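(* Let $l\ge 1$, let $m_1,\dots,m_l$ and $n_1,\dots,n_l$ be positive integers with $n_s\mid m_s$ for each $s$, and put $k_s=m_s/n_s$, $M_s=\prod_{i<s}m_i$, $N_s=\prod_{i<s}n_i$ ($s=1,\dots,l$; so $M_1=N_1=1$), $m=\prod_{s=1}^l m_s$, $n=\prod_{s=1}^l n_s$, $k=\prod_{s=1}^l k_s$ (so $m=kn$). Let $G=\mathbb{Z}_{m_1}\times\cdots\times\mathbb{Z}_{m_l}$ and let $H=\mathbb{Z}_{n_1}\times\cdots\times\mathbb{Z}_{n_l}$, where $\mathbb{Z}_{n_s}$ is regarded as the subgroup of $\mathbb{Z}_{m_s}$ generated by $k_s$. Let $\phi_{\mathrm{st}}$ be the standard ordering of $G$ and $f_{\mathrm{pr}}\colon G\to\mathbb{C}[q]$ the principal specialization, $f_{\mathrm{pr}}(\phi_{\mathrm{st}}(i))=q^i$ for $0\le i<m$. Then $$\Theta(G,H,\phi_{\mathrm{st}},f_{\mathrm{pr}})=\omega^{(k^n)}(\sigma\tau^{-1})\Bigl(\frac{k!}{k^k}\Bigr)^n\prod_{s=1}^l q^{mM_s(k_s-1)/2}\prod_{s=1}^l\bigl(q^{M_sm_s}-1\bigr)^{m(1-1/n_s)},$$ where $\sigma,\tau$ are permutations of $m$ letters determined by the conditions $$(I_{n_l}\otimes\mathbf{1}_{1,k_l})\otimes\cdots\otimes(I_{n_1}\otimes\mathbf{1}_{1,k_1})=(I_n\otimes\mathbf{1}_{1,k})P(\sigma),$$ $$P((1~2~\dots~m_l))\otimes\cdots\otimes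 P((1~2~\dots~m_1))=P(\tau),$$ and the function $\omega^{(k^n)}$ on the symmetric group $\mathfrak{S}_m$ is defined by $$\omega^{(k^n)}(x)=\frac{1}{(k!)^n}\sum_{g\in\mathfrak{S}_k^n}\chi^{(k^n)}(xg)\qquad(x\in\mathfrak{S}_m),$$ where $\chi^{(k^n)}$ is the irreducible character of $\mathfrak{S}_m$ corresponding to the partition $(k^n)=(k,\dots,k)\vdash m$ ($n$ parts).
   Context: Notation. $\mathbb{Z}_r=\mathbb{Z}/r\mathbb{Z}=\{0,1,\dots,r-1\}$. $\lfloor x\rfloor$ is the floor of $x$, and $a\bmod b\in\{0,\dots,b-1\}$ is the remainder of $a$ divided by $b$. $\mathbf{1}_{p,r}$ is the $p\times r$ all-one matrix, $I_n$ the identity matrix. $P(\tau)=(\delta_{i\,\tau(j)})_{i,j}$ is the permutation matrix of $\tau$. The group $\mathfrak{S}_k^n$ is the subgroup of $\mathfrak{S}_{kn}$ of permutations preserving each of the $n$ consecutive blocks of $k$ letters. Kronecker product: for $A=(a(i,j))_{0\le i<m,\,0\le j<n}$ and $B=(b(i,j))_{0\le i<p,\,0\le j<s}$, $A\otimes B=\bigl(a(\lfloor i/p\rfloor,\lfloor j/s\rfloor)\,b(i\bmod p,j\bmod s)\bigr)_{0\le i<mp,\,0\le j<ns}$. Alpha-determinant and wreath determinant: for a square matrix $X=(x_{ij})$ of size $N$ and $\alpha\in\mathbb{C}$, $\det_\alpha X=\sum_{\pi\in\mathfrak{S}_N}\alpha^{\nu(\pi)}x_{\pi(1)1}\cdots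 x_{\pi(N)N}$, where $\nu(\pi)=\sum_{j\ge2}(j-1)c_j(\pi)$ and $c_j(\pi)$ is the number of $j$-cycles of $\pi$. For an $n\times kn$ matrix $X$, $\operatorname{wrdet}_k X=\det_{-1/k}(X\otimes\mathbf{1}_{k,1})$. Wreath determinant of a pair: for a finite group $G$ of order $m=kn$, a subgroup $H=\{h_0,\dots,h_{n-1}\}$ of order $n$, a bijection (ordering) $\phi\colon\{0,\dots,m-1\}\to G$, $g_j=\phi(j)$, and a map (specialization) $f\colon G\to R$ to a commutative ring, $\Theta(G,H,\phi,f)=\operatorname{wrdet}_k X(G,H,\phi,f)$ with $X(G,H,\phi,f)=\bigl(f(h_ig_j^{-1})\bigr)_{0\le i<n,\,0\le j<m}$. Standard ordering of $G=\mathbb{Z}_{m_1}\times\cdots\times\mathbb{Z}_{m_l}$: $\phi_{\mathrm{st}}(i)=\bigl(\lfloor i/M_1\rfloor\bmod m_1,\dots,\lfloor i/M_l\rfloor\bmod m_l\bigr)$ for $0\le i<m$. The elements of $H$ are ordered by letting the $s$-th component of $h_i$ be $k_s\lfloor i/N_s\rfloor\bmod m_s$ ($0\le i<n$), so that $$X(G,H,\phi_{\mathrm{st}},f_{\mathrm{pr}})=\bigl(q^{\varepsilon_l(i,j)}\bigr)_{0\le i<n,\,0\le j<m},\qquad \varepsilon_l(i,j)=\sum_{s=1}^l M_s\bigl((k_s\lfloor i/N_s\rfloor-\lfloor j/M_s\rfloor)\bmod m_s\bigr).$$ *)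

theory Defs
  imports
    Complex_Main
    "HOL-Library.Function_Algebras"
    "HOL-Computational_Algebra.Polynomial"
    "HOL-Combinatorics.Permutations"
    "HOL-Combinatorics.Orbits"
    "HOL-Algebra.Product_Groups"
    "Jordan_Normal_Form.Matrix"
begin

text \<open>
  All indices start at 0: rows and columns of matrices, and the letters on which the symmetric
  group of degree \<open>N\<close> acts, which are \<open>{..<N}\<close>. Permutations are composed as functions.
\<close>

section \<open>Matrices\<close>

definition kronecker :: "'a::times mat \<Rightarrow> 'a mat \<Rightarrow> 'a mat" where
  "kronecker A B = mat (dim_row A * dim_row B) (dim_col A * dim_col B)
     (\<lambda>(i, j). A $$ (i div dim_row B, j div dim_col B) * B $$ (i mod dim_row B, j mod dim_col B))"

text \<open>\<open>kronecker_desc A l\<close> is the product \<open>A l \<otimes> A (l - 1) \<otimes> \<dots> \<otimes> A 1\<close>.\<close>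

fun kronecker_desc :: "(nat \<Rightarrow> 'a::semiring_1 mat) \<Rightarrow> nat \<Rightarrow> 'a mat" where
  "kronecker_desc A 0 = 1\<^sub>m 1"
| "kronecker_desc A (Suc s) = kronecker (A (Suc s)) (kronecker_desc A s)"

definition ones_mat :: "nat \<Rightarrow> nat \<Rightarrow> 'a::one mat" where
  "ones_mat p r = mat p r (\<lambda>_. 1)"

definition perm_mat :: "nat \<Rightarrow> (nat \<Rightarrow> nat) \<Rightarrow> 'a::zero_neq_one mat" where
  "perm_mat N \<tau> = mat N N (\<lambda>(i, j). if i = \<tau> j then 1 else 0)"

text \<open>The cycle written \<open>(1 2 \<dots> r)\<close> for letters numbered from 1.\<close>

definition full_cycle :: "nat \<Rightarrow> nat \<Rightarrow> nat" where
  "full_cycle r j = (if j < r then Suc j mod r else j)"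

section \<open>Alpha-determinant and wreath determinant\<close>

definition cycle_count :: "nat \<Rightarrow> (nat \<Rightarrow> nat) \<Rightarrow> nat \<Rightarrow> nat" where
  "cycle_count N \<pi> j = card {C \<in> Orbits.orbit \<pi> ` {..<N}. card C = j}"

definition perm_nu :: "nat \<Rightarrow> (nat \<Rightarrow> nat) \<Rightarrow> nat" where
  "perm_nu N \<pi> = (\<Sum>j=2..N. (j - 1) * cycle_count N \<pi> j)"

definition alpha_det :: "complex \<Rightarrow> complex poly mat \<Rightarrow> complex poly" where
  "alpha_det \<alpha> X = (\<Sum>\<pi> | \<pi> permutes {..<dim_row X}.
     Polynomial.smult (\<alpha> ^ perm_nu (dim_row X) \<pi>) (\<Prod>j<dim_row X. X $$ (\<pi> j, j)))"

text \<open>Meant for matrices with \<open>n\<close> rows and \<open>k * n\<close> columns.\<close>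

definition wrdet :: "nat \<Rightarrow> complex poly mat \<Rightarrow> complex poly" where
  "wrdet k X = alpha_det (- 1 / of_nat k) (kronecker X (ones_mat k 1))"

text \<open>
  The subgroup \<open>H\<close> comes with an enumeration \<open>h 0, \<dots>, h (card H - 1)\<close>, since the wreath
  determinant may change sign under permutations of the rows.
\<close>

definition pair_matrix ::
  "('g, 'b) monoid_scheme \<Rightarrow> 'g set \<Rightarrow> (nat \<Rightarrow> 'g) \<Rightarrow> (nat \<Rightarrow> 'g) \<Rightarrow> ('g \<Rightarrow> complex poly)
    \<Rightarrow> complex poly mat" where
  "pair_matrix G H h \<phi> f = mat (card H) (order G) (\<lambda>(i, j). f (h i \<otimes>\<^bsub>G\<^esub> inv\<^bsub>G\<^esub> (\<phi> j)))"

definition wrdet_pair ::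
  "('g, 'b) monoid_scheme \<Rightarrow> 'g set \<Rightarrow> (nat \<Rightarrow> 'g) \<Rightarrow> (nat \<Rightarrow> 'g) \<Rightarrow> ('g \<Rightarrow> complex poly)
    \<Rightarrow> complex poly" where
  "wrdet_pair G H h \<phi> f = wrdet (order G div card H) (pair_matrix G H h \<phi> f)"

section \<open>The abelian group and its subgroup\<close>

text \<open>
  Below, \<open>partial_prod m s\<close> is the product of \<open>m i\<close> over \<open>1 \<le> i < s\<close>, which is the
  number written \<open>M\<^sub>s\<close> for \<open>m\<close> and \<open>N\<^sub>s\<close> for \<open>n\<close>.
\<close>

definition partial_prod :: "(nat \<Rightarrow> nat) \<Rightarrow> nat \<Rightarrow> nat" where
  "partial_prod m s = (\<Prod>i\<in>{1..<s}. m i)"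

definition Zprod :: "nat \<Rightarrow> (nat \<Rightarrow> nat) \<Rightarrow> (nat \<Rightarrow> int) monoid" where
  "Zprod l m = product_group {1..l} (\<lambda>s. integer_mod_group (m s))"

text \<open>The reduction modulo \<open>m s\<close> matters only for \<open>k s = m s\<close>.\<close>

definition Zprod_sub :: "nat \<Rightarrow> (nat \<Rightarrow> nat) \<Rightarrow> (nat \<Rightarrow> nat) \<Rightarrow> (nat \<Rightarrow> int) set" where
  "Zprod_sub l m k =
     (\<Pi>\<^sub>E s\<in>{1..l}. generate (integer_mod_group (m s)) {int (k s) mod int (m s)})"

definition std_ordering :: "nat \<Rightarrow> (nat \<Rightarrow> nat) \<Rightarrow> nat \<Rightarrow> nat \<Rightarrow> int" where
  "std_ordering l m i = (\<lambda>s\<in>{1..l}. int ((i div partial_prod m s) mod m s))"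

definition sub_ordering :: "nat \<Rightarrow> (nat \<Rightarrow> nat) \<Rightarrow> (nat \<Rightarrow> nat) \<Rightarrow> nat \<Rightarrow> nat \<Rightarrow> int" where
  "sub_ordering l m n i =
     (\<lambda>s\<in>{1..l}. int ((m s div n s * (i div partial_prod n s)) mod m s))"

definition principal_spec :: "nat \<Rightarrow> (nat \<Rightarrow> nat) \<Rightarrow> (nat \<Rightarrow> int) \<Rightarrow> complex poly" where
  "principal_spec l m g = monom 1 (inv_into {..<\<Prod>s\<in>{1..l}. m s} (std_ordering l m) g)"

section \<open>Irreducible characters of the symmetric group\<close>

interpretation fun_vs: vector_space "\<lambda>(c::complex) (v::'a \<Rightarrow> complex) x. c * v x"
  by unfold_locales (simp_all add: fun_eq_iff algebra_simps)

text \<open>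
  The trace of a linear endomorphism \<open>T\<close> of a finite-dimensional space \<open>V\<close>; it does not
  depend on the chosen basis.
\<close>

definition trace_on :: "('a \<Rightarrow> complex) set \<Rightarrow> (('a \<Rightarrow> complex) \<Rightarrow> 'a \<Rightarrow> complex) \<Rightarrow> complex" where
  "trace_on V T = (let B = (SOME B. fun_vs.independent B \<and> fun_vs.span B = V)
     in \<Sum>b\<in>B. fun_vs.representation B (T b) b)"

text \<open>
  A partition is given by the list of its parts. A tableau is a bijective filling of its diagram
  by \<open>{..<N}\<close>, where \<open>N\<close> is the size of the partition. A tabloid, that is, a tableau up to
  permutations within its rows, is encoded by the function taking each letter to the index of
  its row.
\<close>

definition diagram :: "nat list \<Rightarrow> (nat \<times> nat) set" where
  "diagram ls = {(i, j). i < length ls \<and> j < ls ! i}"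

definition is_tableau :: "nat list \<Rightarrow> (nat \<times> nat \<Rightarrow> nat) \<Rightarrow> bool" where
  "is_tableau ls t \<longleftrightarrow> bij_betw t (diagram ls) {..<sum_list ls}"

definition tabloid :: "nat list \<Rightarrow> (nat \<times> nat \<Rightarrow> nat) \<Rightarrow> nat \<Rightarrow> nat" where
  "tabloid ls t = (\<lambda>x\<in>{..<sum_list ls}. fst (inv_into (diagram ls) t x))"

definition column :: "nat list \<Rightarrow> (nat \<times> nat \<Rightarrow> nat) \<Rightarrow> nat \<Rightarrow> nat set" where
  "column ls t j = t ` {c \<in> diagram ls. snd c = j}"

definition column_stabilizer :: "nat list \<Rightarrow> (nat \<times> nat \<Rightarrow> nat) \<Rightarrow> (nat \<Rightarrow> nat) set" where
  "column_stabilizer ls t =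
     {\<pi>. \<pi> permutes {..<sum_list ls} \<and> (\<forall>j. \<pi> ` column ls t j = column ls t j)}"

text \<open>
  Vectors of the permutation module are complex functions on tabloids. The polytabloid of \<open>t\<close>
  is the sum of \<open>sign \<pi>\<close> times the tabloid of \<open>\<pi> \<circ> t\<close>, and the Specht module is spanned by
  all polytabloids. Since a permutation \<open>\<pi>\<close> takes the tabloid \<open>r\<close> to \<open>r \<circ> \<pi>\<^sup>-\<^sup>1\<close>, it takes
  the vector \<open>v\<close> to \<open>\<lambda>r. v (r \<circ> \<pi>)\<close>.
\<close>

definition polytabloid :: "nat list \<Rightarrow> (nat \<times> nat \<Rightarrow> nat) \<Rightarrow> (nat \<Rightarrow> nat) \<Rightarrow> complex" where
  "polytabloid ls t = (\<lambda>r. \<Sum>\<pi>\<in>column_stabilizer ls t.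
     if r = tabloid ls (\<pi> \<circ> t) then of_int (sign \<pi>) else 0)"

definition specht :: "nat list \<Rightarrow> ((nat \<Rightarrow> nat) \<Rightarrow> complex) set" where
  "specht ls = fun_vs.span {polytabloid ls t | t. is_tableau ls t}"

definition perm_action ::
  "(nat \<Rightarrow> nat) \<Rightarrow> ((nat \<Rightarrow> nat) \<Rightarrow> complex) \<Rightarrow> (nat \<Rightarrow> nat) \<Rightarrow> complex" where
  "perm_action \<pi> v = (\<lambda>r. v (r \<circ> \<pi>))"

text \<open>
  Over the complex numbers the Specht module is the irreducible module of the partition \<open>ls\<close>;
  the partition \<open>[N]\<close> gives the trivial character and \<open>replicate N 1\<close> the sign.
\<close>

definition irr_char :: "nat list \<Rightarrow> (nat \<Rightarrow> nat) \<Rightarrow> complex" where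
  "irr_char ls \<pi> = trace_on (specht ls) (perm_action \<pi>)"

definition block_subgroup :: "nat \<Rightarrow> nat \<Rightarrow> (nat \<Rightarrow> nat) set" where
  "block_subgroup k n = {g. g permutes {..<k * n} \<and> (\<forall>x<k * n. g x div k = x div k)}"

definition omega :: "nat \<Rightarrow> nat \<Rightarrow> (nat \<Rightarrow> nat) \<Rightarrow> complex" where
  "omega k n x =
     1 / (fact k) ^ n * (\<Sum>g\<in>block_subgroup k n. irr_char (replicate n k) (x \<circ> g))"

end

theory Submission
  imports Defs
begin

text \<open>
  Ordering the columns by \<open>\<tau>\<close> turns each tensor factor of the matrix of the pair into a circulant
  matrix with \<open>k\<^sub>s\<close>-fold repeated columns, up to powers of \<open>q\<close> in the columns. The circulant
  matrices have explicit triangular factorisations, and so has their Kronecker product; since the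
  wreath determinant is multiplied by \<open>(det A)^k\<close> under multiplication by a triangular matrix \<open>A\<close>,
  only the wreath determinant of \<open>(I\<^sub>n \<otimes> 1\<^sub>1\<^sub>,\<^sub>k) P(\<sigma> \<tau>\<^sup>-\<^sup>1)\<close> remains.

  As a function of the permutation it is a vector of the permutation module on words with \<open>k\<close> copies
  of each of \<open>n\<close> letters. It is invariant under the block subgroup, and it is annihilated by the
  symmetrisers of all sets of \<open>k + 1\<close> positions because \<open>\<alpha> = - 1 / k\<close>. Such vectors form a line,
  which meets the Specht module of \<open>(k, \<dots>, k)\<close>. Hence the average over the block subgroup acts on the
  Specht module with rank one, and its trace, the function \<open>\<omega>\<close>, is proportional to the vector.
\<close>

section \<open>Mixed radix digits\<close>

text \<open>Multiplication by a triangular matrix amounts to row operations. In the blown-up matrix,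
  replacing one of the k copies of a row by a different row produces k + 1 equal rows, and there the
  parameter -1/k gives 0. The triangular factors contain negative powers of q, so the computation
  takes place at complex numbers z different from 0 and returns to polynomials at the end.

  The permutation \<tau> shifts every digit of the column index by one. Unshifted, the columns k_s c
  + d of a block have the exponents (k_s i - k_s c - d) mod m_s, which wrap around at another row
  for d = 0 than for d > 0. Shifted, they are k_s ((i - c - 1) mod n_s) + (k_s - 1 - d), so the
  columns of a block are proportional. Such columns become neighbours under \<sigma>.

  On the side of representations, the trace results from two facts: the Specht module lies among the
  vectors killed by the symmetrisers, and it contains a polytabloid with value 1 at the base
  word.\<close>

definition digit :: "(nat \<Rightarrow> nat) \<Rightarrow> nat \<Rightarrow> nat \<Rightarrow> nat" where
  "digit r s i = (i div partial_prod r s) mod r s"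

lemma partial_prod_one [simp]: "partial_prod r (Suc 0) = 1"
  by (simp add: partial_prod_def)

lemma partial_prod_Suc:
  assumes "s \<ge> 1"
  shows "partial_prod r (Suc s) = partial_prod r s * r s"
  using assms by (simp add: partial_prod_def mult.commute)

lemma partial_prod_Suc_eq: "partial_prod r (Suc l) = (\<Prod>s\<in>{1..l}. r s)"
  unfolding partial_prod_def by (simp add: atLeastLessThanSuc_atLeastAtMost)

lemma partial_prod_dvd:
  assumes "s \<in> {1..l}"
  shows "partial_prod r s * r s dvd partial_prod r (Suc l)"
proof -
  have "partial_prod r (Suc s) dvd partial_prod r (Suc l)"
    unfolding partial_prod_def using assms by (intro prod_dvd_prod_subset) auto
  then show ?thesis using assms by (simp add: partial_prod_Suc)
qed

lemma digit_less:
  assumes "r s > 0"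
  shows "digit r s i < r s"
  using assms by (simp add: digit_def)

lemma mod_div_mod_cancel:
  fixes x p q c :: nat
  assumes "p * q dvd c"
  shows "(x mod c) div p mod q = x div p mod q"
proof (cases "p = 0")
  case False
  obtain d where "c = p * (q * d)" using assms by (metis dvd_def mult.assoc)
  then have "(x mod c) div p = x div p mod (q * d)"
    using False by (simp add: mod_mult2_eq)
  then show ?thesis by (simp add: mod_mod_cancel)
qed simp

lemma digit_mod:
  assumes "s \<in> {1..l}"
  shows "digit r s (i mod partial_prod r (Suc l)) = digit r s i"
  unfolding digit_def by (rule mod_div_mod_cancel[OF partial_prod_dvd[OF assms]])

lemma mod_eq_sum_digits:
  "i mod partial_prod r (Suc l) = (\<Sum>s\<in>{1..l}. partial_prod r s * digit r s i)"
proof (induction l)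
  case (Suc l)
  have "i mod partial_prod r (Suc (Suc l))
      = partial_prod r (Suc l) * digit r (Suc l) i + i mod partial_prod r (Suc l)"
    by (simp add: partial_prod_Suc mod_mult2_eq digit_def)
  then show ?case using Suc by simp
qed simp

lemma eq_sum_digits:
  assumes "i < partial_prod r (Suc l)"
  shows "i = (\<Sum>s\<in>{1..l}. partial_prod r s * digit r s i)"
  using mod_eq_sum_digits[of i r l] assms by simp

lemma digits_inject:
  assumes "i < partial_prod r (Suc l)" "j < partial_prod r (Suc l)"
    and "\<And>s. s \<in> {1..l} \<Longrightarrow> digit r s i = digit r s j"
  shows "i = j"
proof -
  have "(\<Sum>s\<in>{1..l}. partial_prod r s * digit r s i) = (\<Sum>s\<in>{1..l}. partial_prod r s * digit r s j)"
    by (rule sum.cong) (use assms(3) in auto)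
  then show ?thesis using assms(1,2) eq_sum_digits by metis
qed

text \<open>The existence half of mixed radix expansions, with \<open>digits_inject\<close> as the
  uniqueness half. Together they allow \<sigma>, \<tau> and the quotients in the group to be
  described digit by digit.\<close>

lemma number_of_digits:
  assumes "\<And>s. s \<in> {1..l} \<Longrightarrow> d s < r s"
  shows "(\<Sum>s\<in>{1..l}. partial_prod r s * d s) < partial_prod r (Suc l) \<and>
    (\<forall>s\<in>{1..l}. digit r s (\<Sum>s\<in>{1..l}. partial_prod r s * d s) = d s)"
  using assms
proof (induction l)
  case (Suc l)
  define x where "x = (\<Sum>s\<in>{1..l}. partial_prod r s * d s)"
  have IH: "x < partial_prod r (Suc l)" "\<forall>s\<in>{1..l}. digit r s x = d s"
    using Suc unfolding x_def by auto
  have d: "d (Suc l) < r (Suc l)" using Suc by simp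
  define y where "y = x + partial_prod r (Suc l) * d (Suc l)"
  have y: "(\<Sum>s\<in>{1..Suc l}. partial_prod r s * d s) = y"
    unfolding y_def x_def by simp
  have "y < partial_prod r (Suc l) * (d (Suc l) + 1)" using IH(1) by (simp add: y_def)
  also have "\<dots> \<le> partial_prod r (Suc l) * r (Suc l)"
    by (rule mult_le_mono2) (use d in simp)
  finally have lt: "y < partial_prod r (Suc (Suc l))" by (simp add: partial_prod_Suc)
  have "digit r s y = d s" if "s \<in> {1..Suc l}" for s
  proof (cases "s = Suc l")
    case True
    have "y div partial_prod r (Suc l) = d (Suc l)" using IH(1) by (simp add: y_def)
    then show ?thesis using d True by (simp add: digit_def)
  next
    case False
    then have s: "s \<in> {1..l}" using that by auto
    have "y mod partial_prod r (Suc l) = x" using IH(1) by (simp add: y_def)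
    then have "digit r s y = digit r s x" using digit_mod[OF s, of r y] by simp
    then show ?thesis using IH(2) s by simp
  qed
  then show ?case using lt unfolding y by simp
qed simp

section \<open>Sums and products over all digit vectors\<close>

lemma (in comm_monoid_set) lessThan_mult:
  fixes a b :: nat
  shows "F (\<lambda>i. g (i mod a) (i div a)) {..<a * b} = F (\<lambda>x. F (g x) {..<b}) {..<a}"
proof -
  have "F (\<lambda>i. g (i mod a) (i div a)) {..<a * b} = F (\<lambda>(x, y). g x y) ({..<a} \<times> {..<b})"
  proof (rule reindex_bij_witness[where i = "\<lambda>(x, y). x + a * y" and j = "\<lambda>i. (i mod a, i div a)"])
    fix p assume "p \<in> {..<a} \<times> {..<b}"
    then obtain x y where p: "p = (x, y)" "x < a" "y < b" by auto
    have "x + a * y < a * (y + 1)" using p by simp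
    also have "\<dots> \<le> a * b" by (rule mult_le_mono2) (use p in simp)
    finally show "(case p of (x, y) \<Rightarrow> x + a * y) \<in> {..<a * b}" using p by simp
  qed (auto simp: less_mult_imp_div_less mult.commute intro!: mod_less_divisor gr0I)
  then show ?thesis by (simp add: cartesian_product)
qed

text \<open>The mixed product rule for Kronecker products in terms of entries: the sum over the
  inner index splits into one sum for each digit.\<close>

lemma sum_prod_digits:
  fixes f :: "nat \<Rightarrow> nat \<Rightarrow> 'a::comm_semiring_1"
  shows "(\<Sum>i<partial_prod r (Suc l). \<Prod>s\<in>{1..l}. f s (digit r s i)) = (\<Prod>s\<in>{1..l}. \<Sum>b<r s. f s b)"
proof (induction l)
  case (Suc l)
  let ?P = "partial_prod r (Suc l)"
  have "(\<Sum>i<partial_prod r (Suc (Suc l)). \<Prod>s\<in>{1..Suc l}. f s (digit r s i))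
      = (\<Sum>i<?P * r (Suc l). (\<Prod>s\<in>{1..l}. f s (digit r s (i mod ?P))) * f (Suc l) (i div ?P))"
  proof (rule sum.cong)
    show "{..<partial_prod r (Suc (Suc l))} = {..<?P * r (Suc l)}" by (simp add: partial_prod_Suc)
    fix i assume "i \<in> {..<?P * r (Suc l)}"
    then have "i div ?P < r (Suc l)" by (simp add: less_mult_imp_div_less mult.commute)
    then have "digit r (Suc l) i = i div ?P" by (simp add: digit_def)
    moreover have "(\<Prod>s\<in>{1..l}. f s (digit r s (i mod ?P))) = (\<Prod>s\<in>{1..l}. f s (digit r s i))"
      by (rule prod.cong) (simp_all add: digit_mod)
    ultimately show "(\<Prod>s\<in>{1..Suc l}. f s (digit r s i))
      = (\<Prod>s\<in>{1..l}. f s (digit r s (i mod ?P))) * f (Suc l) (i div ?P)"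
      by (simp add: mult.commute)
  qed
  also have "\<dots> = (\<Sum>x<?P. \<Sum>y<r (Suc l). (\<Prod>s\<in>{1..l}. f s (digit r s x)) * f (Suc l) y)"
    by (rule sum.lessThan_mult[of "\<lambda>x y. (\<Prod>s\<in>{1..l}. f s (digit r s x)) * f (Suc l) y"])
  also have "\<dots> = (\<Prod>s\<in>{1..l}. \<Sum>b<r s. f s b) * (\<Sum>y<r (Suc l). f (Suc l) y)"
    unfolding Suc[symmetric] by (rule sum_product[symmetric])
  finally show ?case by (simp add: mult.commute)
qed simp

lemma prod_div_mod:
  fixes f :: "nat \<Rightarrow> 'a::comm_semiring_1"
  shows "(\<Prod>i<a * (b * c). f (i div a mod b)) = (\<Prod>y<b. f y) ^ (a * c)"
proof -
  have "(\<Prod>i<a * (b * c). f (i div a mod b)) = (\<Prod>x<a. \<Prod>y<b * c. f (y mod b))"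
    by (rule prod.lessThan_mult[of "\<lambda>x y. f (y mod b)"])
  also have "(\<Prod>y<b * c. f (y mod b)) = (\<Prod>y<b. \<Prod>z<c. f y)"
    by (rule prod.lessThan_mult[of "\<lambda>x y. f x"])
  also have "(\<Prod>y<b. \<Prod>z<c. f y) = (\<Prod>y<b. f y) ^ c"
    by (simp add: prod_power_distrib)
  finally show ?thesis by (simp add: power_mult[symmetric] mult.commute[of c a])
qed

text \<open>Every value of the digit is taken equally often. This is the origin of the exponents n /
  n_s and m / m_s.\<close>

lemma prod_digit:
  fixes f :: "nat \<Rightarrow> 'a::comm_semiring_1"
  assumes s: "s \<in> {1..l}" and pos: "r s > 0"
  shows "(\<Prod>i<partial_prod r (Suc l). f (digit r s i)) = (\<Prod>y<r s. f y) ^ (partial_prod r (Suc l) div r s)"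
proof -
  obtain c where c: "partial_prod r (Suc l) = partial_prod r s * r s * c"
    using partial_prod_dvd[OF s, of r] by (auto simp: dvd_def)
  have "partial_prod r (Suc l) div r s = partial_prod r s * c"
    using pos by (simp add: c)
  then show ?thesis
    using prod_div_mod[of f "partial_prod r s" "r s" c] c by (simp add: digit_def mult.assoc)
qed

section \<open>Entries of iterated Kronecker products\<close>

lemma dim_kronecker_desc:
  assumes "\<And>s. s \<in> {1..l} \<Longrightarrow> A s \<in> carrier_mat (ra s) (ca s)"
  shows "kronecker_desc A l \<in> carrier_mat (partial_prod ra (Suc l)) (partial_prod ca (Suc l))"
  using assms
proof (induction l)
  case (Suc l)
  then have "kronecker_desc A l \<in> carrier_mat (partial_prod ra (Suc l)) (partial_prod ca (Suc l))"
    "A (Suc l) \<in> carrier_mat (ra (Suc l)) (ca (Suc l))" by simp_all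
  then show ?case
    by (simp add: kronecker_def partial_prod_Suc mult.commute[of "ra (Suc l)"] mult.commute[of "ca (Suc l)"])
qed simp

text \<open>The left factor of a Kronecker product belongs to the most significant digit, so the
  descending order of the factors matches the digits taken with \<open>partial_prod\<close>.\<close>

lemma kronecker_desc_index:
  assumes "\<And>s. s \<in> {1..l} \<Longrightarrow> A s \<in> carrier_mat (ra s) (ca s)"
    and "i < partial_prod ra (Suc l)" "j < partial_prod ca (Suc l)"
  shows "kronecker_desc A l $$ (i, j) = (\<Prod>s\<in>{1..l}. A s $$ (digit ra s i, digit ca s j))"
  using assms
proof (induction l arbitrary: i j)
  case (Suc l)
  let ?R = "partial_prod ra (Suc l)" and ?C = "partial_prod ca (Suc l)"
  have dims: "kronecker_desc A l \<in> carrier_mat ?R ?C"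
    using Suc.prems by (intro dim_kronecker_desc) auto
  have A: "A (Suc l) \<in> carrier_mat (ra (Suc l)) (ca (Suc l))" using Suc.prems by simp
  have lt: "i < ?R * ra (Suc l)" "j < ?C * ca (Suc l)"
    using Suc.prems by (simp_all add: partial_prod_Suc)
  then have pos: "?R > 0" "?C > 0" by (auto intro: gr0I)
  have IH: "kronecker_desc A l $$ (i mod ?R, j mod ?C)
      = (\<Prod>s\<in>{1..l}. A s $$ (digit ra s (i mod ?R), digit ca s (j mod ?C)))"
    using Suc.prems(1) pos by (intro Suc.IH) auto
  have dv: "i div ?R < ra (Suc l)" "j div ?C < ca (Suc l)"
    using lt by (simp_all add: less_mult_imp_div_less mult.commute)
  have "kronecker_desc A (Suc l) $$ (i, j)
      = A (Suc l) $$ (i div ?R, j div ?C) * kronecker_desc A l $$ (i mod ?R, j mod ?C)"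
    using carrier_matD[OF dims] carrier_matD[OF A] lt
    by (simp add: kronecker_def mult.commute[of "ra (Suc l)"] mult.commute[of "ca (Suc l)"])
  also have "\<dots> = A (Suc l) $$ (digit ra (Suc l) i, digit ca (Suc l) j) * (\<Prod>s\<in>{1..l}. A s $$ (digit ra s i, digit ca s j))"
    proof -
    have "digit ra (Suc l) i = i div ?R" "digit ca (Suc l) j = j div ?C"
      using dv by (simp_all add: digit_def)
    then show ?thesis unfolding IH by (simp add: digit_mod)
  qed
  finally show ?case by (simp add: mult.commute)
qed (simp add: partial_prod_def)

section \<open>Cycle statistics and invariant colourings\<close>

text \<open>An invariant colouring is constant on cycles, so these sets count cycles in exponential
  form. They are easier to transport along maps than the sets of cycles.\<close>

definition colourings :: "nat \<Rightarrow> nat \<Rightarrow> (nat \<Rightarrow> nat) \<Rightarrow> (nat \<Rightarrow> nat) set" where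
  "colourings N k \<pi> = {f \<in> {..<N} \<rightarrow>\<^sub>E {..<k}. f \<circ> \<pi> = f}"

lemma finite_colourings [simp]: "finite (colourings N k \<pi>)"
  unfolding colourings_def by (simp add: finite_PiE)

context
  fixes N :: nat and \<pi> :: "nat \<Rightarrow> nat"
  assumes perm: "\<pi> permutes {..<N}"
begin

private lemma permutation: "permutation \<pi>"
  using perm by (auto simp: permutation_permutes)

private lemma orbit_eq: "y \<in> orbit \<pi> x \<Longrightarrow> orbit \<pi> y = orbit \<pi> x"
  by (rule orbit_cyclic_eq3[OF cyclic_on_orbit'[OF permutation]])

private lemma self_in: "x \<in> orbit \<pi> x"
  using permutation_self_in_orbit[OF permutation] .

lemma orbit_subset_lessThan: "x < N \<Longrightarrow> orbit \<pi> x \<subseteq> {..<N}"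
  using permutes_orbit_subset[OF perm] by simp

lemma Union_orbits: "\<Union>(orbit \<pi> ` {..<N}) = {..<N}"
proof (intro subset_antisym subsetI)
  fix y assume "y \<in> {..<N}"
  then show "y \<in> \<Union>(orbit \<pi> ` {..<N})" using self_in[of y] by (intro UN_I)
next
  fix y assume "y \<in> \<Union>(orbit \<pi> ` {..<N})"
  then obtain x where "x < N" "y \<in> orbit \<pi> x" by auto
  then show "y \<in> {..<N}" using orbit_subset_lessThan[of x] by (auto simp del: lessThan_iff)
qed

lemma sum_card_orbits: "(\<Sum>C\<in>orbit \<pi> ` {..<N}. card C) = N"
proof -
  have "card (\<Union>(orbit \<pi> ` {..<N})) = (\<Sum>C\<in>orbit \<pi> ` {..<N}. card C)"
  proof (rule card_Union_disjoint)
    show "disjoint (orbit \<pi> ` {..<N})"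
      unfolding pairwise_def disjnt_def by (auto dest: orbit_eq)
    show "finite C" if "C \<in> orbit \<pi> ` {..<N}" for C
      using that orbit_subset_lessThan finite_subset[of C "{..<N}"] by auto
  qed
  then show ?thesis by (simp add: Union_orbits)
qed

text \<open>A cycle of length j contributes j - 1 to \<open>perm_nu\<close>, which is therefore the
  number of letters minus the number of cycles, fixed points included.\<close>

lemma perm_nu_add_card_orbits: "perm_nu N \<pi> + card (orbit \<pi> ` {..<N}) = N"
proof -
  let ?O = "orbit \<pi> ` {..<N}"
  have bounds: "1 \<le> card C \<and> card C \<le> N" if "C \<in> ?O" for C
  proof -
    from that obtain x where "C = orbit \<pi> x" "x \<in> {..<N}" by (rule imageE)
    then have x: "x < N" "C = orbit \<pi> x" by simp_all
    have sub: "C \<subseteq> {..<N}" using orbit_subset_lessThan x by simp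
    then have "finite C" using finite_subset by blast
    then have "card C > 0" using self_in x by (auto simp: card_gt_0_iff)
    moreover have "card C \<le> N" using card_mono[OF _ sub] by simp
    ultimately show ?thesis by simp
  qed
  have "perm_nu N \<pi> = (\<Sum>j\<in>{1..N}. (j - 1) * cycle_count N \<pi> j)"
    unfolding perm_nu_def by (rule sum.mono_neutral_left) auto
  also have "\<dots> = (\<Sum>j\<in>{1..N}. \<Sum>C\<in>{C \<in> ?O. card C = j}. card C - 1)"
    by (rule sum.cong) (simp_all add: cycle_count_def)
  also have "\<dots> = (\<Sum>C\<in>?O. card C - 1)"
    by (rule sum.group) (use bounds in auto)
  finally have "perm_nu N \<pi> + card ?O = (\<Sum>C\<in>?O. (card C - 1) + 1)"
    by (simp only: sum.distrib card_eq_sum)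
  also have "\<dots> = (\<Sum>C\<in>?O. card C)"
  proof (rule sum.cong)
    fix C assume "C \<in> ?O"
    then show "card C - 1 + 1 = card C" using bounds[of C] by simp
  qed simp
  finally show ?thesis by (simp add: sum_card_orbits)
qed

lemma card_colourings: "card (colourings N k \<pi>) = k ^ card (orbit \<pi> ` {..<N})"
proof -
  let ?O = "orbit \<pi> ` {..<N}"
  define \<Phi> where "\<Phi> F = (\<lambda>x\<in>{..<N}. F (orbit \<pi> x))" for F :: "nat set \<Rightarrow> nat"
  have "bij_betw \<Phi> (?O \<rightarrow>\<^sub>E {..<k}) (colourings N k \<pi>)"
  proof (rule bij_betw_imageI)
    show "inj_on \<Phi> (?O \<rightarrow>\<^sub>E {..<k})"
    proof (rule inj_onI)
      fix F F' assume F: "F \<in> ?O \<rightarrow>\<^sub>E {..<k}" "F' \<in> ?O \<rightarrow>\<^sub>E {..<k}" "\<Phi> F = \<Phi> F'"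
      show "F = F'"
      proof (rule PiE_ext[OF F(1,2)])
        fix C assume "C \<in> ?O"
        then obtain x where x: "x < N" "C = orbit \<pi> x" by auto
        show "F C = F' C" using fun_cong[OF F(3), of x] x by (simp add: \<Phi>_def)
      qed
    qed
    show "\<Phi> ` (?O \<rightarrow>\<^sub>E {..<k}) = colourings N k \<pi>"
    proof (intro subset_antisym subsetI)
      fix f assume "f \<in> \<Phi> ` (?O \<rightarrow>\<^sub>E {..<k})"
      then obtain F where F: "F \<in> ?O \<rightarrow>\<^sub>E {..<k}" "f = \<Phi> F" by auto
      have "f (\<pi> x) = f x" for x
      proof (cases "x < N")
        case True
        then have "\<pi> x < N" using permutes_in_image[OF perm, of x] by simp
        moreover have "orbit \<pi> (\<pi> x) = orbit \<pi> x" by (rule orbit_eq) (rule orbit.base)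
        ultimately show ?thesis using True F by (simp add: \<Phi>_def)
      next
        case False
        then show ?thesis using permutes_not_in[OF perm, of x] by simp
      qed
      moreover have "f \<in> {..<N} \<rightarrow>\<^sub>E {..<k}" using F by (auto simp: \<Phi>_def PiE_iff)
      ultimately show "f \<in> colourings N k \<pi>" by (simp add: colourings_def fun_eq_iff)
    next
      fix f assume f: "f \<in> colourings N k \<pi>"
      have const: "f y = f x" if "y \<in> orbit \<pi> x" for x y
        using that
      proof induction
        case base
        show ?case using f by (simp add: colourings_def fun_eq_iff)
      next
        case (step y)
        then show ?case using f by (simp add: colourings_def fun_eq_iff)
      qed
      define F where "F = (\<lambda>C\<in>?O. f (SOME x. x \<in> C))"
      have F: "F (orbit \<pi> x) = f x" if "x < N" for x
        using that const[OF someI[of "\<lambda>y. y \<in> orbit \<pi> x", OF self_in]] by (simp add: F_def)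
      have "F \<in> ?O \<rightarrow>\<^sub>E {..<k}"
        using F f by (auto simp: PiE_iff colourings_def F_def[unfolded restrict_def] extensional_def)
      moreover have "f = \<Phi> F"
        using F f by (auto simp: \<Phi>_def colourings_def PiE_iff extensional_def fun_eq_iff)
      ultimately show "f \<in> \<Phi> ` (?O \<rightarrow>\<^sub>E {..<k})" by blast
    qed
  qed
  then have "card (colourings N k \<pi>) = card (?O \<rightarrow>\<^sub>E {..<k})"
    by (simp add: bij_betw_same_card)
  then show ?thesis by (simp add: card_PiE)
qed

end

text \<open>The transposition makes \<open>a\<close> a fixed point, so that its colour becomes free.\<close>

lemma card_colourings_transpose:
  assumes perm: "\<pi> permutes {..<N}" and a: "\<pi> a \<noteq> a"
  shows "card (colourings N k (transpose a (\<pi> a) \<circ> \<pi>)) = k * card (colourings N k \<pi>)"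
proof -
  define b where "b = \<pi> a"
  define \<rho> where "\<rho> = transpose a b \<circ> \<pi>"
  have aN: "a < N" using a permutes_not_in[OF perm, of a] by auto
  have bN: "b < N" using permutes_in_image[OF perm, of a] aN by (simp add: b_def)
  have ab: "a \<noteq> b" using a by (simp add: b_def)
  have inj: "\<pi> x = \<pi> y \<longleftrightarrow> x = y" for x y using permutes_inj[OF perm] by (auto dest: injD)
  \<comment> \<open>Overwriting the colour of \<open>a\<close> loses nothing: for a colouring
    invariant under \<pi> it equals that of \<open>b = \<pi> a\<close>, from which the inverse map
    restores it.\<close>
  have "bij_betw (\<lambda>(c, f). f(a := c)) ({..<k} \<times> colourings N k \<pi>) (colourings N k \<rho>)"
  proof (rule bij_betw_byWitness[where f' = "\<lambda>g. (g a, g(a := g b))"])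
    have "f b = f a" if "f \<in> colourings N k \<pi>" for f
      using that by (simp add: colourings_def b_def fun_eq_iff)
    then show "\<forall>p\<in>{..<k} \<times> colourings N k \<pi>. (\<lambda>g. (g a, g(a := g b))) (case p of (c, f) \<Rightarrow> f(a := c)) = p"
      using ab by auto
    show "\<forall>g\<in>colourings N k \<rho>. (case (g a, g(a := g b)) of (c, f) \<Rightarrow> f(a := c)) = g"
      by auto
    show "(\<lambda>(c, f). f(a := c)) ` ({..<k} \<times> colourings N k \<pi>) \<subseteq> colourings N k \<rho>"
    proof (rule image_subsetI)
      fix p assume "p \<in> {..<k} \<times> colourings N k \<pi>"
      then obtain c f where p: "p = (c, f)" and c: "c \<in> {..<k}" and f: "f \<in> colourings N k \<pi>"
        by auto
      have inv: "f (\<pi> x) = f x" for x using f by (simp add: colourings_def fun_eq_iff)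
      have "(f(a := c)) (\<rho> x) = (f(a := c)) x" for x
        using inv[of x] inv[of a] inj[of x a] ab unfolding \<rho>_def b_def
        by (auto simp: transpose_def)
      then show "(case p of (c, f) \<Rightarrow> f(a := c)) \<in> colourings N k \<rho>"
        using f c aN p by (auto simp: colourings_def fun_eq_iff PiE_iff extensional_def)
    qed
    show "(\<lambda>g. (g a, g(a := g b))) ` colourings N k \<rho> \<subseteq> {..<k} \<times> colourings N k \<pi>"
    proof (rule image_subsetI)
      fix g assume g: "g \<in> colourings N k \<rho>"
      have inv: "g (\<rho> x) = g x" for x using g by (simp add: colourings_def fun_eq_iff)
      have "(g(a := g b)) (\<pi> x) = (g(a := g b)) x" for x
        using inv[of x] inj[of x a] ab unfolding \<rho>_def b_def
        by (auto simp: transpose_def split: if_splits)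
      then show "(g a, g(a := g b)) \<in> {..<k} \<times> colourings N k \<pi>"
        using g aN bN by (auto simp: colourings_def fun_eq_iff PiE_iff extensional_def)
    qed
  qed
  then show ?thesis
    by (simp add: bij_betw_same_card[symmetric] card_cartesian_product \<rho>_def b_def)
qed

text \<open>Splitting off a moved letter as a fixed point flips the sign, adds one cycle and lowers
  the number of moved letters, on which the induction runs. The additional cycle is read off from
  the colourings with 2 colours, as a power of 2 determines its exponent.\<close>

lemma sign_eq_orbits:
  assumes "\<pi> permutes {..<N}"
  shows "sign \<pi> = (- 1) ^ (N - card (orbit \<pi> ` {..<N}))"
  using assms
proof (induction "card {x. x < N \<and> \<pi> x \<noteq> x}" arbitrary: \<pi> rule: less_induct)
  case less
  note perm = less.prems
  have le: "card (orbit \<rho> ` {..<N}) \<le> N" for \<rho>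
    using card_image_le[of "{..<N}" "orbit \<rho>"] by simp
  show ?case
  proof (cases "\<pi> = id")
    case True
    have "colourings N 2 id = ({..<N} \<rightarrow>\<^sub>E {..<2})" by (auto simp: colourings_def)
    then have "(2::nat) ^ card (orbit \<pi> ` {..<N}) = 2 ^ N"
      using card_colourings[OF perm, of 2] True by (simp add: card_PiE)
    then show ?thesis using True by simp
  next
    case False
    then obtain a where a: "\<pi> a \<noteq> a" by (auto simp: fun_eq_iff)
    define \<rho> where "\<rho> = transpose a (\<pi> a) \<circ> \<pi>"
    have aN: "a < N" using a permutes_not_in[OF perm, of a] by auto
    have bN: "\<pi> a < N" using permutes_in_image[OF perm, of a] aN by simp
    have swap: "transpose a (\<pi> a) permutes {..<N}"
      using aN bN by (simp add: permutes_swap_id)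
    have \<rho>: "\<rho> permutes {..<N}" unfolding \<rho>_def by (rule permutes_compose[OF perm swap])
    have "{x. x < N \<and> \<rho> x \<noteq> x} \<subseteq> {x. x < N \<and> \<pi> x \<noteq> x}"
    proof clarsimp
      fix x assume "\<rho> x \<noteq> x" "\<pi> x = x"
      then have "x = a \<or> x = \<pi> a" by (auto simp: \<rho>_def transpose_def split: if_splits)
      then show False using a \<open>\<pi> x = x\<close> injD[OF permutes_inj[OF perm], of x a] by auto
    qed
    moreover have "\<rho> a = a" by (simp add: \<rho>_def)
    ultimately have "{x. x < N \<and> \<rho> x \<noteq> x} \<subset> {x. x < N \<and> \<pi> x \<noteq> x}"
      using a aN by blast
    then have lt: "card {x. x < N \<and> \<rho> x \<noteq> x} < card {x. x < N \<and> \<pi> x \<noteq> x}"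
      by (intro psubset_card_mono) auto
    have "sign \<rho> = - sign \<pi>"
      using a permutes_imp_permutation[OF _ perm] permutes_imp_permutation[OF _ swap]
      by (simp add: \<rho>_def sign_compose sign_swap_id)
    moreover have "(2::nat) ^ card (orbit \<rho> ` {..<N}) = 2 ^ Suc (card (orbit \<pi> ` {..<N}))"
      using card_colourings_transpose[OF perm a, of 2] card_colourings[OF perm, of 2]
        card_colourings[OF \<rho>, of 2] by (simp add: \<rho>_def)
    then have "card (orbit \<rho> ` {..<N}) = Suc (card (orbit \<pi> ` {..<N}))" by (simp only: power_inject_exp)
    then have "N - card (orbit \<pi> ` {..<N}) = Suc (N - card (orbit \<rho> ` {..<N}))"
      using le[of \<rho>] by simp
    ultimately show ?thesis using less.hyps[OF lt \<rho>] by simp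
  qed
qed

section \<open>The weight of a permutation for the parameter -1/k\<close>

definition alpha_wt :: "nat \<Rightarrow> nat \<Rightarrow> (nat \<Rightarrow> nat) \<Rightarrow> complex" where
  "alpha_wt k N \<pi> = (- 1 / of_nat k) ^ perm_nu N \<pi>"

text \<open>
  Up to normalisation, the weight is the supertrace of \<open>\<pi>\<close> on the \<open>N\<close>-th tensor power of an odd
  space of dimension \<open>k\<close>. All special properties of the parameter \<open>- 1 / k\<close> come from this formula.
\<close>

lemma alpha_wt_eq:
  assumes "\<pi> permutes {..<N}" "k > 0"
  shows "alpha_wt k N \<pi> = of_int (sign \<pi>) * of_nat (card (colourings N k \<pi>)) / of_nat k ^ N"
proof -
  let ?c = "card (orbit \<pi> ` {..<N})"
  have nu: "perm_nu N \<pi> + ?c = N" by (rule perm_nu_add_card_orbits[OF assms(1)])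
  then have eq: "N - ?c = perm_nu N \<pi>" by simp
  have "(of_nat k :: complex) ^ N = of_nat k ^ perm_nu N \<pi> * of_nat k ^ ?c"
    by (subst nu[symmetric]) (rule power_add)
  moreover have "alpha_wt k N \<pi> = (- 1) ^ perm_nu N \<pi> / of_nat k ^ perm_nu N \<pi>"
    unfolding alpha_wt_def by (rule power_divide)
  ultimately show ?thesis
    using assms(2)
    by (simp add: sign_eq_orbits[OF assms(1)] card_colourings[OF assms(1)] eq)
qed

text \<open>The weight is a class function. Composition with \<open>x\<close> embeds the colourings
  fixed by \<open>x \<circ> y\<close> into those fixed by \<open>y \<circ> x\<close>, and exchanging
  the roles gives the reverse inequality.\<close>

lemma alpha_wt_compose_commute:
  assumes x: "x permutes {..<N}" and y: "y permutes {..<N}" and k: "k > 0"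
  shows "alpha_wt k N (x \<circ> y) = alpha_wt k N (y \<circ> x)"
proof -
  have le: "card (colourings N k (x \<circ> y)) \<le> card (colourings N k (y \<circ> x))"
    if x: "x permutes {..<N}" and y: "y permutes {..<N}" for x y
  proof (rule card_inj_on_le)
    show "inj_on (\<lambda>f. f \<circ> x) (colourings N k (x \<circ> y))"
    proof (rule inj_onI)
      fix f g :: "nat \<Rightarrow> nat" assume "f \<circ> x = g \<circ> x"
      then have "f \<circ> x \<circ> inv_into UNIV x = g \<circ> x \<circ> inv_into UNIV x" by simp
      then show "f = g" by (simp add: comp_assoc permutes_inv_o[OF x])
    qed
    show "(\<lambda>f. f \<circ> x) ` colourings N k (x \<circ> y) \<subseteq> colourings N k (y \<circ> x)"
    proof (rule image_subsetI)
      fix f assume f: "f \<in> colourings N k (x \<circ> y)"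
      have "f \<circ> x \<circ> (y \<circ> x) = f \<circ> x" using f by (simp add: colourings_def comp_assoc[symmetric])
      moreover have "f \<circ> x \<in> {..<N} \<rightarrow>\<^sub>E {..<k}"
        using f permutes_in_image[OF x] permutes_not_in[OF x]
        by (auto simp: colourings_def PiE_iff extensional_def)
      ultimately show "f \<circ> x \<in> colourings N k (y \<circ> x)" by (simp add: colourings_def)
    qed
  qed simp
  have "sign (x \<circ> y) = sign (y \<circ> x)"
    using permutes_imp_permutation[OF _ x] permutes_imp_permutation[OF _ y] by (simp add: sign_compose)
  then show ?thesis
    using le[OF x y] le[OF y x] alpha_wt_eq[OF permutes_compose[OF x y] k]
      alpha_wt_eq[OF permutes_compose[OF y x] k] by simp
qed

lemma sum_sign_permutations_eq_0:
  fixes G :: "(nat \<Rightarrow> nat) \<Rightarrow> complex"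
  assumes B: "finite B" "b \<in> B" "c \<in> B" "b \<noteq> c"
    and G: "\<And>h. h permutes B \<Longrightarrow> G (transpose b c \<circ> h) = G h"
  shows "(\<Sum>h | h permutes B. of_int (sign h) * G h) = 0"
proof -
  let ?S = "\<Sum>h | h permutes B. of_int (sign h) * G h"
  have t: "transpose b c permutes B" using B by (simp add: permutes_swap_id)
  have "?S = (\<Sum>h | h permutes B. of_int (sign (transpose b c \<circ> h)) * G (transpose b c \<circ> h))"
    by (rule setum_permutations_compose_left[OF t])
  also have "\<dots> = (\<Sum>h | h permutes B. - (of_int (sign h) * G h))"
  proof (rule sum.cong)
    fix h assume "h \<in> {h. h permutes B}"
    then have h: "h permutes B" by simp
    show "of_int (sign (transpose b c \<circ> h)) * G (transpose b c \<circ> h) = - (of_int (sign h) * G h)"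
      using G[OF h] permutes_imp_permutation[OF B(1) h] permutes_imp_permutation[OF B(1) t] B(4)
      by (simp add: sign_compose sign_swap_id)
  qed simp
  also have "\<dots> = - ?S" by (rule sum_negf)
  finally show ?thesis by simp
qed

text \<open>The pigeonhole principle: with k colours, any colouring repeats a colour on
  \<open>B\<close>. The transposition of two such positions fixes the colouring and has sign -1, so
  the signed contributions of each colouring cancel.\<close>

lemma sum_alpha_wt_eq_0:
  assumes \<pi>: "\<pi> permutes {..<N}" and B: "B \<subseteq> {..<N}" "card B > k" and k: "k > 0"
  shows "(\<Sum>h | h permutes B. alpha_wt k N (h \<circ> \<pi>)) = 0"
proof -
  have fin: "finite B" using B(1) finite_subset by blast
  have perm: "h permutes {..<N}" if "h permutes B" for h using permutes_subset[OF that B(1)] .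
  have wt: "alpha_wt k N (h \<circ> \<pi>) = of_int (sign \<pi>) / of_nat k ^ N *
      (\<Sum>f\<in>{..<N} \<rightarrow>\<^sub>E {..<k}. of_int (sign h) * (if f \<circ> (h \<circ> \<pi>) = f then 1 else 0))"
    if h: "h permutes B" for h
  proof -
    have "(of_nat (card (colourings N k (h \<circ> \<pi>))) :: complex)
        = (\<Sum>f\<in>{..<N} \<rightarrow>\<^sub>E {..<k}. if f \<circ> (h \<circ> \<pi>) = f then 1 else 0)"
      by (simp add: colourings_def sum.If_cases finite_PiE Int_def)
    then show ?thesis
      using alpha_wt_eq[OF permutes_compose[OF \<pi> perm[OF h]] k] permutes_imp_permutation[OF _ \<pi>]
        permutes_imp_permutation[OF fin h]
      by (simp add: sign_compose sum_distrib_left[symmetric])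
  qed
  have zero: "(\<Sum>h | h permutes B. of_int (sign h) * (if f \<circ> (h \<circ> \<pi>) = f then 1 else 0)) = (0::complex)"
    if f: "f \<in> {..<N} \<rightarrow>\<^sub>E {..<k}" for f
  proof -
    have "card (f ` B) \<le> card {..<k}" using f B(1) by (intro card_mono) (auto simp: PiE_iff)
    then have "\<not> inj_on f B" using B(2) card_image[of f B] by auto
    then obtain b c where bc: "b \<in> B" "c \<in> B" "b \<noteq> c" "f b = f c" by (auto simp: inj_on_def)
    have "f \<circ> transpose b c = f" using bc by (auto simp: fun_eq_iff transpose_def)
    then show ?thesis
      by (intro sum_sign_permutations_eq_0[OF fin bc(1-3)]) (simp add: comp_assoc[symmetric])
  qed
  have "(\<Sum>h | h permutes B. alpha_wt k N (h \<circ> \<pi>)) = of_int (sign \<pi>) / of_nat k ^ N *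
      (\<Sum>h | h permutes B. \<Sum>f\<in>{..<N} \<rightarrow>\<^sub>E {..<k}. of_int (sign h) * (if f \<circ> (h \<circ> \<pi>) = f then 1 else 0))"
    unfolding sum_distrib_left[of "of_int (sign \<pi>) / of_nat k ^ N"]
    by (rule sum.cong) (simp_all only: wt mem_Collect_eq sum_distrib_left)
  also have "(\<Sum>h | h permutes B. \<Sum>f\<in>{..<N} \<rightarrow>\<^sub>E {..<k}. of_int (sign h) * (if f \<circ> (h \<circ> \<pi>) = f then 1 else 0)) = (0::complex)"
    by (subst sum.swap) (simp add: zero)
  finally show ?thesis by (simp only: mult_zero_right)
qed

section \<open>Row operations on the wreath determinant\<close>

text \<open>Numerical counterparts of \<open>alpha_det\<close> and \<open>wrdet\<close>. Complex
  entries permit division by powers of z, and matrices given as functions let a row be replaced by a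
  function update.\<close>

definition adet :: "nat \<Rightarrow> nat \<Rightarrow> (nat \<Rightarrow> nat \<Rightarrow> complex) \<Rightarrow> complex" where
  "adet k N Z = (\<Sum>\<pi> | \<pi> permutes {..<N}. alpha_wt k N \<pi> * (\<Prod>j<N. Z (\<pi> j) j))"

definition wr :: "nat \<Rightarrow> nat \<Rightarrow> (nat \<Rightarrow> nat \<Rightarrow> complex) \<Rightarrow> complex" where
  "wr k n X = adet k (k * n) (\<lambda>p. X (p div k))"

text \<open>Permuting the equal rows leaves the products of entries unchanged, so the determinant
  equals its average over the permutations of \<open>B\<close>. There the weights add up to
  0.\<close>

lemma adet_eq_0:
  assumes B: "B \<subseteq> {..<N}" "card B > k" and k: "k > 0"
    and eq: "\<And>b b' j. b \<in> B \<Longrightarrow> b' \<in> B \<Longrightarrow> Z b j = Z b' j"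
  shows "adet k N Z = 0"
proof -
  have fin: "finite B" using B(1) finite_subset by blast
  have move: "adet k N Z = (\<Sum>\<pi> | \<pi> permutes {..<N}. alpha_wt k N (h \<circ> \<pi>) * (\<Prod>j<N. Z (\<pi> j) j))"
    if h: "h permutes B" for h
  proof -
    have "Z (h x) j = Z x j" for x j
    proof (cases "x \<in> B")
      case True
      then have "h x \<in> B" using permutes_in_image[OF h] by simp
      then show ?thesis by (rule eq) (rule True)
    qed (simp add: permutes_not_in[OF h])
    then show ?thesis
      unfolding adet_def
      by (subst setum_permutations_compose_left[OF permutes_subset[OF h B(1)]]) simp
  qed
  have "fact (card B) * adet k N Z = (\<Sum>h | h permutes B. adet k N Z)"
    by (simp add: card_permutations[OF refl fin])
  also have "\<dots> = (\<Sum>h | h permutes B. \<Sum>\<pi> | \<pi> permutes {..<N}.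
      alpha_wt k N (h \<circ> \<pi>) * (\<Prod>j<N. Z (\<pi> j) j))"
    by (rule sum.cong[OF refl]) (use move in simp)
  also have "\<dots> = (\<Sum>\<pi> | \<pi> permutes {..<N}. \<Sum>h | h permutes B.
      alpha_wt k N (h \<circ> \<pi>) * (\<Prod>j<N. Z (\<pi> j) j))"
    by (rule sum.swap)
  also have "\<dots> = 0"
  proof (rule sum.neutral, clarify)
    fix \<pi> :: "nat \<Rightarrow> nat" assume \<pi>: "\<pi> permutes {..<N}"
    show "(\<Sum>h | h permutes B. alpha_wt k N (h \<circ> \<pi>) * (\<Prod>j<N. Z (\<pi> j) j)) = 0"
      unfolding sum_distrib_right[symmetric] sum_alpha_wt_eq_0[OF \<pi> B k] by simp
  qed
  finally show ?thesis by simp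
qed

text \<open>The coefficient of \<pi> collects the entries outside row \<open>p\<close> and thus does
  not depend on \<open>u\<close>. In this form linearity in a row is a rearrangement of
  sums.\<close>

lemma adet_row_expansion:
  assumes "p < N"
  shows "\<exists>C. \<forall>u. adet k N (Z(p := u)) = (\<Sum>\<pi> | \<pi> permutes {..<N}. C \<pi> * u (inv_into UNIV \<pi> p))"
proof (intro exI allI)
  fix u
  show "adet k N (Z(p := u)) = (\<Sum>\<pi> | \<pi> permutes {..<N}.
    (alpha_wt k N \<pi> * (\<Prod>j\<in>{..<N} - {inv_into UNIV \<pi> p}. Z (\<pi> j) j)) * u (inv_into UNIV \<pi> p))"
    unfolding adet_def
  proof (rule sum.cong[OF refl])
    fix \<pi> assume "\<pi> \<in> {\<pi>. \<pi> permutes {..<N}}"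
    then have \<pi>: "\<pi> permutes {..<N}" by simp
    let ?j = "inv_into UNIV \<pi> p"
    have j: "\<pi> ?j = p" "?j < N"
      using permutes_inverses(1)[OF \<pi>] permutes_in_image[OF permutes_inv[OF \<pi>], of p] assms by auto
    have "(\<Prod>i<N. (Z(p := u)) (\<pi> i) i) = u ?j * (\<Prod>i\<in>{..<N} - {?j}. (Z(p := u)) (\<pi> i) i)"
      using j by (subst prod.remove[of _ ?j]) simp_all
    also have "(\<Prod>i\<in>{..<N} - {?j}. (Z(p := u)) (\<pi> i) i) = (\<Prod>i\<in>{..<N} - {?j}. Z (\<pi> i) i)"
    proof (rule prod.cong[OF refl])
      fix i assume "i \<in> {..<N} - {?j}"
      then have "\<pi> i \<noteq> p" using j permutes_inverses(2)[OF \<pi>, of i] by auto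
      then show "(Z(p := u)) (\<pi> i) i = Z (\<pi> i) i" by simp
    qed
    finally show "alpha_wt k N \<pi> * (\<Prod>j<N. (Z(p := u)) (\<pi> j) j) =
      (alpha_wt k N \<pi> * (\<Prod>j\<in>{..<N} - {?j}. Z (\<pi> j) j)) * u ?j"
      by simp
  qed
qed

lemma adet_row_linear:
  assumes "p < N"
  shows "adet k N (Z(p := (\<lambda>j. c * u j + (\<Sum>i\<in>I. \<beta> i * v i j))))
    = c * adet k N (Z(p := u)) + (\<Sum>i\<in>I. \<beta> i * adet k N (Z(p := v i)))"
proof -
  obtain C where C: "\<And>u. adet k N (Z(p := u)) = (\<Sum>\<pi> | \<pi> permutes {..<N}. C \<pi> * u (inv_into UNIV \<pi> p))"
    using adet_row_expansion[OF assms, of k Z] by blast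
  have "(\<Sum>i\<in>I. \<beta> i * (\<Sum>\<pi> | \<pi> permutes {..<N}. C \<pi> * v i (inv_into UNIV \<pi> p)))
      = (\<Sum>\<pi> | \<pi> permutes {..<N}. C \<pi> * (\<Sum>i\<in>I. \<beta> i * v i (inv_into UNIV \<pi> p)))"
    unfolding sum_distrib_left by (subst sum.swap) (simp add: ac_simps)
  then show ?thesis
    unfolding C by (simp add: distrib_left sum.distrib sum_distrib_left[of c] ac_simps)
qed

lemma block_eq:
  fixes k :: nat
  assumes "k > 0"
  shows "{p. p div k = r} = {r * k..<r * k + k}"
proof -
  have iff: "p div k = r \<longleftrightarrow> r * k \<le> p \<and> p < r * k + k" for p
    using assms div_nat_eqI[of k r p] div_times_less_eq_dividend[of p k] dividend_less_div_times[of k p]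
    by (auto simp: algebra_simps)
  show ?thesis unfolding iff by auto
qed

text \<open>The k copies of row \<open>r\<close> are replaced one at a time, each contributing a
  factor \<open>c\<close>. The terms with a row \<open>X i\<close> vanish, because the copy at
  \<open>p\<close> together with the block of \<open>i\<close> makes k + 1 equal rows.\<close>

lemma wr_row_operation:
  assumes k: "k > 0" and r: "r < n" and I: "I \<subseteq> {..<n} - {r}"
    and X: "X r = (\<lambda>j. c * y j + (\<Sum>i\<in>I. \<beta> i * X i j))"
  shows "wr k n X = c ^ k * wr k n (X(r := y))"
proof -
  let ?N = "k * n" and ?block = "\<lambda>i. {p. p div k = i}"
  \<comment> \<open>\<open>Q\<close> is the set of copies of row \<open>r\<close> that have already
    been replaced by \<open>y\<close>.\<close>
  define Z where "Z Q p = (if p \<in> Q then y else X (p div k))" for Q p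
  have block: "finite (?block i)" "card (?block i) = k" for i
    using block_eq[OF k, of i] by simp_all
  have block_N: "?block i \<subseteq> {..<?N}" if "i < n" for i
    using that k by (auto simp: less_mult_imp_div_less div_less_iff_less_mult mult.commute)
  have "adet k ?N (Z {}) = c ^ card Q * adet k ?N (Z Q)" if "Q \<subseteq> ?block r" for Q
    using finite_subset[OF that block(1)] that
  proof (induction Q rule: finite_induct)
    case (insert p Q)
    have p: "p div k = r" "p < ?N" using insert.prems block_N[OF r] by auto
    have upd: "Z Q = (Z Q)(p := X r)" using insert.hyps p by (auto simp: Z_def fun_eq_iff)
    have "adet k ?N ((Z Q)(p := X i)) = 0" if "i \<in> I" for i
    proof (rule adet_eq_0[of "insert p (?block i)"])
      have i: "i < n" "i \<noteq> r" using that I by auto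
      then show "insert p (?block i) \<subseteq> {..<?N}" using block_N[of i] p by auto
      show "k < card (insert p (?block i))" using block[of i] i p by simp
      have row: "((Z Q)(p := X i)) b = X i" if "b \<in> insert p (?block i)" for b
        using that insert.prems i by (auto simp: Z_def)
      show "((Z Q)(p := X i)) b j = ((Z Q)(p := X i)) b' j"
        if "b \<in> insert p (?block i)" "b' \<in> insert p (?block i)" for b b' j
        using row[OF that(1)] row[OF that(2)] by simp
    qed (rule k)
    moreover have "(Z Q)(p := y) = Z (insert p Q)" by (auto simp: Z_def fun_eq_iff)
    ultimately have "adet k ?N (Z Q) = c * adet k ?N (Z (insert p Q))"
      by (subst upd, subst X, subst adet_row_linear[OF p(2)]) simp
    then show ?case using insert by simp
  qed simp
  from this[OF subset_refl] have "adet k ?N (Z {}) = c ^ k * adet k ?N (Z (?block r))"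
    by (simp add: block)
  moreover have "Z {} = (\<lambda>p. X (p div k))" "Z (?block r) = (\<lambda>p. (X(r := y)) (p div k))"
    by (auto simp: Z_def fun_eq_iff)
  ultimately show ?thesis unfolding wr_def by simp
qed

lemma wr_cong:
  assumes "\<And>i j. i < n \<Longrightarrow> j < k * n \<Longrightarrow> X i j = Y i j"
  shows "wr k n X = wr k n Y"
proof -
  have "(\<Prod>j<k * n. X (\<pi> j div k) j) = (\<Prod>j<k * n. Y (\<pi> j div k) j)"
    if \<pi>: "\<pi> permutes {..<k * n}" for \<pi>
  proof (rule prod.cong[OF refl])
    fix j assume "j \<in> {..<k * n}"
    then have "\<pi> j < n * k" "j < k * n"
      using permutes_in_image[OF \<pi>, of j] by (simp_all add: mult.commute)
    then show "X (\<pi> j div k) j = Y (\<pi> j div k) j"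
      by (intro assms less_mult_imp_div_less)
  qed
  then show ?thesis unfolding wr_def adet_def by simp
qed

text \<open>A rank \<open>\<rho>\<close> increasing or decreasing in the index covers lower and upper triangular matrices.\<close>

lemma wr_triangular_mult:
  assumes k: "k > 0" and inj: "inj_on \<rho> {..<n}"
    and T: "\<And>i j. i < n \<Longrightarrow> j < n \<Longrightarrow> i \<noteq> j \<Longrightarrow> \<not> \<rho> j < (\<rho> i :: nat) \<Longrightarrow> T i j = 0"
  shows "wr k n (\<lambda>i j. \<Sum>c<n. T i c * Y c j) = (\<Prod>i<n. T i i) ^ k * wr k n Y"
proof -
  \<comment> \<open>The rows of rank below \<open>t\<close> are already those of \<open>Y\<close>.
    By triangularity the row of rank \<open>t\<close> is \<open>T r r\<close> times its row of
    \<open>Y\<close> plus a combination of the rows already treated, so it fits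
    \<open>wr_row_operation\<close>.\<close>
  define X where "X t i = (if i < n \<and> \<rho> i < t then Y i else (\<lambda>j. \<Sum>c<n. T i c * Y c j))" for t i
  have step: "wr k n (X 0) = (\<Prod>i\<in>{i. i < n \<and> \<rho> i < t}. T i i) ^ k * wr k n (X t)" for t
  proof (induction t)
    case (Suc t)
    show ?case
    proof (cases "\<exists>r<n. \<rho> r = t")
      case True
      then obtain r where r: "r < n" "\<rho> r = t" by blast
      have eq: "\<rho> i = t \<longleftrightarrow> i = r" if "i < n" for i
        using inj_onD[OF inj, of i r] that r by auto
      have "X t r = (\<lambda>j. T r r * Y r j + (\<Sum>i\<in>{i. i < n \<and> \<rho> i < t}. T r i * X t i j))"
      proof
        fix j
        have "X t r j = (\<Sum>c<n. T r c * Y c j)" using r by (simp add: X_def)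
        also have "\<dots> = T r r * Y r j + (\<Sum>c\<in>{..<n} - {r}. T r c * Y c j)"
          using r by (subst sum.remove[of _ r]) simp_all
        also have "(\<Sum>c\<in>{..<n} - {r}. T r c * Y c j) = (\<Sum>c\<in>{i. i < n \<and> \<rho> i < t}. T r c * Y c j)"
          by (rule sum.mono_neutral_right) (use r T[of r] in auto)
        also have "\<dots> = (\<Sum>i\<in>{i. i < n \<and> \<rho> i < t}. T r i * X t i j)"
          by (rule sum.cong) (simp_all add: X_def)
        finally show "X t r j = T r r * Y r j + (\<Sum>i\<in>{i. i < n \<and> \<rho> i < t}. T r i * X t i j)" .
      qed
      then have "wr k n (X t) = T r r ^ k * wr k n ((X t)(r := Y r))"
        by (intro wr_row_operation[OF k r(1), of "{i. i < n \<and> \<rho> i < t}"]) (use r in auto)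
      also have "(X t)(r := Y r) = X (Suc t)"
      proof
        fix i show "((X t)(r := Y r)) i = X (Suc t) i"
          using r eq[of i] by (auto simp: X_def less_Suc_eq)
      qed
      finally have "wr k n (X t) = T r r ^ k * wr k n (X (Suc t))" .
      moreover have "{i. i < n \<and> \<rho> i < Suc t} = insert r {i. i < n \<and> \<rho> i < t}"
        using r eq by (auto simp: less_Suc_eq)
      ultimately show ?thesis using Suc r by (simp add: power_mult_distrib)
    next
      case False
      then have *: "(i < n \<and> \<rho> i < Suc t) = (i < n \<and> \<rho> i < t)" for i by (auto simp: less_Suc_eq)
      have "X (Suc t) = X t" unfolding X_def * ..
      then show ?thesis using Suc unfolding * by simp
    qed
  qed simp
  obtain t where t: "\<And>i. i < n \<Longrightarrow> \<rho> i < t"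
    using that[of "Suc (Max (\<rho> ` {..<n}))"] by (simp add: less_Suc_eq_le)
  have "{i. i < n \<and> \<rho> i < t} = {..<n}" using t by auto
  moreover have "wr k n (X t) = wr k n Y" by (rule wr_cong) (simp add: X_def t)
  moreover have "X 0 = (\<lambda>i j. \<Sum>c<n. T i c * Y c j)" by (simp add: X_def fun_eq_iff)
  ultimately show ?thesis using step[of t] by simp
qed

lemma wr_mult_columns:
  "wr k n (\<lambda>i j. X i j * d j) = (\<Prod>j<k * n. d j) * wr k n X"
  unfolding wr_def adet_def by (simp add: prod.distrib sum_distrib_left ac_simps)

section \<open>Vectors annihilated by symmetrisers\<close>

lemma sum_apply: "(\<Sum>a\<in>A. f a) x = (\<Sum>a\<in>A. f a x :: complex)"
  by (induction A rule: infinite_finite_induct) auto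

text \<open>Coordinates in the basis chosen by \<open>trace_on\<close> are additive, so the traces
  add up to that of the operator taking v to \<open>v z\<close> times \<open>w\<close>, which is the
  functional evaluated at \<open>w\<close>. The finite spanning set makes the chosen basis finite;
  over an infinite one the sum in \<open>trace_on\<close> would be 0 by default.\<close>

lemma sum_trace_on_rank_one:
  fixes V :: "('a \<Rightarrow> complex) set"
  assumes V: "V = fun_vs.span P" and F: "finite F" "V \<subseteq> fun_vs.span F"
    and T: "\<And>i v. i \<in> I \<Longrightarrow> v \<in> V \<Longrightarrow> T i v \<in> V"
    and rank: "\<And>v. v \<in> V \<Longrightarrow> (\<Sum>i\<in>I. T i v) = (\<lambda>x. v z * w x)" and w: "w \<in> V"
  shows "(\<Sum>i\<in>I. trace_on V (T i)) = w z"
proof -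
  define B where "B = (SOME B. fun_vs.independent B \<and> fun_vs.span B = V)"
  obtain B' where B': "B' \<subseteq> V" "fun_vs.independent B'" "V \<subseteq> fun_vs.span B'"
    using fun_vs.maximal_independent_subset by blast
  have "fun_vs.span B' \<subseteq> V" using B'(1) unfolding V by (intro fun_vs.span_minimal) simp_all
  with B' have "\<exists>B. fun_vs.independent B \<and> fun_vs.span B = V" by blast
  then have B: "fun_vs.independent B" "fun_vs.span B = V"
    unfolding B_def by (metis (mono_tags, lifting) someI_ex)+
  have BV: "B \<subseteq> V" using B(2) fun_vs.span_superset by blast
  have fin: "finite B" using fun_vs.independent_span_bound[OF F(1) B(1)] BV F(2) by blast
  have "(\<Sum>i\<in>I. trace_on V (T i)) = (\<Sum>i\<in>I. \<Sum>b\<in>B. fun_vs.representation B (T i b) b)"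
    unfolding trace_on_def B_def Let_def ..
  also have "\<dots> = (\<Sum>b\<in>B. \<Sum>i\<in>I. fun_vs.representation B (T i b) b)" by (rule sum.swap)
  also have "\<dots> = (\<Sum>b\<in>B. fun_vs.representation B w b * b z)"
  proof (rule sum.cong[OF refl])
    fix b assume "b \<in> B"
    then have b: "b \<in> V" using BV by blast
    have "(\<Sum>i\<in>I. fun_vs.representation B (T i b) b) = fun_vs.representation B (\<Sum>i\<in>I. T i b) b"
      by (subst fun_vs.representation_sum[OF B(1)]) (simp_all add: B(2) T b)
    also have "\<dots> = b z * fun_vs.representation B w b"
      unfolding rank[OF b] by (subst fun_vs.representation_scale[OF B(1)]) (simp_all add: B(2) w)
    finally show "(\<Sum>i\<in>I. fun_vs.representation B (T i b) b) = fun_vs.representation B w b * b z"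
      by simp
  qed
  also have "\<dots> = (\<Sum>b\<in>B. (\<lambda>x. fun_vs.representation B w b * b x)) z"
    by (simp add: sum_apply)
  also have "\<dots> = w z"
    by (subst fun_vs.sum_representation_eq[OF B(1) _ fin]) (simp_all add: B(2) w)
  finally show ?thesis .
qed

text \<open>The tabloids of shape (k, ..., k), in the encoding used by
  \<open>tabloid\<close>.\<close>

definition words :: "nat \<Rightarrow> nat \<Rightarrow> (nat \<Rightarrow> nat) set" where
  "words k n = {r \<in> {..<k * n} \<rightarrow>\<^sub>E {..<n}. \<forall>i<n. card {x. x < k * n \<and> r x = i} = k}"

definition base_word :: "nat \<Rightarrow> nat \<Rightarrow> nat \<Rightarrow> nat" where
  "base_word k n = (\<lambda>x\<in>{..<k * n}. x div k)"

text \<open>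
  In the weight space \<open>(k, \<dots>, k)\<close> of the tensor power, the second condition says that \<open>v\<close> is killed
  by the operators replacing one letter by another. These vectors form the Specht module, but only
  one inclusion is needed.
\<close>

definition harmonic :: "nat \<Rightarrow> nat \<Rightarrow> ((nat \<Rightarrow> nat) \<Rightarrow> complex) set" where
  "harmonic k n = {v. (\<forall>r. r \<notin> words k n \<longrightarrow> v r = 0) \<and>
     (\<forall>B r. B \<subseteq> {..<k * n} \<longrightarrow> card B = Suc k \<longrightarrow> (\<Sum>h | h permutes B. v (r \<circ> h)) = 0)}"

lemma harmonic_outside: "v \<in> harmonic k n \<Longrightarrow> r \<notin> words k n \<Longrightarrow> v r = 0"
  by (simp add: harmonic_def)

lemma harmonic_sum:
  "v \<in> harmonic k n \<Longrightarrow> B \<subseteq> {..<k * n} \<Longrightarrow> card B = Suc k \<Longrightarrow> (\<Sum>h | h permutes B. v (r \<circ> h)) = 0"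
  by (simp add: harmonic_def)

lemma finite_words: "finite (words k n)"
  unfolding words_def by (simp add: finite_PiE)

lemma words_compose:
  assumes h: "h permutes {..<k * n}" and r: "r \<in> words k n"
  shows "r \<circ> h \<in> words k n"
proof -
  have "card {x. x < k * n \<and> r (h x) = i} = card {x. x < k * n \<and> r x = i}" for i
  proof (rule bij_betw_same_card)
    show "bij_betw h {x. x < k * n \<and> r (h x) = i} {x. x < k * n \<and> r x = i}"
      by (rule bij_betw_byWitness[where f' = "inv_into UNIV h"])
        (use permutes_in_image[OF h] permutes_in_image[OF permutes_inv[OF h]] permutes_inverses[OF h]
          in auto)
  qed
  moreover have "r \<circ> h \<in> {..<k * n} \<rightarrow>\<^sub>E {..<n}"
    using r permutes_in_image[OF h] permutes_not_in[OF h]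
    by (auto simp: words_def PiE_iff extensional_def)
  ultimately show ?thesis using r by (simp add: words_def)
qed

lemma words_compose_iff:
  assumes h: "h permutes {..<k * n}"
  shows "r \<circ> h \<in> words k n \<longleftrightarrow> r \<in> words k n"
proof
  assume "r \<circ> h \<in> words k n"
  then have "r \<circ> h \<circ> inv_into UNIV h \<in> words k n" by (rule words_compose[OF permutes_inv[OF h]])
  then show "r \<in> words k n" by (simp add: comp_assoc permutes_inv_o[OF h])
qed (rule words_compose[OF h])

lemma base_word_in_words:
  assumes k: "k > 0"
  shows "base_word k n \<in> words k n"
proof -
  have "{x. x < k * n \<and> base_word k n x = i} = {i * k..<i * k + k}" if "i < n" for i
  proof -
    have "i * k + k \<le> n * k" using mult_le_mono1[of "Suc i" n k] that by simp
    then have "x < k * n" if "x div k = i" for x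
      using that k dividend_less_div_times[of k x] by (simp add: mult.commute)
    then have "{x. x < k * n \<and> base_word k n x = i} = {x. x div k = i}"
      by (auto simp: base_word_def)
    then show ?thesis by (simp only: block_eq[OF k])
  qed
  then show ?thesis
    by (auto simp: words_def base_word_def PiE_iff less_mult_imp_div_less mult.commute)
qed

lemma subspace_harmonic: "fun_vs.subspace (harmonic k n)"
  unfolding fun_vs.subspace_def
  by (auto simp: harmonic_def sum.distrib sum_distrib_left[symmetric])

text \<open>Point masses at the words provide the finite spanning set for
  \<open>sum_trace_on_rank_one\<close>.\<close>

lemma harmonic_subset_span:
  "harmonic k n \<subseteq> fun_vs.span ((\<lambda>r r'. if r' = r then 1 else 0) ` words k n)"
proof
  fix v assume v: "v \<in> harmonic k n"
  have "v = (\<Sum>r\<in>words k n. (\<lambda>r'. v r * (if r' = r then 1 else 0)))"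
  proof
    fix r' show "v r' = (\<Sum>r\<in>words k n. (\<lambda>r'. v r * (if r' = r then 1 else 0))) r'"
      using harmonic_outside[OF v, of r'] finite_words[of k n]
      by (auto simp: sum_apply if_distrib[of "(*) _"] cong: if_cong)
  qed
  moreover have "(\<Sum>r\<in>words k n. (\<lambda>r'. v r * (if r' = r then 1 else 0)))
    \<in> fun_vs.span ((\<lambda>r r'. if r' = r then 1 else 0) ` words k n)"
    by (intro fun_vs.span_sum fun_vs.span_scale fun_vs.span_base) auto
  ultimately show "v \<in> fun_vs.span ((\<lambda>r r'. if r' = r then 1 else 0) ` words k n)" by simp
qed

lemma finite_block_subgroup: "finite (block_subgroup k n)"
proof (rule finite_subset)
  show "block_subgroup k n \<subseteq> {g. g permutes {..<k * n}}" by (auto simp: block_subgroup_def)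
qed (simp add: finite_permutations)

text \<open>The block subgroup as the stabiliser of the base word, which turns its closure
  properties into computations with composition.\<close>

lemma block_subgroup_iff:
  assumes "g permutes {..<k * n}"
  shows "g \<in> block_subgroup k n \<longleftrightarrow> base_word k n \<circ> g = base_word k n"
  using assms permutes_in_image[OF assms] permutes_not_in[OF assms]
  by (auto simp: block_subgroup_def base_word_def fun_eq_iff)

lemma block_subgroup_permutes: "g \<in> block_subgroup k n \<Longrightarrow> g permutes {..<k * n}"
  by (simp add: block_subgroup_def)

lemma block_subgroup_base: "g \<in> block_subgroup k n \<Longrightarrow> base_word k n \<circ> g = base_word k n"
  using block_subgroup_iff block_subgroup_permutes by blast

text \<open>
  Induction on the number of positions where \<open>r\<close> differs from the base word. If \<open>p\<close> is such a
  position, in the block \<open>b\<close>, symmetrise over \<open>p\<close> and the \<open>k\<close> positions carrying the letter \<open>b\<close>: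
  moving a \<open>b\<close> to \<open>p\<close> either stays within the block \<open>b\<close>, leaving \<open>v\<close> unchanged, or improves
  the agreement.
\<close>

lemma harmonic_block_invariant_eq_0:
  assumes k: "k > 0" and v: "v \<in> harmonic k n"
    and inv: "\<And>g r. g \<in> block_subgroup k n \<Longrightarrow> v (r \<circ> g) = v r"
    and base: "v (base_word k n) = 0"
  shows "v r = 0"
proof (cases "r \<in> words k n")
  case True
  then show ?thesis
  proof (induction "card {y. y < k * n \<and> r y \<noteq> y div k}" arbitrary: r rule: less_induct)
    case less
    note r = less.prems
    show ?case
    proof (cases "\<exists>p<k * n. r p \<noteq> p div k")
      case False
      have "r = base_word k n"
      proof
        fix x show "r x = base_word k n x"
          using False r by (cases "x < k * n") (auto simp: base_word_def words_def PiE_iff extensional_def)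
      qed
      then show ?thesis using base by simp
    next
      case True
      then obtain p where p: "p < k * n" "r p \<noteq> p div k" by blast
      define b where "b = p div k"
      have bn: "b < n" using p by (simp add: b_def less_mult_imp_div_less mult.commute)
      define A where "A = {x. x < k * n \<and> r x = b}"
      have A: "card A = k" using r bn by (simp add: words_def A_def)
      define B where "B = insert p A"
      have pA: "p \<notin> A" using p by (simp add: A_def b_def)
      have finA: "finite A" by (simp add: A_def)
      have B: "B \<subseteq> {..<k * n}" "card B = Suc k"
        using p A pA finA by (auto simp: B_def A_def)
      define C where "C = {h. h permutes B \<and> inv_into UNIV h p div k = b}"
      have val: "v (r \<circ> h) = (if h \<in> C then v r else 0)" if h: "h permutes B" for h
      proof -
        define x where "x = inv_into UNIV h p"
        have hx: "h x = p" using permutes_inverses(1)[OF h] by (simp add: x_def)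
        have xB: "x \<in> B" using permutes_in_image[OF permutes_inv[OF h], of p] by (simp add: x_def B_def)
        then have xN: "x < k * n" using B by auto
        have swap: "transpose p x permutes {..<k * n}" using p xN by (simp add: permutes_swap_id)
        \<comment> \<open>As \<open>r\<close> has the constant value \<open>b\<close> on
          \<open>A\<close>, the word \<open>r \<circ> h\<close> depends only on the position
          \<open>x\<close> that \<open>h\<close> sends to \<open>p\<close>.\<close>
        have comp: "r \<circ> h = r \<circ> transpose p x"
        proof
          fix y
          show "(r \<circ> h) y = (r \<circ> transpose p x) y"
          proof (cases "y = x \<or> y \<notin> B")
            case True
            then show ?thesis using hx xB permutes_not_in[OF h, of y] by (auto simp: transpose_def B_def)
          next
            case False
            then have "h y \<in> B" "h y \<noteq> p"
              using permutes_in_image[OF h, of y] hx permutes_inj[OF h] by (auto dest: injD)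
            then have hy: "r (h y) = b" by (simp add: B_def A_def)
            show ?thesis
            proof (cases "y = p")
              case True
              then have "r x = b" using xB False by (auto simp: B_def A_def)
              then show ?thesis using hy True by simp
            next
              case ne: False
              then have "r y = b" using False by (auto simp: B_def A_def)
              then show ?thesis using hy ne False by simp
            qed
          qed
        qed
        show ?thesis
        proof (cases "x div k = b")
          case True
          have "transpose p x y div k = y div k" for y
            using True by (auto simp: transpose_def b_def)
          then have "transpose p x \<in> block_subgroup k n" using swap by (simp add: block_subgroup_def)
          then show ?thesis using inv comp h True by (simp add: C_def x_def)
        next
          case False
          then have x: "x \<noteq> p" "r x = b" using xB by (auto simp: b_def B_def A_def)
          \<comment> \<open>The position \<open>x\<close> carries \<open>b\<close> outside the block
            \<open>b\<close>, so it disagreed with the base word beforehand. Whatever it receives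
            creates no new disagreement, while the one at \<open>p\<close> disappears.\<close>
          have "{y. y < k * n \<and> (r \<circ> transpose p x) y \<noteq> y div k} \<subset> {y. y < k * n \<and> r y \<noteq> y div k}"
          proof (rule psubsetI)
            show "{y. y < k * n \<and> (r \<circ> transpose p x) y \<noteq> y div k} \<subseteq> {y. y < k * n \<and> r y \<noteq> y div k}"
              using x p xN False by (auto simp: transpose_def b_def split: if_splits)
            have "(r \<circ> transpose p x) p = p div k" using x by (simp add: b_def)
            then show "{y. y < k * n \<and> (r \<circ> transpose p x) y \<noteq> y div k} \<noteq> {y. y < k * n \<and> r y \<noteq> y div k}"
              using p by blast
          qed
          then have "v (r \<circ> transpose p x) = 0"
            by (intro less.hyps words_compose[OF swap r] psubset_card_mono) auto
          then show ?thesis using False comp by (simp add: C_def x_def)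
        qed
      qed
      have finC: "finite C"
        using finite_permutations[of B] B(1) finite_subset[of B "{..<k * n}"] by (simp add: C_def)
      have "0 = (\<Sum>h | h permutes B. v (r \<circ> h))" using harmonic_sum[OF v B] by simp
      also have "\<dots> = (\<Sum>h | h permutes B. if h \<in> C then v r else 0)"
        by (rule sum.cong) (simp_all add: val)
      also have "\<dots> = (\<Sum>h\<in>C. v r)"
        by (rule sum.mono_neutral_cong_right)
          (use finite_permutations[of B] B(1) finite_subset[of B "{..<k * n}"] in \<open>auto simp: C_def\<close>)
      also have "\<dots> = of_nat (card C) * v r" by simp
      finally have "of_nat (card C) * v r = 0" by simp
      moreover have "id \<in> C" by (simp add: C_def permutes_id b_def inv_id)
      then have "card C > 0" using finC by (auto simp: card_gt_0_iff)
      ultimately show ?thesis by simp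
    qed
  qed
qed (rule harmonic_outside[OF v])

section \<open>Polytabloids of rectangular shape\<close>

definition column_index :: "nat list \<Rightarrow> (nat \<times> nat \<Rightarrow> nat) \<Rightarrow> nat \<Rightarrow> nat" where
  "column_index ls t x = snd (inv_into (diagram ls) t x)"

lemma tableau_compose:
  assumes "is_tableau ls t" "\<pi> permutes {..<sum_list ls}"
  shows "is_tableau ls (\<pi> \<circ> t)"
  using assms bij_betw_trans[OF _ permutes_imp_bij] unfolding is_tableau_def by blast

lemma tableau_inv:
  assumes "is_tableau ls t" "x < sum_list ls"
  shows "inv_into (diagram ls) t x \<in> diagram ls" "t (inv_into (diagram ls) t x) = x"
  using assms inv_into_into[of x t "diagram ls"] f_inv_into_f[of x t "diagram ls"]
  by (auto simp: is_tableau_def bij_betw_def)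

lemma tableau_inv_eq:
  assumes "is_tableau ls t" "c \<in> diagram ls"
  shows "inv_into (diagram ls) t (t c) = c"
  using assms by (auto simp: is_tableau_def bij_betw_def)

lemma tabloid_compose:
  assumes t: "is_tableau ls t" and \<pi>: "\<pi> permutes {..<sum_list ls}"
  shows "tabloid ls (\<pi> \<circ> t) \<circ> \<pi> = tabloid ls t"
proof
  fix x
  show "(tabloid ls (\<pi> \<circ> t) \<circ> \<pi>) x = tabloid ls t x"
  proof (cases "x < sum_list ls")
    case True
    let ?c = "inv_into (diagram ls) t x"
    have c: "?c \<in> diagram ls" "t ?c = x" using tableau_inv[OF t True] .
    have "inv_into (diagram ls) (\<pi> \<circ> t) (\<pi> x) = ?c"
      using tableau_inv_eq[OF tableau_compose[OF t \<pi>] c(1)] c(2) by simp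
    then show ?thesis using True permutes_in_image[OF \<pi>, of x] by (simp add: tabloid_def)
  next
    case False
    then show ?thesis using permutes_not_in[OF \<pi>, of x] by (simp add: tabloid_def)
  qed
qed

lemma tabloid_eq_iff:
  assumes t: "is_tableau ls t" and \<pi>: "\<pi> permutes {..<sum_list ls}"
  shows "r = tabloid ls (\<pi> \<circ> t) \<longleftrightarrow> r \<circ> \<pi> = tabloid ls t"
proof
  assume "r \<circ> \<pi> = tabloid ls t"
  then have "r \<circ> \<pi> \<circ> inv_into UNIV \<pi> = tabloid ls (\<pi> \<circ> t) \<circ> \<pi> \<circ> inv_into UNIV \<pi>"
    by (simp only: tabloid_compose[OF t \<pi>])
  then show "r = tabloid ls (\<pi> \<circ> t)" by (simp add: comp_assoc permutes_inv_o[OF \<pi>])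
qed (simp add: tabloid_compose[OF t \<pi>])

text \<open>With \<pi> moved from the tableau to the argument, translating \<open>r\<close> becomes
  a shift of the summation index.\<close>

lemma polytabloid_eq:
  assumes t: "is_tableau ls t"
  shows "polytabloid ls t r
    = (\<Sum>\<pi>\<in>column_stabilizer ls t. if r \<circ> \<pi> = tabloid ls t then of_int (sign \<pi>) else 0)"
  unfolding polytabloid_def
  by (rule sum.cong) (simp_all add: column_stabilizer_def tabloid_eq_iff[OF t])

lemma column_eq:
  assumes t: "is_tableau ls t"
  shows "column ls t j = {x. x < sum_list ls \<and> column_index ls t x = j}"
proof (intro subset_antisym subsetI)
  fix x assume "x \<in> column ls t j"
  then obtain c where c: "c \<in> diagram ls" "snd c = j" "x = t c" by (auto simp: column_def)
  then show "x \<in> {x. x < sum_list ls \<and> column_index ls t x = j}"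
    using t tableau_inv_eq[OF t c(1)] by (auto simp: is_tableau_def bij_betw_def column_index_def)
next
  fix x assume "x \<in> {x. x < sum_list ls \<and> column_index ls t x = j}"
  then show "x \<in> column ls t j"
    using tableau_inv[OF t, of x] by (force simp: column_def column_index_def)
qed

lemma column_stabilizer_index:
  assumes t: "is_tableau ls t" and \<pi>: "\<pi> \<in> column_stabilizer ls t" and x: "x < sum_list ls"
  shows "column_index ls t (\<pi> x) = column_index ls t x"
proof -
  have "\<pi> x \<in> \<pi> ` column ls t (column_index ls t x)" using x by (simp add: column_eq[OF t])
  then have "\<pi> x \<in> column ls t (column_index ls t x)" using \<pi> by (auto simp: column_stabilizer_def)
  then show ?thesis by (simp add: column_eq[OF t])
qed

lemma transpose_in_column_stabilizer:
  assumes t: "is_tableau ls t" and xy: "x < sum_list ls" "y < sum_list ls" "column_index ls t x = column_index ls t y"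
  shows "transpose x y \<in> column_stabilizer ls t"
proof -
  have "transpose x y ` column ls t j = column ls t j" for j
  proof -
    have mem: "transpose x y z \<in> column ls t j" if z: "z \<in> column ls t j" for z
    proof (cases "z = x \<or> z = y")
      case True
      then show ?thesis using z xy unfolding column_eq[OF t] by (elim disjE) simp_all
    qed (use z in simp)
    then have "transpose x y ` column ls t j \<subseteq> column ls t j" by (rule image_subsetI)
    moreover have "column ls t j \<subseteq> transpose x y ` column ls t j"
    proof
      fix z assume "z \<in> column ls t j"
      from imageI[OF mem[OF this], of "transpose x y"]
      show "z \<in> transpose x y ` column ls t j" by simp
    qed
    ultimately show ?thesis by (rule subset_antisym)
  qed
  then show ?thesis using xy by (simp add: column_stabilizer_def permutes_swap_id)
qed

lemma column_stabilizer_compose: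
  assumes "\<pi> \<in> column_stabilizer ls t" "\<rho> \<in> column_stabilizer ls t"
  shows "\<pi> \<circ> \<rho> \<in> column_stabilizer ls t"
proof -
  have "(\<pi> \<circ> \<rho>) ` A = \<pi> ` (\<rho> ` A)" for A by (rule image_comp[symmetric])
  then show ?thesis using assms unfolding column_stabilizer_def by (simp add: permutes_compose del: o_apply)
qed

lemma sign_compose_permutes:
  assumes "finite A" "p permutes A" "q permutes A"
  shows "sign (p \<circ> q) = sign p * sign q"
  by (intro sign_compose permutes_imp_permutation[OF assms(1)] assms(2,3))

text \<open>The transposition lies in the column stabiliser and has sign -1, so composing with it
  shifts the signed sum to its negative.\<close>

lemma polytabloid_transpose:
  assumes t: "is_tableau ls t" and xy: "x < sum_list ls" "y < sum_list ls" "column_index ls t x = column_index ls t y" "x \<noteq> y"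
  shows "polytabloid ls t (r \<circ> transpose x y) = - polytabloid ls t r"
proof -
  let ?C = "column_stabilizer ls t" and ?\<tau> = "transpose x y"
  have \<tau>: "?\<tau> \<in> ?C" by (rule transpose_in_column_stabilizer[OF t xy(1-3)])
  have inv: "?\<tau> \<circ> (?\<tau> \<circ> \<pi>) = \<pi>" for \<pi> by (simp add: comp_assoc[symmetric])
  have "polytabloid ls t (r \<circ> ?\<tau>)
      = (\<Sum>\<pi>\<in>?C. if r \<circ> (?\<tau> \<circ> \<pi>) = tabloid ls t then of_int (sign \<pi>) else 0)"
    by (simp add: polytabloid_eq[OF t] comp_assoc)
  also have "\<dots> = (\<Sum>\<pi>\<in>?C. if r \<circ> \<pi> = tabloid ls t then of_int (sign (?\<tau> \<circ> \<pi>)) else 0)"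
    by (rule sum.reindex_bij_witness[where i = "\<lambda>\<pi>. ?\<tau> \<circ> \<pi>" and j = "\<lambda>\<pi>. ?\<tau> \<circ> \<pi>"])
      (auto simp: inv column_stabilizer_compose[OF \<tau>])
  also have "\<dots> = (\<Sum>\<pi>\<in>?C. - (if r \<circ> \<pi> = tabloid ls t then of_int (sign \<pi>) else 0))"
  proof (rule sum.cong[OF refl])
    fix \<pi> assume "\<pi> \<in> ?C"
    then have "\<pi> permutes {..<sum_list ls}" "?\<tau> permutes {..<sum_list ls}"
      using \<tau> by (simp_all add: column_stabilizer_def)
    then have "sign (?\<tau> \<circ> \<pi>) = - sign \<pi>"
      using sign_compose_permutes[of "{..<sum_list ls}"] xy(4) by (simp add: sign_swap_id)
    then show "(if r \<circ> \<pi> = tabloid ls t then of_int (sign (?\<tau> \<circ> \<pi>)) else (0::complex))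
      = - (if r \<circ> \<pi> = tabloid ls t then of_int (sign \<pi>) else 0)" by simp
  qed
  also have "\<dots> = - polytabloid ls t r" by (simp add: sum_negf polytabloid_eq[OF t])
  finally show ?thesis .
qed

text \<open>The column stabiliser of \<open>\<pi> \<circ> t\<close> is the conjugate by \<pi> of
  that of \<open>t\<close>, and conjugation preserves signs.\<close>

lemma polytabloid_perm_action:
  assumes t: "is_tableau ls t" and \<pi>: "\<pi> permutes {..<sum_list ls}"
  shows "perm_action \<pi> (polytabloid ls t) = polytabloid ls (\<pi> \<circ> t)"
proof
  fix r
  let ?C = "column_stabilizer ls" and ?i = "inv_into UNIV \<pi>"
  have \<pi>i: "?i permutes {..<sum_list ls}" by (rule permutes_inv[OF \<pi>])
  have inv: "\<pi> \<circ> (?i \<circ> x) = x" "?i \<circ> (\<pi> \<circ> x) = x" for x :: "nat \<Rightarrow> nat"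
    unfolding comp_assoc[symmetric] by (simp_all add: permutes_inv_o[OF \<pi>])
  have conj: "p \<circ> \<sigma> \<circ> q \<in> ?C (p \<circ> s)" if "\<sigma> \<in> ?C s" "p permutes {..<sum_list ls}" "q permutes {..<sum_list ls}"
    "q \<circ> p = id" for p q \<sigma> s
  proof -
    have column: "column ls (p \<circ> s) j = p ` column ls s j" for j
      unfolding column_def by (rule image_comp[symmetric])
    have "(p \<circ> \<sigma> \<circ> q) ` column ls (p \<circ> s) j = column ls (p \<circ> s) j" for j
    proof -
      have "(p \<circ> \<sigma> \<circ> q) ` p ` A = p ` \<sigma> ` A" for A
        unfolding image_comp by (simp only: comp_assoc that(4) comp_id)
      then show ?thesis using that(1) unfolding column by (simp add: column_stabilizer_def)
    qed
    moreover have "p \<circ> \<sigma> \<circ> q permutes {..<sum_list ls}"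
      using that by (intro permutes_compose) (simp_all add: column_stabilizer_def)
    ultimately show ?thesis by (simp add: column_stabilizer_def)
  qed
  have "polytabloid ls (\<pi> \<circ> t) r
      = (\<Sum>\<rho>\<in>?C (\<pi> \<circ> t). if r \<circ> \<rho> = tabloid ls (\<pi> \<circ> t) then of_int (sign \<rho>) else 0)"
    by (rule polytabloid_eq[OF tableau_compose[OF t \<pi>]])
  also have "\<dots> = (\<Sum>\<sigma>\<in>?C t. if r \<circ> \<pi> \<circ> \<sigma> = tabloid ls t then of_int (sign \<sigma>) else 0)"
  proof (rule sum.reindex_bij_witness[where i = "\<lambda>\<sigma>. \<pi> \<circ> \<sigma> \<circ> ?i" and j = "\<lambda>\<rho>. ?i \<circ> \<rho> \<circ> \<pi>"])
    fix \<sigma> assume \<sigma>: "\<sigma> \<in> ?C t"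
    show "\<pi> \<circ> \<sigma> \<circ> ?i \<in> ?C (\<pi> \<circ> t)" by (rule conj[OF \<sigma> \<pi> \<pi>i]) (simp add: permutes_inv_o[OF \<pi>])
    show "?i \<circ> (\<pi> \<circ> \<sigma> \<circ> ?i) \<circ> \<pi> = \<sigma>" by (simp add: comp_assoc inv permutes_inv_o[OF \<pi>])
  next
    fix \<rho> assume \<rho>: "\<rho> \<in> ?C (\<pi> \<circ> t)"
    show "\<pi> \<circ> (?i \<circ> \<rho> \<circ> \<pi>) \<circ> ?i = \<rho>" by (simp add: comp_assoc inv permutes_inv_o[OF \<pi>])
    have "?i \<circ> \<rho> \<circ> \<pi> \<in> ?C (?i \<circ> (\<pi> \<circ> t))"
      by (rule conj[OF \<rho> \<pi>i \<pi>]) (simp add: permutes_inv_o[OF \<pi>])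
    moreover have "?i \<circ> (\<pi> \<circ> t) = t" unfolding comp_assoc[symmetric] by (simp add: permutes_inv_o[OF \<pi>])
    ultimately show "?i \<circ> \<rho> \<circ> \<pi> \<in> ?C t" by simp
    have \<rho>p: "\<rho> permutes {..<sum_list ls}" using \<rho> by (simp add: column_stabilizer_def)
    have "sign (?i \<circ> \<rho> \<circ> \<pi>) = sign ?i * sign \<rho> * sign \<pi>"
      using sign_compose_permutes[OF _ permutes_compose[OF \<rho>p \<pi>i] \<pi>] sign_compose_permutes[OF _ \<pi>i \<rho>p]
      by simp
    then have "sign (?i \<circ> \<rho> \<circ> \<pi>) = sign \<rho>"
      using sign_inverse[OF permutes_imp_permutation[OF _ \<pi>]] by (simp add: mult.assoc mult.commute[of "sign \<rho>"])
    moreover have "r \<circ> \<pi> \<circ> (?i \<circ> \<rho> \<circ> \<pi>) = r \<circ> \<rho> \<circ> \<pi>" by (simp add: comp_assoc inv)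
    moreover have "r \<circ> \<rho> = tabloid ls (\<pi> \<circ> t) \<longleftrightarrow> r \<circ> \<rho> \<circ> \<pi> = tabloid ls t"
      by (rule tabloid_eq_iff[OF t \<pi>])
    ultimately show "(if r \<circ> \<pi> \<circ> (?i \<circ> \<rho> \<circ> \<pi>) = tabloid ls t then of_int (sign (?i \<circ> \<rho> \<circ> \<pi>)) else (0::complex))
      = (if r \<circ> \<rho> = tabloid ls (\<pi> \<circ> t) then of_int (sign \<rho>) else 0)" by simp
  qed
  also have "\<dots> = polytabloid ls t (r \<circ> \<pi>)" by (simp add: polytabloid_eq[OF t])
  finally show "perm_action \<pi> (polytabloid ls t) r = polytabloid ls (\<pi> \<circ> t) r"
    by (simp add: perm_action_def)
qed

lemma perm_action_specht:
  assumes v: "v \<in> specht ls" and \<pi>: "\<pi> permutes {..<sum_list ls}"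
  shows "perm_action \<pi> v \<in> specht ls"
  using v unfolding specht_def
proof (induction rule: fun_vs.span_induct_alt)
  case base
  have "perm_action \<pi> 0 = 0" by (auto simp: perm_action_def)
  then show ?case by (simp only: fun_vs.span_zero)
next
  case (step c x y)
  then obtain t where t: "is_tableau ls t" "x = polytabloid ls t" by auto
  have eq: "perm_action \<pi> ((\<lambda>r. c * x r) + y) = (\<lambda>r. c * polytabloid ls (\<pi> \<circ> t) r) + perm_action \<pi> y"
    unfolding polytabloid_perm_action[OF t(1) \<pi>, symmetric] t(2) by (auto simp: perm_action_def)
  have "polytabloid ls (\<pi> \<circ> t) \<in> fun_vs.span {polytabloid ls t | t. is_tableau ls t}"
    by (rule fun_vs.span_base) (use tableau_compose[OF t(1) \<pi>] in blast)
  then show ?case unfolding eq using step by (intro fun_vs.span_add fun_vs.span_scale)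
qed

lemma diagram_rect: "diagram (replicate n k) = {..<n} \<times> {..<k}"
  by (auto simp: diagram_def)

lemma sum_list_rect: "sum_list (replicate n k) = k * (n :: nat)"
  by (simp add: sum_list_replicate mult.commute)

lemma tabloid_in_words:
  assumes t: "is_tableau (replicate n k) t"
  shows "tabloid (replicate n k) t \<in> words k n"
proof -
  let ?ls = "replicate n k" and ?T = "tabloid (replicate n k) t"
  have val: "?T (t c) = fst c" "t c < k * n" if "c \<in> diagram ?ls" for c
    using that t tableau_inv_eq[OF t that]
    by (auto simp: tabloid_def sum_list_rect is_tableau_def bij_betw_def)
  have ex: "\<exists>c\<in>diagram ?ls. x = t c" if "x < k * n" for x
    using tableau_inv[OF t, of x] that by (auto simp: sum_list_rect intro!: bexI)
  have "card {x. x < k * n \<and> ?T x = i} = k" if i: "i < n" for i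
  proof -
    have "{x. x < k * n \<and> ?T x = i} = t ` ({i} \<times> {..<k})"
    proof (intro subset_antisym subsetI)
      fix x assume x: "x \<in> {x. x < k * n \<and> ?T x = i}"
      then obtain c where c: "c \<in> diagram ?ls" "x = t c" using ex by blast
      then have "c \<in> {i} \<times> {..<k}" using x val[OF c(1)] by (auto simp: diagram_rect)
      then show "x \<in> t ` ({i} \<times> {..<k})" using c(2) by blast
    next
      fix x assume "x \<in> t ` ({i} \<times> {..<k})"
      then obtain c where c: "c \<in> {i} \<times> {..<k}" "x = t c" by blast
      then have "c \<in> diagram ?ls" using i by (auto simp: diagram_rect)
      then show "x \<in> {x. x < k * n \<and> ?T x = i}" using val[of c] c by auto
    qed
    moreover have "inj_on t ({i} \<times> {..<k})"
      by (rule inj_on_subset[of t "diagram ?ls"]) (use t i in \<open>auto simp: is_tableau_def bij_betw_def diagram_rect\<close>)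
    ultimately show ?thesis by (simp add: card_image)
  qed
  moreover have "?T x < n" if x: "x < k * n" for x
  proof -
    obtain c where "c \<in> diagram ?ls" "x = t c" using ex[OF x] by blast
    then show ?thesis using val[of c] by (auto simp: diagram_rect)
  qed
  moreover have "?T \<in> extensional {..<k * n}" by (simp add: tabloid_def sum_list_rect)
  ultimately show ?thesis by (auto simp: words_def PiE_iff)
qed

text \<open>The diagram has k columns, so two of any k + 1 positions share one. Antisymmetry under
  their transposition makes the symmetrised value equal to its own negative.\<close>

lemma polytabloid_harmonic:
  assumes t: "is_tableau (replicate n k) t"
  shows "polytabloid (replicate n k) t \<in> harmonic k n"
proof -
  let ?ls = "replicate n k" and ?e = "polytabloid (replicate n k) t"
  have "?e r = 0" if r: "r \<notin> words k n" for r
  proof -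
    have "r \<circ> \<pi> \<noteq> tabloid ?ls t" if "\<pi> \<in> column_stabilizer ?ls t" for \<pi>
      using that words_compose_iff[of \<pi> k n r] r tabloid_in_words[OF t]
      by (auto simp: column_stabilizer_def sum_list_rect)
    then show ?thesis by (simp add: polytabloid_eq[OF t])
  qed
  moreover have "(\<Sum>h | h permutes B. ?e (r \<circ> h)) = 0" if B: "B \<subseteq> {..<k * n}" "card B = Suc k" for B r
  proof -
    have "column_index ?ls t ` B \<subseteq> {..<k}"
    proof (rule image_subsetI)
      fix x assume "x \<in> B"
      then have "x < sum_list ?ls" using B(1) by (auto simp: sum_list_rect)
      then show "column_index ?ls t x \<in> {..<k}"
        using tableau_inv(1)[OF t] by (auto simp: column_index_def diagram_rect mem_Times_iff)
    qed
    then have "card (column_index ?ls t ` B) \<le> k" using card_mono[of "{..<k}"] by fastforce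
    then have "\<not> inj_on (column_index ?ls t) B" using B(2) card_image by fastforce
    then obtain x y where xy: "x \<in> B" "y \<in> B" "x \<noteq> y" "column_index ?ls t x = column_index ?ls t y"
      by (auto simp: inj_on_def)
    have swap: "transpose x y permutes B" using xy by (simp add: permutes_swap_id)
    have "(\<Sum>h | h permutes B. ?e (r \<circ> h)) = (\<Sum>h | h permutes B. ?e (r \<circ> (h \<circ> transpose x y)))"
      by (rule sum_permutations_compose_right[OF swap])
    also have "\<dots> = (\<Sum>h | h permutes B. - ?e (r \<circ> h))"
    proof (rule sum.cong[OF refl])
      fix h
      have "x < sum_list ?ls" "y < sum_list ?ls" using xy B(1) by (auto simp: sum_list_rect)
      from polytabloid_transpose[OF t this xy(4,3), of "r \<circ> h"]
      show "?e (r \<circ> (h \<circ> transpose x y)) = - ?e (r \<circ> h)" by (simp add: comp_assoc)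
    qed
    finally show ?thesis by (simp add: sum_negf)
  qed
  ultimately show ?thesis by (simp add: harmonic_def)
qed

lemma specht_subset_harmonic: "specht (replicate n k) \<subseteq> harmonic k n"
  unfolding specht_def
proof (rule fun_vs.span_minimal[OF _ subspace_harmonic], rule subsetI)
  fix v assume "v \<in> {polytabloid (replicate n k) t | t. is_tableau (replicate n k) t}"
  then obtain t where "v = polytabloid (replicate n k) t" "is_tableau (replicate n k) t" by blast
  then show "v \<in> harmonic k n" by (simp only: polytabloid_harmonic)
qed

text \<open>Filling the diagram row by row makes the rows the blocks. Only the identity preserves
  every row and every column, so a single term of the polytabloid survives. This guarantees that the
  block average on the Specht module is not zero.\<close>

lemma base_polytabloid:
  assumes k: "k > 0"
  obtains t where "is_tableau (replicate n k) t" "polytabloid (replicate n k) t (base_word k n) = 1"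
proof
  let ?ls = "replicate n k"
  define t :: "nat \<times> nat \<Rightarrow> nat" where "t = (\<lambda>(i, j). i * k + j)"
  show t: "is_tableau ?ls t"
    unfolding is_tableau_def sum_list_rect
  proof (rule bij_betw_byWitness[where f' = "\<lambda>x. (x div k, x mod k)"])
    have "i * k + j < k * n" if "i < n" "j < k" for i j
    proof -
      have "i * k + j < Suc i * k" using that by simp
      also have "\<dots> \<le> n * k" by (rule mult_le_mono1) (use that in simp)
      finally show ?thesis by (simp add: mult.commute)
    qed
    then show "t ` diagram ?ls \<subseteq> {..<k * n}" by (auto simp: diagram_rect t_def)
    show "(\<lambda>x. (x div k, x mod k)) ` {..<k * n} \<subseteq> diagram ?ls"
      using k by (auto simp: diagram_rect less_mult_imp_div_less mult.commute)
  qed (auto simp: t_def diagram_rect)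
  have inv: "inv_into (diagram ?ls) t x = (x div k, x mod k)" if x: "x < k * n" for x
  proof -
    have "(x div k, x mod k) \<in> diagram ?ls"
      using k x by (auto simp: diagram_rect less_mult_imp_div_less mult.commute)
    from tableau_inv_eq[OF t this] show ?thesis by (simp add: t_def)
  qed
  have T: "tabloid ?ls t = base_word k n"
    by (auto simp: tabloid_def base_word_def sum_list_rect inv restrict_def)
  have triv: "\<pi> = id" if \<pi>: "\<pi> \<in> column_stabilizer ?ls t" "base_word k n \<circ> \<pi> = base_word k n" for \<pi>
  proof
    fix x
    have perm: "\<pi> permutes {..<k * n}" using \<pi>(1) by (simp add: column_stabilizer_def sum_list_rect)
    show "\<pi> x = id x"
    proof (cases "x < k * n")
      case True
      then have lt: "\<pi> x < k * n" using permutes_in_image[OF perm, of x] by simp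
      have "\<pi> x mod k = x mod k"
        using column_stabilizer_index[OF t \<pi>(1), of x] True lt
        by (simp add: sum_list_rect column_index_def inv)
      moreover have "\<pi> x div k = x div k"
        using fun_cong[OF \<pi>(2), of x] True lt by (simp add: base_word_def)
      ultimately show ?thesis by (metis div_mult_mod_eq id_apply)
    qed (simp add: permutes_not_in[OF perm])
  qed
  have id: "id \<in> column_stabilizer ?ls t" by (simp add: column_stabilizer_def permutes_id)
  have fin: "finite (column_stabilizer ?ls t)"
    by (rule finite_subset[of _ "{\<pi>. \<pi> permutes {..<sum_list ?ls}}"])
      (auto simp: column_stabilizer_def finite_permutations)
  have "(\<Sum>\<pi>\<in>column_stabilizer ?ls t. if base_word k n \<circ> \<pi> = base_word k n then of_int (sign \<pi>) else 0)
      = (\<Sum>\<pi>\<in>{id :: nat \<Rightarrow> nat}. of_int (sign \<pi>) :: complex)"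
    by (rule sum.mono_neutral_cong_right) (use triv id fin in auto)
  then show "polytabloid ?ls t (base_word k n) = 1"
    by (simp add: polytabloid_eq[OF t] T)
qed

section \<open>The character of a rectangular partition averaged over the blocks\<close>

lemma id_in_block_subgroup: "id \<in> block_subgroup k n"
  by (simp add: block_subgroup_def permutes_id)

lemma block_subgroup_compose:
  assumes "g \<in> block_subgroup k n" "h \<in> block_subgroup k n"
  shows "g \<circ> h \<in> block_subgroup k n"
proof -
  note [simp] = block_subgroup_permutes[OF assms(1)] block_subgroup_permutes[OF assms(2)]
  have "base_word k n \<circ> g \<circ> h = base_word k n" using assms by (simp add: block_subgroup_base)
  then show ?thesis by (simp add: block_subgroup_iff permutes_compose comp_assoc)
qed

lemma block_subgroup_inv:
  assumes "g \<in> block_subgroup k n"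
  shows "inv_into UNIV g \<in> block_subgroup k n"
proof -
  note g = block_subgroup_permutes[OF assms]
  have "base_word k n \<circ> inv_into UNIV g = base_word k n \<circ> g \<circ> inv_into UNIV g"
    by (simp add: block_subgroup_base[OF assms])
  then have "base_word k n \<circ> inv_into UNIV g = base_word k n"
    by (simp add: comp_assoc permutes_inv_o[OF g])
  then show ?thesis by (simp add: block_subgroup_iff permutes_inv[OF g])
qed

lemma sum_block_subgroup_shift:
  assumes h: "h \<in> block_subgroup k n"
  shows "(\<Sum>g\<in>block_subgroup k n. F (h \<circ> g)) = (\<Sum>g\<in>block_subgroup k n. F g)"
proof (rule sum.reindex_bij_witness[where i = "\<lambda>g. inv_into UNIV h \<circ> g" and j = "\<lambda>g. h \<circ> g"])
  note p = permutes_inv_o[OF block_subgroup_permutes[OF h]]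
  show "inv_into UNIV h \<circ> (h \<circ> g) = g" "h \<circ> (inv_into UNIV h \<circ> g) = g" for g
    by (simp_all only: comp_assoc[symmetric] p id_comp)
  show "h \<circ> g \<in> block_subgroup k n" "inv_into UNIV h \<circ> g \<in> block_subgroup k n"
    if "g \<in> block_subgroup k n" for g
    using block_subgroup_compose[OF h that] block_subgroup_compose[OF block_subgroup_inv[OF h] that] .
qed (rule refl)

lemma div_mod_eqI: "(a :: nat) div k = b div k \<Longrightarrow> a mod k = b mod k \<Longrightarrow> a = b"
  by (metis div_mult_mod_eq)

text \<open>The image of the base word under the central element with coefficients \<open>alpha_wt\<close>.\<close>

definition coset_sum :: "nat \<Rightarrow> nat \<Rightarrow> (nat \<Rightarrow> nat) \<Rightarrow> complex" where
  "coset_sum k n r = (\<Sum>x | x permutes {..<k * n} \<and> base_word k n \<circ> x = r. alpha_wt k (k * n) x)"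

lemma coset_sum_compose:
  assumes h: "h permutes {..<k * n}"
  shows "coset_sum k n (r \<circ> h)
    = (\<Sum>x | x permutes {..<k * n} \<and> base_word k n \<circ> x = r. alpha_wt k (k * n) (x \<circ> h))"
  unfolding coset_sum_def
proof (rule sum.reindex_bij_witness[where i = "\<lambda>x. x \<circ> h" and j = "\<lambda>x. x \<circ> inv_into UNIV h"])
  note inv = permutes_inv_o[OF h]
  show "x \<circ> inv_into UNIV h \<circ> h = x" "x \<circ> h \<circ> inv_into UNIV h = x" for x :: "nat \<Rightarrow> nat"
    by (simp_all only: comp_assoc inv comp_id)
  then show "alpha_wt k (k * n) (x \<circ> inv_into UNIV h \<circ> h) = alpha_wt k (k * n) x" for x
    by simp
  fix x
  assume "x \<in> {x. x permutes {..<k * n} \<and> base_word k n \<circ> x = r \<circ> h}"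
  then have x: "x permutes {..<k * n}" "base_word k n \<circ> x = r \<circ> h" by simp_all
  have "base_word k n \<circ> (x \<circ> inv_into UNIV h) = r"
    by (simp only: comp_assoc[symmetric] x(2)) (simp only: comp_assoc inv comp_id)
  then show "x \<circ> inv_into UNIV h \<in> {x. x permutes {..<k * n} \<and> base_word k n \<circ> x = r}"
    using x(1) permutes_inv[OF h] by (simp add: permutes_compose)
next
  fix x assume "x \<in> {x. x permutes {..<k * n} \<and> base_word k n \<circ> x = r}"
  then show "x \<circ> h \<in> {x. x permutes {..<k * n} \<and> base_word k n \<circ> x = r \<circ> h}"
    using h by (auto simp: permutes_compose comp_assoc[symmetric])
qed

text \<open>Since the weight is a class function, \<open>g\<close> may be moved to the left of
  \<open>x\<close>. There it keeps the fibre over \<open>r\<close>, because \<open>g\<close> fixes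
  the base word.\<close>

lemma coset_sum_block_invariant:
  assumes k: "k > 0" and g: "g \<in> block_subgroup k n"
  shows "coset_sum k n (r \<circ> g) = coset_sum k n r"
proof -
  note gp = block_subgroup_permutes[OF g]
  let ?S = "{x. x permutes {..<k * n} \<and> base_word k n \<circ> x = r}"
  have "coset_sum k n (r \<circ> g) = (\<Sum>x\<in>?S. alpha_wt k (k * n) (g \<circ> x))"
    unfolding coset_sum_compose[OF gp]
    by (rule sum.cong) (simp_all add: alpha_wt_compose_commute gp k)
  also have "\<dots> = coset_sum k n r"
    unfolding coset_sum_def
  proof (rule sum.reindex_bij_witness[where i = "\<lambda>x. inv_into UNIV g \<circ> x" and j = "\<lambda>x. g \<circ> x"])
    show "inv_into UNIV g \<circ> (g \<circ> x) = x" "g \<circ> (inv_into UNIV g \<circ> x) = x" for x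
      by (simp_all only: comp_assoc[symmetric] permutes_inv_o[OF gp] id_comp)
    have closed: "h \<circ> x \<in> ?S" if "h \<in> block_subgroup k n" "x \<in> ?S" for h x
    proof -
      have "base_word k n \<circ> h \<circ> x = r" using that by (simp add: block_subgroup_base)
      then show ?thesis using that block_subgroup_permutes by (auto simp: permutes_compose comp_assoc)
    qed
    show "g \<circ> x \<in> ?S" "inv_into UNIV g \<circ> x \<in> ?S" if "x \<in> ?S" for x
      using closed[OF g that] closed[OF block_subgroup_inv[OF g] that] .
  qed simp
  finally show ?thesis .
qed

text \<open>Again the class function property moves \<open>h\<close> to the left, where
  \<open>sum_alpha_wt_eq_0\<close> applies to each \<open>x\<close> of the fibre.\<close>

lemma coset_sum_harmonic:
  assumes k: "k > 0"
  shows "coset_sum k n \<in> harmonic k n"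
proof -
  have "coset_sum k n r = 0" if "r \<notin> words k n" for r
  proof -
    have "{x. x permutes {..<k * n} \<and> base_word k n \<circ> x = r} = {}"
      using words_compose[OF _ base_word_in_words[OF k]] that by blast
    then show ?thesis by (simp only: coset_sum_def sum.empty)
  qed
  moreover have "(\<Sum>h | h permutes B. coset_sum k n (r \<circ> h)) = 0"
    if B: "B \<subseteq> {..<k * n}" "card B = Suc k" for B r
  proof -
    let ?S = "{x. x permutes {..<k * n} \<and> base_word k n \<circ> x = r}"
    have "(\<Sum>h | h permutes B. coset_sum k n (r \<circ> h))
        = (\<Sum>h | h permutes B. \<Sum>x\<in>?S. alpha_wt k (k * n) (h \<circ> x))"
    proof (rule sum.cong[OF refl])
      fix h assume "h \<in> {h. h permutes B}"
      then have h: "h permutes {..<k * n}" using permutes_subset B(1) by blast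
      show "coset_sum k n (r \<circ> h) = (\<Sum>x\<in>?S. alpha_wt k (k * n) (h \<circ> x))"
        unfolding coset_sum_compose[OF h]
        by (rule sum.cong) (simp_all add: alpha_wt_compose_commute h k)
    qed
    also have "\<dots> = (\<Sum>x\<in>?S. \<Sum>h | h permutes B. alpha_wt k (k * n) (h \<circ> x))"
      by (rule sum.swap)
    also have "\<dots> = 0"
      by (rule sum.neutral) (use B k sum_alpha_wt_eq_0 in auto)
    finally show ?thesis .
  qed
  ultimately show ?thesis by (simp add: harmonic_def)
qed

text \<open>A product of entries survives only if \<pi> and \<rho> send every column to the same
  block. These \<pi> form one coset of the block subgroup, on which every product is 1.\<close>

lemma wr_permutation:
  assumes k: "k > 0" and \<rho>: "\<rho> permutes {..<k * n}"
  shows "wr k n (\<lambda>i j. if i = \<rho> j div k then 1 else 0) = coset_sum k n (base_word k n \<circ> \<rho>)"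
proof -
  have iff: "(\<forall>j<k * n. \<pi> j div k = \<rho> j div k) \<longleftrightarrow> base_word k n \<circ> \<pi> = base_word k n \<circ> \<rho>"
    if \<pi>: "\<pi> permutes {..<k * n}" for \<pi>
  proof -
    have val: "(base_word k n \<circ> p) j = p j div k" if "p permutes {..<k * n}" "j < k * n" for p j
      using permutes_in_image[OF that(1), of j] that(2) by (simp add: base_word_def)
    have "(base_word k n \<circ> \<pi>) j = (base_word k n \<circ> \<rho>) j" if "\<not> j < k * n" for j
      using permutes_not_in[OF \<pi>, of j] permutes_not_in[OF \<rho>, of j] that by simp
    then show ?thesis
      unfolding fun_eq_iff using val[OF \<pi>] val[OF \<rho>] by (metis (no_types))
  qed
  have "(\<Prod>j<k * n. if \<pi> j div k = \<rho> j div k then 1 else (0::complex))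
      = (if base_word k n \<circ> \<pi> = base_word k n \<circ> \<rho> then 1 else 0)"
    if \<pi>: "\<pi> permutes {..<k * n}" for \<pi>
    unfolding iff[OF \<pi>, symmetric] by auto
  then have "wr k n (\<lambda>i j. if i = \<rho> j div k then 1 else 0)
      = (\<Sum>\<pi> | \<pi> permutes {..<k * n}. alpha_wt k (k * n) \<pi> *
          (if base_word k n \<circ> \<pi> = base_word k n \<circ> \<rho> then 1 else 0))"
    unfolding wr_def adet_def by (intro sum.cong) simp_all
  also have "\<dots> = coset_sum k n (base_word k n \<circ> \<rho>)"
    unfolding coset_sum_def
    by (rule sum.mono_neutral_cong_right) (auto simp: finite_permutations)
  finally show ?thesis .
qed

text \<open>
  For \<open>f\<close> with two equal letters in a block, the signed sum over the stabiliser of \<open>f\<close> in the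
  block subgroup vanishes; otherwise the stabiliser is trivial, and the \<open>f\<close> of this kind form a
  regular orbit.
\<close>

lemma coset_sum_base:
  assumes k: "k > 0"
  shows "coset_sum k n (base_word k n) = of_nat (card (block_subgroup k n)) / of_nat k ^ (k * n)"
proof -
  let ?K = "block_subgroup k n" and ?N = "k * n"
  let ?F = "{..<?N} \<rightarrow>\<^sub>E {..<k}"
  define I where "I = {f \<in> ?F. \<forall>x<?N. \<forall>y<?N. x div k = y div k \<longrightarrow> f x = f y \<longrightarrow> x = y}"
  have set_eq: "{x. x permutes {..<?N} \<and> base_word k n \<circ> x = base_word k n} = ?K"
    using block_subgroup_iff[of _ k n] block_subgroup_permutes[of _ k n] by blast
  have inner: "(\<Sum>g\<in>?K. if f \<circ> g = f then of_int (sign g) else 0) = (if f \<in> I then 1 else (0::complex))"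
    if f: "f \<in> ?F" for f
  proof (cases "f \<in> I")
    case True
    have triv: "g = id" if g: "g \<in> ?K" "f \<circ> g = f" for g
    proof
      fix x
      note gp = block_subgroup_permutes[OF g(1)]
      show "g x = id x"
      proof (cases "x < ?N")
        case x: True
        then have "g x < ?N" "g x div k = x div k"
          using permutes_in_image[OF gp, of x] g(1) by (auto simp: block_subgroup_def)
        moreover have "f (g x) = f x" using fun_cong[OF g(2), of x] by simp
        ultimately have "g x < ?N" "g x div k = x div k" "f (g x) = f x" .
        then show ?thesis using True x by (auto simp: I_def)
      qed (simp add: permutes_not_in[OF gp])
    qed
    have "(\<Sum>g\<in>?K. if f \<circ> g = f then of_int (sign g) else 0) = (\<Sum>g\<in>{id :: nat \<Rightarrow> nat}. of_int (sign g) :: complex)"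
      by (intro sum.mono_neutral_cong_right)
        (use triv id_in_block_subgroup[of k n] finite_block_subgroup[of k n] in auto)
    then show ?thesis using True by simp
  next
    case False
    then obtain x y where xy: "x < ?N" "y < ?N" "x div k = y div k" "f x = f y" "x \<noteq> y"
      using f unfolding I_def by blast
    let ?t = "transpose x y"
    have tp: "?t permutes {..<?N}" using xy by (simp add: permutes_swap_id)
    moreover have "?t z div k = z div k" for z using xy(3) by (cases "z = x \<or> z = y") auto
    ultimately have t: "?t \<in> ?K" by (simp add: block_subgroup_def)
    have ft: "f \<circ> (?t \<circ> g) = f \<circ> g" for g using xy(4) by (auto simp: fun_eq_iff transpose_def)
    have sg: "sign (?t \<circ> g) = - sign g" if "g \<in> ?K" for g
      using sign_compose_permutes[OF _ tp block_subgroup_permutes[OF that]] xy(5) by (simp add: sign_swap_id)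
    let ?s = "\<Sum>g\<in>?K. if f \<circ> g = f then of_int (sign g) else (0::complex)"
    have "?s = (\<Sum>g\<in>?K. if f \<circ> (?t \<circ> g) = f then of_int (sign (?t \<circ> g)) else 0)"
      by (rule sum_block_subgroup_shift[OF t, symmetric])
    also have "\<dots> = (\<Sum>g\<in>?K. - (if f \<circ> g = f then of_int (sign g) else 0))"
      by (rule sum.cong) (auto simp: ft sg)
    also have "\<dots> = - ?s" by (rule sum_negf)
    finally show ?thesis using False by simp
  qed
  \<comment> \<open>The orbit map at the colouring \<open>x mod k\<close>. A block permutation is
    recovered from it, since its values have known quotients and the colouring records their
    remainders.\<close>
  have "bij_betw (\<lambda>g. \<lambda>x\<in>{..<?N}. g x mod k) ?K I"
  proof (rule bij_betw_imageI)
    show "inj_on (\<lambda>g. \<lambda>x\<in>{..<?N}. g x mod k) ?K"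
    proof (rule inj_onI)
      fix g h assume g: "g \<in> ?K" and h: "h \<in> ?K"
        and eq: "(\<lambda>x\<in>{..<?N}. g x mod k) = (\<lambda>x\<in>{..<?N}. h x mod k)"
      show "g = h"
      proof
        fix x show "g x = h x"
        proof (cases "x < ?N")
          case True
          then have "g x mod k = h x mod k" using fun_cong[OF eq, of x] by simp
          moreover have "g x div k = h x div k" using True g h by (simp add: block_subgroup_def)
          ultimately show ?thesis by (rule div_mod_eqI[rotated])
        qed (use permutes_not_in[OF block_subgroup_permutes[OF g]]
            permutes_not_in[OF block_subgroup_permutes[OF h]] in simp)
      qed
    qed
    show "(\<lambda>g. \<lambda>x\<in>{..<?N}. g x mod k) ` ?K = I"
    proof (intro subset_antisym subsetI)
      fix f assume "f \<in> (\<lambda>g. \<lambda>x\<in>{..<?N}. g x mod k) ` ?K"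
      then obtain g where g: "g \<in> ?K" and f: "f = (\<lambda>x\<in>{..<?N}. g x mod k)" by blast
      have "x = y" if xy: "x < ?N" "y < ?N" "x div k = y div k" "f x = f y" for x y
      proof -
        have "g x mod k = g y mod k" using xy by (simp add: f)
        moreover have "g x div k = x div k" "g y div k = y div k"
          using xy(1,2) g by (simp_all add: block_subgroup_def)
        then have "g x div k = g y div k" using xy(3) by (simp only:)
        ultimately have "g x div k = g y div k" "g x mod k = g y mod k" by (simp_all only:)
        then have "g x = g y" by (rule div_mod_eqI)
        then show ?thesis using permutes_inj[OF block_subgroup_permutes[OF g]] by (simp add: inj_eq)
      qed
      then show "f \<in> I" using k unfolding I_def f by auto
    next
      fix f assume f: "f \<in> I"
      define g where "g x = (if x < ?N then x div k * k + f x else x)" for x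
      have fk: "f x < k" if "x < ?N" for x using f that by (auto simp: I_def PiE_iff)
      have gd: "g x div k = x div k" "g x mod k = f x" if "x < ?N" for x
        using fk[OF that] that by (simp_all add: g_def)
      have gN: "g x < ?N" if "x < ?N" for x
        using less_mult_imp_div_less[of x n k] gd(1)[OF that] that k dividend_less_div_times[of k "g x"]
          div_less_iff_less_mult[OF k, of "g x" n] by (simp add: mult.commute)
      have "inj_on g {..<?N}"
      proof (rule inj_onI)
        fix x y assume "x \<in> {..<?N}" "y \<in> {..<?N}" "g x = g y"
        then have "x < ?N" "y < ?N" "x div k = y div k" "f x = f y"
          using gd[of x] gd[of y] by simp_all
        then show "x = y" using f unfolding I_def by blast
      qed
      moreover have "g ` {..<?N} \<subseteq> {..<?N}" using gN by auto
      ultimately have "bij_betw g {..<?N} {..<?N}" by (simp add: bij_betw_def endo_inj_surj)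
      then have "g permutes {..<?N}" by (rule bij_imp_permutes) (simp add: g_def)
      then have "g \<in> ?K" using gd by (simp add: block_subgroup_def)
      moreover have "f = (\<lambda>x\<in>{..<?N}. g x mod k)"
        using f gd by (auto simp: I_def PiE_iff extensional_def restrict_def fun_eq_iff)
      ultimately show "f \<in> (\<lambda>g. \<lambda>x\<in>{..<?N}. g x mod k) ` ?K" by blast
    qed
  qed
  then have card_I: "card I = card ?K" by (simp add: bij_betw_same_card)
  have "coset_sum k n (base_word k n) = (\<Sum>g\<in>?K. alpha_wt k ?N g)"
    unfolding coset_sum_def set_eq ..
  also have "\<dots> = (\<Sum>g\<in>?K. (\<Sum>f\<in>?F. if f \<circ> g = f then of_int (sign g) else 0) / of_nat k ^ ?N)"
  proof (rule sum.cong[OF refl])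
    fix g assume g: "g \<in> ?K"
    have "(\<Sum>f\<in>?F. if f \<circ> g = f then of_int (sign g) else (0::complex))
        = of_int (sign g) * of_nat (card (colourings ?N k g))"
      by (simp add: colourings_def sum.If_cases finite_PiE Int_def)
    then show "alpha_wt k ?N g = (\<Sum>f\<in>?F. if f \<circ> g = f then of_int (sign g) else 0) / of_nat k ^ ?N"
      by (simp add: alpha_wt_eq[OF block_subgroup_permutes[OF g] k])
  qed
  also have "\<dots> = (\<Sum>f\<in>?F. \<Sum>g\<in>?K. if f \<circ> g = f then of_int (sign g) else 0) / of_nat k ^ ?N"
    unfolding sum_divide_distrib[symmetric] by (subst sum.swap) simp
  also have "(\<Sum>f\<in>?F. \<Sum>g\<in>?K. if f \<circ> g = f then of_int (sign g) else 0)
      = (\<Sum>f\<in>?F. if f \<in> I then 1 else (0::complex))"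
    by (rule sum.cong[OF refl inner])
  also have "\<dots> = of_nat (card I)"
  proof -
    have "?F \<inter> I = I" by (auto simp: I_def)
    then show ?thesis by (simp add: sum.If_cases finite_PiE)
  qed
  finally show ?thesis by (simp add: card_I)
qed

text \<open>
  The block-invariant harmonic vectors form a line. Hence averaging over the block subgroup has
  rank one on the Specht module, which determines the trace.
\<close>

lemma coset_sum_eq_omega:
  assumes k: "k > 0" and \<rho>: "\<rho> permutes {..<k * n}"
  shows "coset_sum k n (base_word k n \<circ> \<rho>) = omega k n \<rho> * (fact k / of_nat k ^ k) ^ n"
proof -
  let ?ls = "replicate n k" and ?K = "block_subgroup k n" and ?b = "base_word k n"
  obtain t where t: "is_tableau ?ls t" "polytabloid ?ls t ?b = 1" using base_polytabloid[OF k] .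
  define u where "u = (\<Sum>g\<in>?K. perm_action g (polytabloid ?ls t))"
  have perm: "g permutes {..<sum_list ?ls}" if "g \<in> ?K" for g
    using block_subgroup_permutes[OF that] by (simp add: sum_list_rect)
  have e: "polytabloid ?ls t \<in> specht ?ls" unfolding specht_def by (rule fun_vs.span_base) (use t in blast)
  have avg_in: "(\<Sum>g\<in>?K. perm_action g v) \<in> specht ?ls" if "v \<in> specht ?ls" for v
    unfolding specht_def
    by (rule fun_vs.span_sum) (use perm_action_specht[OF that perm] in \<open>simp add: specht_def\<close>)
  have avg_apply: "(\<Sum>g\<in>?K. perm_action g v) r = (\<Sum>g\<in>?K. v (r \<circ> g))" for v r
    by (simp add: sum_apply perm_action_def)
  have avg_inv: "(\<Sum>g\<in>?K. perm_action g v) (r \<circ> h) = (\<Sum>g\<in>?K. perm_action g v) r"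
    if "h \<in> ?K" for v r h
    unfolding avg_apply comp_assoc by (rule sum_block_subgroup_shift[OF that])
  have avg_base: "(\<Sum>g\<in>?K. perm_action g v) ?b = of_nat (card ?K) * v ?b" for v
    unfolding avg_apply by (simp add: block_subgroup_base)
  have u: "u \<in> specht ?ls" "\<And>h r. h \<in> ?K \<Longrightarrow> u (r \<circ> h) = u r" "u ?b = of_nat (card ?K)"
    unfolding u_def using avg_in[OF e] avg_inv avg_base[of "polytabloid ?ls t"] t(2) by simp_all
  have K0: "(of_nat (card ?K) :: complex) \<noteq> 0"
    using id_in_block_subgroup[of k n] finite_block_subgroup[of k n] by auto
  have line: "v r = v ?b / of_nat (card ?K) * u r"
    if v: "v \<in> harmonic k n" "\<And>h r. h \<in> ?K \<Longrightarrow> v (r \<circ> h) = v r" for v r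
  proof -
    \<comment> \<open>Subtracting the multiple of \<open>u\<close> with the same value at the base
      word yields a block-invariant harmonic vector that is 0 there, hence 0 everywhere.\<close>
    let ?w = "v + (\<lambda>r. (- v ?b / of_nat (card ?K)) * u r)"
    have "?w \<in> harmonic k n"
      using u(1) specht_subset_harmonic v(1) subspace_harmonic
      by (intro fun_vs.subspace_add fun_vs.subspace_scale) auto
    then have "?w r = 0"
      by (rule harmonic_block_invariant_eq_0[OF k]) (use u v K0 in simp_all)
    then show ?thesis by simp
  qed
  \<comment> \<open>Acting by \<open>\<rho> \<circ> g\<close> means acting by \<open>g\<close> first
    and by \<rho> afterwards. Summation over \<open>g\<close> sends \<open>v\<close> to
    \<open>v ?b\<close> times \<open>u\<close>, so the total operator is \<open>v ?b\<close> times
    the translate of \<open>u\<close> by \<rho>.\<close>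
  have "(\<Sum>g\<in>?K. trace_on (specht ?ls) (perm_action (\<rho> \<circ> g))) = perm_action \<rho> u ?b"
  proof (rule sum_trace_on_rank_one[where z = ?b])
    show "specht ?ls = fun_vs.span {polytabloid ?ls t | t. is_tableau ?ls t}" by (rule specht_def)
    show "finite ((\<lambda>r r'. if r' = r then 1 else 0) ` words k n)" using finite_words by simp
    show "specht ?ls \<subseteq> fun_vs.span ((\<lambda>r r'. if r' = r then 1 else 0) ` words k n)"
      using specht_subset_harmonic harmonic_subset_span by blast
    show "perm_action \<rho> u \<in> specht ?ls"
      using u(1) \<rho> by (intro perm_action_specht) (simp_all add: sum_list_rect)
    fix v assume v: "v \<in> specht ?ls"
    show "perm_action (\<rho> \<circ> g) v \<in> specht ?ls" if "g \<in> ?K" for g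
      using v \<rho> perm[OF that] by (intro perm_action_specht permutes_compose) (simp_all add: sum_list_rect)
    have avg: "(\<Sum>g\<in>?K. perm_action g v) r = v ?b * u r" for r
      using line[of "\<Sum>g\<in>?K. perm_action g v" r] avg_in[OF v] specht_subset_harmonic[of n k] avg_inv K0
      by (auto simp: avg_base)
    show "(\<Sum>g\<in>?K. perm_action (\<rho> \<circ> g) v) = (\<lambda>x. v ?b * perm_action \<rho> u x)"
    proof
      fix r
      show "(\<Sum>g\<in>?K. perm_action (\<rho> \<circ> g) v) r = v ?b * perm_action \<rho> u r"
        using avg[of "r \<circ> \<rho>"] unfolding avg_apply by (simp add: sum_apply perm_action_def comp_assoc)
    qed
  qed
  then have "omega k n \<rho> = u (?b \<circ> \<rho>) / fact k ^ n"
    by (simp add: omega_def irr_char_def perm_action_def)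
  \<comment> \<open>The order of the block subgroup cancels: it is the value of \<open>u\<close> at
    the base word and also the numerator in \<open>coset_sum_base\<close>. The quotient of the two
    remaining normalisations is (k! / k^k)^n.\<close>
  moreover have "coset_sum k n (?b \<circ> \<rho>) = u (?b \<circ> \<rho>) / of_nat k ^ (k * n)"
    using line[OF coset_sum_harmonic[OF k] coset_sum_block_invariant[OF k], of "?b \<circ> \<rho>"] K0
    by (simp only: coset_sum_base[OF k]) simp
  ultimately show ?thesis by (simp add: power_divide power_mult)
qed

section \<open>Triangular factorisation of the circulant blocks\<close>

text \<open>
  Factors of the circulant matrix with entries \<open>y ^ ((i - c - 1) mod n)\<close>: after one step of Gaussian
  elimination with the entry \<open>y ^ (n - 1)\<close> in the upper left corner it is already upper triangular.
\<close>

definition lower_fac :: "complex \<Rightarrow> nat \<Rightarrow> nat \<Rightarrow> nat \<Rightarrow> complex" where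
  "lower_fac y n i b = (if b = i then 1 else if b = 0 then y ^ i / y ^ n else 0)"

definition upper_fac :: "complex \<Rightarrow> nat \<Rightarrow> nat \<Rightarrow> nat \<Rightarrow> complex" where
  "upper_fac y n b c = (if b = 0 then y ^ (n - 1 - c)
     else if b \<le> c then y ^ b * (y ^ n - 1) / y ^ Suc c else 0)"

text \<open>The exponent is i - c - 1 modulo n, written without negative numbers. For i > 0,
  subtracting y^(i - n) times row 0 from row i removes the entries with c < i and leaves y^(i - c -
  1) (y^n - 1) for c >= i.\<close>

lemma circulant_factorisation:
  assumes y: "y \<noteq> 0" and i: "i < n" and c: "c < n"
  shows "y ^ ((i + (n - 1 - c)) mod n) = (\<Sum>b<n. lower_fac y n i b * upper_fac y n b c)"
proof (cases "i = 0")
  case True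
  have "(\<Sum>b<n. lower_fac y n i b * upper_fac y n b c) = (\<Sum>b\<in>{0}. lower_fac y n i b * upper_fac y n b c)"
    by (rule sum.mono_neutral_right) (use True i in \<open>auto simp: lower_fac_def\<close>)
  then show ?thesis using True i c by (simp add: lower_fac_def upper_fac_def)
next
  case False
  have "(\<Sum>b<n. lower_fac y n i b * upper_fac y n b c) = (\<Sum>b\<in>{0, i}. lower_fac y n i b * upper_fac y n b c)"
    by (rule sum.mono_neutral_right) (use False i in \<open>auto simp: lower_fac_def\<close>)
  also have "\<dots> = y ^ i / y ^ n * y ^ (n - 1 - c) + upper_fac y n i c"
    using False by (simp add: lower_fac_def upper_fac_def)
  finally have sum: "(\<Sum>b<n. lower_fac y n i b * upper_fac y n b c)
    = y ^ i / y ^ n * y ^ (n - 1 - c) + upper_fac y n i c" .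
  have "y ^ (n - 1 - c) * y ^ Suc c = y ^ n" using c by (simp only: power_add[symmetric]) simp
  then have first: "y ^ i / y ^ n * y ^ (n - 1 - c) = y ^ i / y ^ Suc c"
    using y by (simp add: field_simps)
  show ?thesis
  proof (cases "i \<le> c")
    case True
    then have "(i + (n - 1 - c)) mod n = i + (n - 1 - c)" using c by simp
    moreover have "y ^ (i + (n - 1 - c)) * y ^ Suc c = y ^ i * y ^ n"
      using c by (simp only: power_add[symmetric]) simp
    ultimately have "y ^ ((i + (n - 1 - c)) mod n) = y ^ i * y ^ n / y ^ Suc c"
      using y by (simp add: field_simps)
    moreover have "upper_fac y n i c = y ^ i * (y ^ n - 1) / y ^ Suc c"
      using True False by (simp add: upper_fac_def)
    ultimately show ?thesis
      unfolding sum first by (simp only: add_divide_distrib[symmetric] right_diff_distrib) simp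
  next
    case F: False
    then have "i + (n - 1 - c) = (i - Suc c) + n" using c by simp
    then have "(i + (n - 1 - c)) mod n = i - Suc c" using i by (simp only: mod_add_self2) simp
    moreover have "y ^ (i - Suc c) * y ^ Suc c = y ^ i"
      using F by (simp only: power_add[symmetric]) simp
    ultimately have "y ^ ((i + (n - 1 - c)) mod n) = y ^ i / y ^ Suc c"
      using y by (simp add: field_simps)
    moreover have "upper_fac y n i c = 0" using F False by (simp add: upper_fac_def)
    ultimately show ?thesis unfolding sum first by simp
  qed
qed

text \<open>The corner entry y^(n - 1) cancels against the n - 1 denominators y on the rest of the
  diagonal.\<close>

lemma prod_upper_fac:
  assumes "y \<noteq> 0" "n > 0"
  shows "(\<Prod>b<n. upper_fac y n b b) = (y ^ n - 1) ^ (n - 1)"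
proof -
  obtain n' where n: "n = Suc n'" using assms(2) by (cases n) auto
  have "upper_fac y n (Suc b) (Suc b) = (y ^ n - 1) / y" for b
    using assms(1) by (simp add: upper_fac_def)
  moreover have "upper_fac y n 0 0 = y ^ n'" by (simp add: upper_fac_def n)
  moreover have "(\<Prod>b<n. upper_fac y n b b) = upper_fac y n 0 0 * (\<Prod>b<n'. upper_fac y n (Suc b) (Suc b))"
    unfolding n by (rule prod.lessThan_Suc_shift)
  ultimately show ?thesis using assms(1) by (simp add: n power_divide del: power_Suc)
qed

text \<open>With j = k c + d, the left side is k i - k c - d - 1 = k (i - c - 1) + (k - 1 - d), and
  k - 1 - d lies in the range of remainders modulo k. Reduction modulo k n therefore affects only i
  - c - 1.\<close>

lemma circulant_exponent:
  fixes k n i j :: nat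
  assumes i: "i < n" and j: "j < k * n"
  shows "(int (k * i) - int (Suc j mod (k * n))) mod int (k * n)
    = int (k * ((i + (n - 1 - j div k)) mod n) + (k - 1 - j mod k))"
proof -
  have k: "k > 0" using j by (cases k) auto
  define c d where "c = j div k" and "d = j mod k"
  have j_eq: "j = k * c + d" by (simp add: c_def d_def)
  have d: "d < k" using k by (simp add: d_def)
  have c: "c < n" using j k by (simp add: c_def less_mult_imp_div_less mult.commute)
  let ?x = "i + (n - 1 - c)"
  have "(k * ?x + (k - 1 - d)) mod (k * n) = k * (?x mod n) + (k - 1 - d)"
    using k by (simp add: mod_mult2_eq)
  moreover have "int (k * ?x + (k - 1 - d)) = int (k * i) - int (Suc j) + int (k * n)"
  proof -
    \<comment> \<open>The substitution turns the truncated differences n - 1 - c and k - 1 - d into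
      \<open>e\<close> and \<open>f\<close>.\<close>
    obtain e f where "n = Suc (c + e)" "k = Suc (d + f)"
      using c d by (auto simp: less_iff_Suc_add)
    then show ?thesis by (simp add: j_eq algebra_simps)
  qed
  ultimately have "int (k * (?x mod n) + (k - 1 - d)) = (int (k * i) - int (Suc j) + int (k * n)) mod int (k * n)"
    by (metis of_nat_mod)
  also have "\<dots> = (int (k * i) - int (Suc j)) mod int (k * n)" by simp
  also have "\<dots> = (int (k * i) - int (Suc j mod (k * n))) mod int (k * n)"
    by (simp only: of_nat_mod mod_diff_right_eq)
  finally show ?thesis by (simp add: c_def d_def)
qed

section \<open>The matrix of the pair\<close>

text \<open>The order of the subgroup is where \<open>pair_matrix\<close> and
  \<open>wrdet_pair\<close> take n and k from. For n = 1 the generator is reduced to 0.\<close>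

lemma card_generate_multiple:
  assumes "k > 0" "n > 0"
  shows "card (generate (integer_mod_group (k * n)) {int k mod int (k * n)}) = n"
proof -
  let ?G = "integer_mod_group (k * n)" and ?a = "int k mod int (k * n)"
  have m: "k * n > 0" using assms by simp
  have a: "?a \<in> carrier ?G" using m by (simp add: carrier_integer_mod_group)
  have pow: "?a [^]\<^bsub>?G\<^esub> (i :: int) = int k * (i mod int n)" for i
  proof -
    have "?a [^]\<^bsub>?G\<^esub> i = (i * int k) mod int (k * n)"
      by (simp only: int_pow_integer_mod_group mod_mult_right_eq)
    also have "\<dots> = (int k * i) mod (int k * int n)" by (simp only: of_nat_mult mult.commute[of i])
    finally show ?thesis by (simp only: mult_mod_right)
  qed
  have "generate ?G {?a} = {?a [^]\<^bsub>?G\<^esub> (i :: int) | i. i \<in> UNIV}"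
    by (rule group.generate_pow[OF group_integer_mod_group a])
  also have "\<dots> = (\<lambda>i. int k * int i) ` {..<n}"
  proof (intro subset_antisym subsetI)
    fix x assume "x \<in> {?a [^]\<^bsub>?G\<^esub> (i :: int) | i. i \<in> UNIV}"
    then obtain i :: int where "x = int k * (i mod int n)" unfolding pow by blast
    then have "x = int k * int (nat (i mod int n))" "nat (i mod int n) < n"
      using assms(2) by (simp_all add: nat_less_iff)
    then show "x \<in> (\<lambda>i. int k * int i) ` {..<n}" by blast
  next
    fix x assume "x \<in> (\<lambda>i. int k * int i) ` {..<n}"
    then obtain i where i: "i < n" "x = int k * int i" by blast
    then have "x = int k * (int i mod int n)" by simp
    then show "x \<in> {?a [^]\<^bsub>?G\<^esub> (i :: int) | i. i \<in> UNIV}" unfolding pow by blast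
  qed
  finally show ?thesis using assms(1) by (simp add: card_image inj_on_def)
qed

lemma poly_wrdet:
  assumes X: "X \<in> carrier_mat n (k * n)"
  shows "poly (wrdet k X) z = wr k n (\<lambda>i j. poly (X $$ (i, j)) z)"
proof -
  let ?Z = "kronecker X (ones_mat k 1)"
  have dim: "dim_row ?Z = k * n" "dim_col ?Z = k * n"
    using X by (simp_all add: kronecker_def ones_mat_def mult.commute)
  have entry: "?Z $$ (p, j) = X $$ (p div k, j)" if "p < k * n" "j < k * n" for p j
  proof -
    have "k > 0" using that(1) by (cases k) auto
    then show ?thesis using that X by (simp add: kronecker_def ones_mat_def mult.commute)
  qed
  have "poly (\<Prod>j<k * n. ?Z $$ (\<pi> j, j)) z = (\<Prod>j<k * n. poly (X $$ (\<pi> j div k, j)) z)"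
    if \<pi>: "\<pi> permutes {..<k * n}" for \<pi>
    unfolding poly_prod
    by (rule prod.cong) (use entry permutes_in_image[OF \<pi>] in auto)
  then show ?thesis
    unfolding wrdet_def alpha_det_def wr_def adet_def alpha_wt_def dim poly_sum poly_smult
    by (intro sum.cong) simp_all
qed

text \<open>Multiplication by the indeterminate forces agreement at 0 as well.\<close>

lemma poly_eqI_nonzero:
  fixes p q :: "complex poly"
  assumes "\<And>z. z \<noteq> 0 \<Longrightarrow> poly p z = poly q z"
  shows "p = q"
proof -
  have "poly (pCons 0 p) z = poly (pCons 0 q) z" for z using assms[of z] by (cases "z = 0") simp_all
  then have "pCons 0 p = pCons 0 q" by (simp add: poly_eq_poly_eq_iff[symmetric] fun_eq_iff)
  then show ?thesis by simp
qed

section \<open>The parameters and the permutations \<sigma> and \<tau>\<close>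

locale divisor_tuple =
  fixes l :: nat and ms ns :: "nat \<Rightarrow> nat"
  assumes ms_pos: "\<And>s. s \<in> {1..l} \<Longrightarrow> ms s > 0"
    and ns_pos: "\<And>s. s \<in> {1..l} \<Longrightarrow> ns s > 0"
    and ns_dvd: "\<And>s. s \<in> {1..l} \<Longrightarrow> ns s dvd ms s"
begin

definition "ks s = ms s div ns s"
definition "m = (\<Prod>s\<in>{1..l}. ms s)"
definition "n = (\<Prod>s\<in>{1..l}. ns s)"
definition "k = (\<Prod>s\<in>{1..l}. ks s)"

lemma ms_eq: "s \<in> {1..l} \<Longrightarrow> ms s = ks s * ns s"
  using ns_dvd by (simp add: ks_def)

lemma ks_pos: "s \<in> {1..l} \<Longrightarrow> ks s > 0"
  using ms_eq ms_pos by (metis mult_is_0 neq0_conv)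

lemma m_eq: "m = k * n"
  unfolding m_def k_def n_def prod.distrib[symmetric] by (rule prod.cong) (simp_all add: ms_eq)

lemma k_pos: "k > 0" unfolding k_def by (rule prod_pos) (use ks_pos in simp)
lemma n_pos: "n > 0" unfolding n_def by (rule prod_pos) (use ns_pos in simp)

lemma partial_prod_eqs:
  "partial_prod ms (Suc l) = m" "partial_prod ns (Suc l) = n" "partial_prod ks (Suc l) = k"
  by (simp_all only: partial_prod_Suc_eq m_def n_def k_def)

lemma n_div_ns: "s \<in> {1..l} \<Longrightarrow> n div ns s * ns s = n"
  unfolding n_def by (rule dvd_div_mult_self) (intro dvd_prodI, auto)

lemma m_div_ms: "s \<in> {1..l} \<Longrightarrow> m div ms s * ms s = m"
  unfolding m_def by (rule dvd_div_mult_self) (intro dvd_prodI, auto)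

text \<open>The matrix equation sees only the block \<open>\<sigma> j div k\<close> of each column,
  so \<sigma> is determined up to composition on the left with the block subgroup. A predicate
  covers all choices.\<close>

definition is_sigma :: "(nat \<Rightarrow> nat) \<Rightarrow> bool" where
  "is_sigma \<sigma> \<longleftrightarrow> \<sigma> permutes {..<m} \<and>
    kronecker_desc (\<lambda>s. kronecker (1\<^sub>m (ns s)) (ones_mat 1 (ks s))) l
      = (kronecker (1\<^sub>m n) (ones_mat 1 k) * perm_mat m \<sigma> :: int mat)"

definition is_tau :: "(nat \<Rightarrow> nat) \<Rightarrow> bool" where
  "is_tau \<tau> \<longleftrightarrow> \<tau> permutes {..<m} \<and>
    kronecker_desc (\<lambda>s. perm_mat (ms s) (full_cycle (ms s))) l = (perm_mat m \<tau> :: int mat)"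

lemma prod_indicator:
  "finite I \<Longrightarrow> (\<Prod>s\<in>I. if P s then 1 else 0) = (if \<forall>s\<in>I. P s then 1 else (0 :: int))"
  by (induction I rule: finite_induct) auto

lemma sigma_matrix_entry:
  assumes "i < n" "j < m"
  shows "kronecker_desc (\<lambda>s. kronecker (1\<^sub>m (ns s)) (ones_mat 1 (ks s))) l $$ (i, j)
    = (if \<forall>s\<in>{1..l}. digit ns s i = digit ms s j div ks s then 1 else (0 :: int))"
proof -
  let ?A = "\<lambda>s. kronecker (1\<^sub>m (ns s)) (ones_mat 1 (ks s)) :: int mat"
  have A: "?A s \<in> carrier_mat (ns s) (ms s)" if "s \<in> {1..l}" for s
    using ms_eq[OF that] by (simp add: kronecker_def ones_mat_def mult.commute)
  have "?A s $$ (digit ns s i, digit ms s j) = (if digit ns s i = digit ms s j div ks s then 1 else 0)"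
    if s: "s \<in> {1..l}" for s
  proof -
    have "digit ns s i < ns s" "digit ms s j < ns s * ks s"
      using digit_less[of ns s, OF ns_pos[OF s]] digit_less[of ms s, OF ms_pos[OF s], of j] ms_eq[OF s]
      by (simp_all add: mult.commute)
    then show ?thesis using ks_pos[OF s]
      by (simp add: kronecker_def ones_mat_def less_mult_imp_div_less)
  qed
  then have "(\<Prod>s\<in>{1..l}. ?A s $$ (digit ns s i, digit ms s j))
    = (\<Prod>s\<in>{1..l}. if digit ns s i = digit ms s j div ks s then 1 else 0)"
    by (rule prod.cong[OF refl])
  then show ?thesis
    using kronecker_desc_index[of l ?A ns ms i j, OF A] assms
    by (simp only: partial_prod_eqs prod_indicator finite_atLeastAtMost)
qed

lemma sigma_product_entry:
  assumes "\<sigma> permutes {..<m}" "i < n" "j < m"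
  shows "(kronecker (1\<^sub>m n) (ones_mat 1 k) * perm_mat m \<sigma> :: int mat) $$ (i, j)
    = (if i = \<sigma> j div k then 1 else 0)"
proof -
  let ?E = "kronecker (1\<^sub>m n) (ones_mat 1 k) :: int mat"
  have dim: "?E \<in> carrier_mat n m" by (simp add: kronecker_def ones_mat_def m_eq mult.commute)
  have E: "?E $$ (i, c) = (if i = c div k then 1 else 0)" if "c < m" for c
    using that assms(2) k_pos
    by (simp add: kronecker_def ones_mat_def m_eq mult.commute less_mult_imp_div_less)
  have \<sigma>j: "\<sigma> j < m" using permutes_in_image[OF assms(1), of j] assms(3) by simp
  have "(?E * perm_mat m \<sigma>) $$ (i, j) = (\<Sum>c\<in>{0..<m}. ?E $$ (i, c) * (if c = \<sigma> j then 1 else 0))"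
    using dim assms(2,3) by (simp add: perm_mat_def scalar_prod_def)
  also have "\<dots> = ?E $$ (i, \<sigma> j)" using \<sigma>j by (simp add: if_distrib[of "(*) _"] cong: if_cong)
  finally show ?thesis by (simp only: E[OF \<sigma>j])
qed

lemma sigma_digit:
  assumes \<sigma>: "is_sigma \<sigma>" and j: "j < m" and s: "s \<in> {1..l}"
  shows "digit ns s (\<sigma> j div k) = digit ms s j div ks s"
proof -
  have p: "\<sigma> permutes {..<m}" using \<sigma> by (simp add: is_sigma_def)
  have "\<sigma> j < k * n" using permutes_in_image[OF p, of j] j by (simp add: m_eq)
  then have i: "\<sigma> j div k < n" by (simp add: less_mult_imp_div_less mult.commute)
  have "kronecker_desc (\<lambda>s. kronecker (1\<^sub>m (ns s)) (ones_mat 1 (ks s))) l $$ (\<sigma> j div k, j) = (1 :: int)"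
    using \<sigma> sigma_product_entry[OF p i j] by (simp add: is_sigma_def)
  then show ?thesis using s unfolding sigma_matrix_entry[OF i j] by (simp split: if_splits)
qed

text \<open>The quotients of the digits prescribe the block \<open>c j\<close>. The place inside the
  block is free, and the remainders read in the radix \<open>ks\<close> give an injective choice
  \<open>d j\<close>.\<close>

lemma ex_sigma: "\<exists>\<sigma>. is_sigma \<sigma>"
proof -
  define c where "c j = (\<Sum>s\<in>{1..l}. partial_prod ns s * (digit ms s j div ks s))" for j
  define d where "d j = (\<Sum>s\<in>{1..l}. partial_prod ks s * (digit ms s j mod ks s))" for j
  have c: "c j < n" "\<And>s. s \<in> {1..l} \<Longrightarrow> digit ns s (c j) = digit ms s j div ks s" for j
  proof -
    have "digit ms s j div ks s < ns s" if s: "s \<in> {1..l}" for s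
      using digit_less[of ms s, OF ms_pos[OF s], of j] ms_eq[OF s]
      by (simp add: less_mult_imp_div_less mult.commute)
    from number_of_digits[of l "\<lambda>s. digit ms s j div ks s" ns, OF this]
    show "c j < n" "\<And>s. s \<in> {1..l} \<Longrightarrow> digit ns s (c j) = digit ms s j div ks s"
      unfolding c_def partial_prod_eqs by simp_all
  qed
  have d: "d j < k" "\<And>s. s \<in> {1..l} \<Longrightarrow> digit ks s (d j) = digit ms s j mod ks s" for j
  proof -
    have "digit ms s j mod ks s < ks s" if s: "s \<in> {1..l}" for s using ks_pos[OF s] by simp
    from number_of_digits[of l "\<lambda>s. digit ms s j mod ks s" ks, OF this]
    show "d j < k" "\<And>s. s \<in> {1..l} \<Longrightarrow> digit ks s (d j) = digit ms s j mod ks s"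
      unfolding d_def partial_prod_eqs by simp_all
  qed
  define \<sigma> where "\<sigma> j = (if j < m then c j * k + d j else j)" for j
  have div_mod: "(c j * k + d j) div k = c j" "(c j * k + d j) mod k = d j" for j
    using d(1)[of j] by simp_all
  have inj: "inj_on \<sigma> {..<m}"
  proof (rule inj_onI)
    fix i j assume ij: "i \<in> {..<m}" "j \<in> {..<m}" "\<sigma> i = \<sigma> j"
    then have "c i = c j" "d i = d j" using div_mod[of i] div_mod[of j] by (simp_all add: \<sigma>_def)
    then have "digit ms s i = digit ms s j" if "s \<in> {1..l}" for s
      using c(2)[OF that, of i] c(2)[OF that, of j] d(2)[OF that, of i] d(2)[OF that, of j]
        div_mod_eqI[of "digit ms s i" "ks s" "digit ms s j"] by simp
    then show "i = j" using ij by (intro digits_inject[of i ms l j]) (simp_all add: partial_prod_eqs)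
  qed
  have "c j * k + d j < m" for j
  proof -
    have "c j * k + d j < Suc (c j) * k" using d(1)[of j] by simp
    also have "\<dots> \<le> n * k" by (rule mult_le_mono1) (use c(1)[of j] in simp)
    finally show ?thesis by (simp add: m_eq mult.commute)
  qed
  then have "\<sigma> ` {..<m} \<subseteq> {..<m}" by (auto simp: \<sigma>_def)
  from endo_inj_surj[OF _ this inj] have "bij_betw \<sigma> {..<m} {..<m}"
    using inj by (simp add: bij_betw_def)
  then have p: "\<sigma> permutes {..<m}" by (rule bij_imp_permutes) (simp add: \<sigma>_def)
  have "kronecker_desc (\<lambda>s. kronecker (1\<^sub>m (ns s)) (ones_mat 1 (ks s))) l
    = (kronecker (1\<^sub>m n) (ones_mat 1 k) * perm_mat m \<sigma> :: int mat)" (is "?A = ?B")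
  proof (rule eq_matI)
    have "?A \<in> carrier_mat (partial_prod ns (Suc l)) (partial_prod ms (Suc l))"
      by (rule dim_kronecker_desc) (use ms_eq in \<open>simp add: kronecker_def ones_mat_def mult.commute\<close>)
    then have A: "?A \<in> carrier_mat n m" unfolding partial_prod_eqs .
    have B: "dim_row ?B = n" "dim_col ?B = m" by (simp_all add: kronecker_def ones_mat_def perm_mat_def)
    show "dim_row ?A = dim_row ?B" "dim_col ?A = dim_col ?B" using A B by simp_all
    fix i j assume "i < dim_row ?B" "j < dim_col ?B"
    then have ij: "i < n" "j < m" using B by simp_all
    have "(\<forall>s\<in>{1..l}. digit ns s i = digit ms s j div ks s) \<longleftrightarrow> i = c j"
    proof
      assume "\<forall>s\<in>{1..l}. digit ns s i = digit ms s j div ks s"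
      then show "i = c j"
        using ij c(1)[of j] c(2)[of _ j] by (intro digits_inject[of i ns l "c j"]) (simp_all add: partial_prod_eqs)
    qed (simp add: c(2))
    moreover have "\<sigma> j div k = c j" using ij div_mod by (simp add: \<sigma>_def)
    ultimately show "?A $$ (i, j) = ?B $$ (i, j)"
      unfolding sigma_matrix_entry[OF ij] sigma_product_entry[OF p ij] by simp
  qed
  then show ?thesis using p unfolding is_sigma_def by blast
qed

lemma tau_matrix_entry:
  assumes "i < m" "j < m"
  shows "kronecker_desc (\<lambda>s. perm_mat (ms s) (full_cycle (ms s))) l $$ (i, j)
    = (if \<forall>s\<in>{1..l}. digit ms s i = Suc (digit ms s j) mod ms s then 1 else (0 :: int))"
proof -
  let ?A = "\<lambda>s. perm_mat (ms s) (full_cycle (ms s)) :: int mat"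
  have A: "?A s \<in> carrier_mat (ms s) (ms s)" for s by (simp add: perm_mat_def)
  have "?A s $$ (digit ms s i, digit ms s j) = (if digit ms s i = Suc (digit ms s j) mod ms s then 1 else 0)"
    if s: "s \<in> {1..l}" for s
    using digit_less[of ms s, OF ms_pos[OF s]] by (simp add: perm_mat_def full_cycle_def)
  then have "(\<Prod>s\<in>{1..l}. ?A s $$ (digit ms s i, digit ms s j))
    = (\<Prod>s\<in>{1..l}. if digit ms s i = Suc (digit ms s j) mod ms s then 1 else 0)"
    by (rule prod.cong[OF refl])
  then show ?thesis
    using kronecker_desc_index[of l ?A ms ms i j, OF A] assms
    by (simp only: partial_prod_eqs prod_indicator finite_atLeastAtMost)
qed

lemma tau_digit:
  assumes \<tau>: "is_tau \<tau>" and j: "j < m" and s: "s \<in> {1..l}"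
  shows "digit ms s (\<tau> j) = Suc (digit ms s j) mod ms s"
proof -
  have p: "\<tau> permutes {..<m}" using \<tau> by (simp add: is_tau_def)
  have i: "\<tau> j < m" using permutes_in_image[OF p, of j] j by simp
  have "kronecker_desc (\<lambda>s. perm_mat (ms s) (full_cycle (ms s))) l $$ (\<tau> j, j) = (1 :: int)"
    using \<tau> i j by (simp add: is_tau_def perm_mat_def)
  then show ?thesis using s unfolding tau_matrix_entry[OF i j] by (simp split: if_splits)
qed

text \<open>The Kronecker product of the cycles adds 1 to every digit separately, without
  carry.\<close>

lemma ex_tau: "\<exists>\<tau>. is_tau \<tau>"
proof -
  define t where "t j = (\<Sum>s\<in>{1..l}. partial_prod ms s * (Suc (digit ms s j) mod ms s))" for j
  have t: "t j < m" "\<And>s. s \<in> {1..l} \<Longrightarrow> digit ms s (t j) = Suc (digit ms s j) mod ms s" for j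
  proof -
    have "Suc (digit ms s j) mod ms s < ms s" if s: "s \<in> {1..l}" for s using ms_pos[OF s] by simp
    from number_of_digits[of l "\<lambda>s. Suc (digit ms s j) mod ms s" ms, OF this]
    show "t j < m" "\<And>s. s \<in> {1..l} \<Longrightarrow> digit ms s (t j) = Suc (digit ms s j) mod ms s"
      unfolding t_def partial_prod_eqs by simp_all
  qed
  define \<tau> where "\<tau> j = (if j < m then t j else j)" for j
  have inj: "inj_on \<tau> {..<m}"
  proof (rule inj_onI)
    fix i j assume ij: "i \<in> {..<m}" "j \<in> {..<m}" "\<tau> i = \<tau> j"
    then have eq: "t i = t j" by (simp add: \<tau>_def)
    have "digit ms s i = digit ms s j" if s: "s \<in> {1..l}" for s
    proof -
      have "Suc (digit ms s i) mod ms s = Suc (digit ms s j) mod ms s"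
        using t(2)[OF s, of i] t(2)[OF s, of j] eq by simp
      then show ?thesis
        using digit_less[of ms s, OF ms_pos[OF s], of i] digit_less[of ms s, OF ms_pos[OF s], of j]
        by (auto simp: mod_Suc split: if_splits)
    qed
    then show "i = j" using ij by (intro digits_inject[of i ms l j]) (simp_all add: partial_prod_eqs)
  qed
  have "\<tau> ` {..<m} \<subseteq> {..<m}" using t(1) by (auto simp: \<tau>_def)
  from endo_inj_surj[OF _ this inj] have "bij_betw \<tau> {..<m} {..<m}"
    using inj by (simp add: bij_betw_def)
  then have p: "\<tau> permutes {..<m}" by (rule bij_imp_permutes) (simp add: \<tau>_def)
  have "kronecker_desc (\<lambda>s. perm_mat (ms s) (full_cycle (ms s))) l = (perm_mat m \<tau> :: int mat)"
    (is "?A = ?B")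
  proof (rule eq_matI)
    have "?A \<in> carrier_mat (partial_prod ms (Suc l)) (partial_prod ms (Suc l))"
      by (rule dim_kronecker_desc) (simp add: perm_mat_def)
    then have A: "?A \<in> carrier_mat m m" unfolding partial_prod_eqs .
    show "dim_row ?A = dim_row ?B" "dim_col ?A = dim_col ?B" using A by (simp_all add: perm_mat_def)
    fix i j assume "i < dim_row ?B" "j < dim_col ?B"
    then have ij: "i < m" "j < m" by (simp_all add: perm_mat_def)
    have "(\<forall>s\<in>{1..l}. digit ms s i = Suc (digit ms s j) mod ms s) \<longleftrightarrow> i = t j"
    proof
      assume "\<forall>s\<in>{1..l}. digit ms s i = Suc (digit ms s j) mod ms s"
      then show "i = t j"
        using ij t(1)[of j] t(2)[of _ j] by (intro digits_inject[of i ms l "t j"]) (simp_all add: partial_prod_eqs)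
    qed (simp add: t(2))
    then show "?A $$ (i, j) = ?B $$ (i, j)"
      unfolding tau_matrix_entry[OF ij] using ij by (simp add: perm_mat_def \<tau>_def)
  qed
  then show ?thesis using p unfolding is_tau_def by blast
qed

section \<open>Factorisation of the Kronecker product of the circulant matrices\<close>

lemma digits_le:
  assumes "i < partial_prod r (Suc l)" "j < partial_prod r (Suc l)"
    and "\<And>s. s \<in> {1..l} \<Longrightarrow> digit r s i \<le> digit r s j"
  shows "i \<le> j"
proof -
  have "(\<Sum>s\<in>{1..l}. partial_prod r s * digit r s i) \<le> (\<Sum>s\<in>{1..l}. partial_prod r s * digit r s j)"
    by (rule sum_mono) (use assms(3) in simp)
  then show ?thesis using eq_sum_digits[OF assms(1)] eq_sum_digits[OF assms(2)] by simp
qed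

text \<open>The parameter y of the circulant matrix for the factor s: exponents there are multiples
  of M_s k_s once the column weight has been split off.\<close>

definition block_base :: "complex \<Rightarrow> nat \<Rightarrow> complex" where
  "block_base z s = z ^ (partial_prod ms s * ks s)"

definition lower_mat :: "complex \<Rightarrow> nat \<Rightarrow> nat \<Rightarrow> complex" where
  "lower_mat z i b = (\<Prod>s\<in>{1..l}. lower_fac (block_base z s) (ns s) (digit ns s i) (digit ns s b))"

definition upper_mat :: "complex \<Rightarrow> nat \<Rightarrow> nat \<Rightarrow> complex" where
  "upper_mat z b c = (\<Prod>s\<in>{1..l}. upper_fac (block_base z s) (ns s) (digit ns s b) (digit ns s c))"

text \<open>The power of z coming from the parts k_s - 1 - d of \<open>circulant_exponent\<close>.
  It is the same for all rows and hence leaves the wreath determinant as a factor.\<close>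

definition column_weight :: "complex \<Rightarrow> nat \<Rightarrow> complex" where
  "column_weight z j = (\<Prod>s\<in>{1..l}. z ^ (partial_prod ms s * (ks s - 1 - digit ms s j mod ks s)))"

text \<open>The exponent \<open>\<epsilon>\<^sub>l(i, j)\<close> is the sum of \<open>M\<^sub>s * offset i j s\<close> over \<open>s\<close>.\<close>

definition offset :: "nat \<Rightarrow> nat \<Rightarrow> nat \<Rightarrow> nat" where
  "offset i j s = nat ((int (ks s * digit ns s i) - int (digit ms s j)) mod int (ms s))"

lemma offset_less: "s \<in> {1..l} \<Longrightarrow> offset i j s < ms s"
  using ms_pos[of s] by (simp add: offset_def nat_less_iff)

text \<open>By \<open>digits_le\<close> the larger index has a larger digit somewhere, and the
  triangular factor belonging to that digit vanishes. So triangularity passes to the Kronecker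
  product.\<close>

lemma lower_mat_eq_0:
  assumes "i < n" "j < n" "i < j"
  shows "lower_mat z i j = 0"
proof -
  have "\<not> j \<le> i" using assms(3) by simp
  then obtain s where s: "s \<in> {1..l}" "\<not> digit ns s j \<le> digit ns s i"
    using digits_le[of j ns i] assms by (auto simp: partial_prod_eqs)
  have "lower_fac (block_base z s) (ns s) (digit ns s i) (digit ns s j) = 0"
    using s(2) by (auto simp: lower_fac_def)
  then show ?thesis unfolding lower_mat_def using s(1) by (intro prod_zero) auto
qed

lemma upper_mat_eq_0:
  assumes "i < n" "j < n" "j < i"
  shows "upper_mat z i j = 0"
proof -
  have "\<not> i \<le> j" using assms(3) by simp
  then obtain s where s: "s \<in> {1..l}" "\<not> digit ns s i \<le> digit ns s j"
    using digits_le[of i ns j] assms by (auto simp: partial_prod_eqs)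
  have "upper_fac (block_base z s) (ns s) (digit ns s i) (digit ns s j) = 0"
    using s(2) by (auto simp: upper_fac_def)
  then show ?thesis unfolding upper_mat_def using s(1) by (intro prod_zero) auto
qed

lemma prod_lower_mat: "(\<Prod>i<n. lower_mat z i i) = 1"
  by (simp add: lower_mat_def lower_fac_def)

text \<open>Each circulant factor contributes its diagonal product, with exponent n_s - 1, to the
  power n / n_s. The k-th power then gives the exponent (n_s - 1) (n / n_s) k = m - m / n_s.\<close>

lemma prod_upper_mat:
  assumes z: "z \<noteq> 0"
  shows "(\<Prod>i<n. upper_mat z i i) ^ k
    = (\<Prod>s\<in>{1..l}. (z ^ (partial_prod ms s * ms s) - 1) ^ (m - m div ns s))"
proof -
  have swap: "(\<Prod>i<n. upper_mat z i i)
      = (\<Prod>s\<in>{1..l}. \<Prod>i<n. upper_fac (block_base z s) (ns s) (digit ns s i) (digit ns s i))"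
    unfolding upper_mat_def by (rule prod.swap)
  show ?thesis
    unfolding swap prod_power_distrib[where A = "{1..l}"]
  proof (rule prod.cong[OF refl])
    fix s assume s: "s \<in> {1..l}"
    have y: "block_base z s \<noteq> 0" using z by (simp add: block_base_def)
    have yn: "block_base z s ^ ns s = z ^ (partial_prod ms s * ms s)"
      by (simp add: block_base_def ms_eq[OF s] power_mult[symmetric] mult.assoc)
    have "(\<Prod>i<n. upper_fac (block_base z s) (ns s) (digit ns s i) (digit ns s i))
        = ((z ^ (partial_prod ms s * ms s) - 1) ^ (ns s - 1)) ^ (n div ns s)"
      using prod_digit[OF s, of ns "\<lambda>b. upper_fac (block_base z s) (ns s) b b"] ns_pos[OF s]
      by (simp add: partial_prod_eqs prod_upper_fac[OF y] yn)
    moreover have "(ns s - 1) * (n div ns s) * k = m - m div ns s"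
    proof -
      define q where "q = n div ns s"
      have n: "n = q * ns s" using n_div_ns[OF s] by (simp add: q_def)
      have "m div ns s = k * q" using ns_pos[OF s] by (simp add: m_eq n)
      then show ?thesis by (simp add: q_def[symmetric] m_eq n algebra_simps diff_mult_distrib)
    qed
    ultimately show "(\<Prod>i<n. upper_fac (block_base z s) (ns s) (digit ns s i) (digit ns s i)) ^ k
        = (z ^ (partial_prod ms s * ms s) - 1) ^ (m - m div ns s)"
      by (simp add: power_mult[symmetric])
  qed
qed

text \<open>Each b < k_s occurs as remainder of the digit in m / k_s columns, and the numbers k_s -
  1 - b have the sum k_s (k_s - 1) / 2.\<close>

lemma prod_column_weight:
  "(\<Prod>j<m. column_weight z j) = (\<Prod>s\<in>{1..l}. z ^ (m * partial_prod ms s * (ks s - 1) div 2))"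
proof -
  have "(\<Prod>j<m. column_weight z j)
      = (\<Prod>s\<in>{1..l}. \<Prod>j<m. z ^ (partial_prod ms s * (ks s - 1 - digit ms s j mod ks s)))"
    unfolding column_weight_def by (rule prod.swap)
  also have "\<dots> = (\<Prod>s\<in>{1..l}. z ^ (m * partial_prod ms s * (ks s - 1) div 2))"
  proof (rule prod.cong[OF refl])
    fix s assume s: "s \<in> {1..l}"
    let ?M = "partial_prod ms s"
    define f where "f b = z ^ (?M * (ks s - 1 - b))" for b
    define S where "S = (\<Sum>b<ks s. ?M * (ks s - 1 - b))"
    have "(\<Sum>b<ks s. ks s - 1 - b) = \<Sum>{..<ks s}"
      using sum.nat_diff_reindex[of "\<lambda>b. b" "ks s"] by simp
    then have S: "2 * S = ?M * (ks s * (ks s - 1))"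
      using gauss_sum_nat[of "ks s - 1"] ks_pos[OF s]
      by (simp add: S_def sum_distrib_left[symmetric] lessThan_Suc_atMost[symmetric] Sum_Ico_nat atLeast0LessThan[symmetric])
    have "(\<Prod>j<m. f (digit ms s j mod ks s)) = (\<Prod>b<ms s. f (b mod ks s)) ^ (m div ms s)"
      using prod_digit[of s l ms, OF s ms_pos[OF s], of "\<lambda>b. f (b mod ks s)"] by (simp add: partial_prod_eqs)
    also have "(\<Prod>b<ms s. f (b mod ks s)) = (\<Prod>b<ks s. f b) ^ ns s"
      using prod_div_mod[of f 1 "ks s" "ns s"] by (simp add: ms_eq[OF s])
    also have "(\<Prod>b<ks s. f b) = z ^ S" unfolding f_def S_def by (simp add: power_sum)
    also have "((z ^ S) ^ ns s) ^ (m div ms s) = z ^ (S * ns s * (m div ms s))"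
      by (simp add: power_mult)
    also have "S * ns s * (m div ms s) = m * ?M * (ks s - 1) div 2"
    \<comment> \<open>Comparing the doubled exponents shows that the division by 2 is exact.\<close>
    proof -
      have "2 * (S * ns s * (m div ms s)) = (2 * S) * (ns s * (m div ms s))" by simp
      also have "\<dots> = ?M * (ks s - 1) * (m div ms s * (ks s * ns s))"
        unfolding S by (simp only: mult_ac)
      also have "\<dots> = m * ?M * (ks s - 1)" using m_div_ms[OF s] ms_eq[OF s] by simp
      finally show ?thesis by simp
    qed
    finally show "(\<Prod>j<m. z ^ (?M * (ks s - 1 - digit ms s j mod ks s))) = z ^ (m * ?M * (ks s - 1) div 2)"
      by (simp add: f_def)
  qed
  finally show ?thesis .
qed

text \<open>For each digit, \<open>circulant_exponent\<close> splits off the column weight and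
  \<open>circulant_factorisation\<close> expands what remains; \<open>sum_prod_digits\<close> merges
  the expansions into a single sum over \<open>b\<close>.\<close>

lemma entry_factorisation:
  assumes z: "z \<noteq> 0" and \<sigma>: "is_sigma \<sigma>" and \<tau>: "is_tau \<tau>" and i: "i < n" and j: "j < m"
  shows "(\<Prod>s\<in>{1..l}. z ^ (partial_prod ms s * offset i (\<tau> j) s))
    = (\<Sum>b<n. lower_mat z i b * upper_mat z b (\<sigma> j div k)) * column_weight z j"
proof -
  let ?y = "block_base z" and ?c = "\<sigma> j div k"
  have p: "\<sigma> permutes {..<m}" using \<sigma> by (simp add: is_sigma_def)
  have "(\<Sum>b<n. lower_mat z i b * upper_mat z b ?c)
      = (\<Sum>b<n. \<Prod>s\<in>{1..l}. lower_fac (?y s) (ns s) (digit ns s i) (digit ns s b) *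
          upper_fac (?y s) (ns s) (digit ns s b) (digit ns s ?c))"
    by (simp add: lower_mat_def upper_mat_def prod.distrib)
  also have "\<dots> = (\<Prod>s\<in>{1..l}. \<Sum>b<ns s. lower_fac (?y s) (ns s) (digit ns s i) b *
      upper_fac (?y s) (ns s) b (digit ns s ?c))"
    using sum_prod_digits[of "\<lambda>s b. lower_fac (?y s) (ns s) (digit ns s i) b *
      upper_fac (?y s) (ns s) b (digit ns s ?c)" ns l] by (simp add: partial_prod_eqs)
  finally have LU: "(\<Sum>b<n. lower_mat z i b * upper_mat z b ?c)
      = (\<Prod>s\<in>{1..l}. \<Sum>b<ns s. lower_fac (?y s) (ns s) (digit ns s i) b *
          upper_fac (?y s) (ns s) b (digit ns s ?c))" .
  show ?thesis
    unfolding LU column_weight_def prod.distrib[symmetric]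
  proof (rule prod.cong[OF refl])
    fix s assume s: "s \<in> {1..l}"
    let ?i = "digit ns s i" and ?j = "digit ms s j"
    have di: "?i < ns s" by (rule digit_less) (rule ns_pos[OF s])
    have dj: "?j < ks s * ns s" using digit_less[of ms s j, OF ms_pos[OF s]] ms_eq[OF s] by simp
    have dc: "digit ns s ?c = ?j div ks s" by (rule sigma_digit[OF \<sigma> j s])
    have "?j div ks s < ns s" using dj by (simp add: less_mult_imp_div_less mult.commute)
    moreover have "?y s \<noteq> 0" using z by (simp add: block_base_def)
    ultimately have "(\<Sum>b<ns s. lower_fac (?y s) (ns s) ?i b * upper_fac (?y s) (ns s) b (digit ns s ?c))
        = ?y s ^ ((?i + (ns s - 1 - ?j div ks s)) mod ns s)"
      unfolding dc using circulant_factorisation[OF _ di] by simp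
    moreover have "offset i (\<tau> j) s = ks s * ((?i + (ns s - 1 - ?j div ks s)) mod ns s) + (ks s - 1 - ?j mod ks s)"
      using circulant_exponent[OF di dj] unfolding offset_def tau_digit[OF \<tau> j s] ms_eq[OF s]
      by (simp only: nat_int)
    ultimately show "z ^ (partial_prod ms s * offset i (\<tau> j) s)
      = (\<Sum>b<ns s. lower_fac (?y s) (ns s) ?i b * upper_fac (?y s) (ns s) b (digit ns s ?c)) *
        z ^ (partial_prod ms s * (ks s - 1 - ?j mod ks s))"
      by (simp add: block_base_def power_mult[symmetric] power_add[symmetric] mult.assoc distrib_left)
  qed
qed

lemma wr_offsets:
  assumes z: "z \<noteq> 0" and \<sigma>: "is_sigma \<sigma>" and \<tau>: "is_tau \<tau>"
  shows "wr k n (\<lambda>i j. \<Prod>s\<in>{1..l}. z ^ (partial_prod ms s * offset i j s))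
    = omega k n (\<sigma> \<circ> inv_into UNIV \<tau>) * (fact k / of_nat k ^ k) ^ n *
      ((\<Prod>s\<in>{1..l}. z ^ (m * partial_prod ms s * (ks s - 1) div 2)) *
       (\<Prod>s\<in>{1..l}. (z ^ (partial_prod ms s * ms s) - 1) ^ (m - m div ns s)))"
proof -
  have \<sigma>p: "\<sigma> permutes {..<m}" and \<tau>p: "\<tau> permutes {..<m}"
    using \<sigma> \<tau> by (simp_all add: is_sigma_def is_tau_def)
  note \<tau>i = permutes_inv[OF \<tau>p]
  define \<rho> where "\<rho> = \<sigma> \<circ> inv_into UNIV \<tau>"
  have \<rho>: "\<rho> permutes {..<k * n}" unfolding \<rho>_def m_eq[symmetric] by (rule permutes_compose[OF \<tau>i \<sigma>p])
  define E :: "nat \<Rightarrow> nat \<Rightarrow> complex" where "E = (\<lambda>i j. if i = \<rho> j div k then 1 else 0)"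
  define d where "d j = column_weight z (inv_into UNIV \<tau> j)" for j
  have "wr k n (\<lambda>i j. \<Prod>s\<in>{1..l}. z ^ (partial_prod ms s * offset i j s))
      = wr k n (\<lambda>i j. (\<Sum>b<n. lower_mat z i b * (\<Sum>c<n. upper_mat z b c * E c j)) * d j)"
  proof (rule wr_cong)
    fix i j assume i: "i < n" and "j < k * n"
    then have j: "j < m" by (simp add: m_eq)
    \<comment> \<open>The factorisation is available for the columns reordered by \<tau>, so column
      \<open>j\<close> has to be read at its preimage. This is how the inverse of \<tau>
      enters.\<close>
    let ?j = "inv_into UNIV \<tau> j"
    have j': "?j < m" "\<tau> ?j = j"
      using permutes_in_image[OF \<tau>i, of j] permutes_inverses(1)[OF \<tau>p] j by simp_all
    have "\<rho> j < k * n" using permutes_in_image[OF \<rho>, of j] j by (simp add: m_eq)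
    then have "\<rho> j div k < n" by (simp add: less_mult_imp_div_less mult.commute)
    then have "(\<Sum>c<n. upper_mat z b c * E c j) = upper_mat z b (\<rho> j div k)" for b
      by (simp add: E_def if_distrib[of "(*) _"] cong: if_cong)
    then show "(\<Prod>s\<in>{1..l}. z ^ (partial_prod ms s * offset i j s))
        = (\<Sum>b<n. lower_mat z i b * (\<Sum>c<n. upper_mat z b c * E c j)) * d j"
      using entry_factorisation[OF z \<sigma> \<tau> i j'(1)] j'(2) by (simp add: \<rho>_def d_def)
  qed
  also have "\<dots> = (\<Prod>j<k * n. d j) * wr k n (\<lambda>i j. \<Sum>b<n. lower_mat z i b * (\<Sum>c<n. upper_mat z b c * E c j))"
    by (rule wr_mult_columns)
  also have "wr k n (\<lambda>i j. \<Sum>b<n. lower_mat z i b * (\<Sum>c<n. upper_mat z b c * E c j))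
      = (\<Prod>i<n. lower_mat z i i) ^ k * wr k n (\<lambda>b j. \<Sum>c<n. upper_mat z b c * E c j)"
    by (rule wr_triangular_mult[OF k_pos, where \<rho> = "\<lambda>i. i"]) (auto intro: lower_mat_eq_0)
  also have "wr k n (\<lambda>b j. \<Sum>c<n. upper_mat z b c * E c j) = (\<Prod>i<n. upper_mat z i i) ^ k * wr k n E"
    by (rule wr_triangular_mult[OF k_pos, where \<rho> = "\<lambda>i. n - i"])
      (auto intro!: upper_mat_eq_0 inj_onI)
  also have "wr k n E = omega k n \<rho> * (fact k / of_nat k ^ k) ^ n"
    unfolding E_def wr_permutation[OF k_pos \<rho>] by (rule coset_sum_eq_omega[OF k_pos \<rho>])
  also have "(\<Prod>j<k * n. d j) = (\<Prod>j<m. column_weight z j)"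
    unfolding d_def m_eq[symmetric] using prod.permute[OF \<tau>i, of "column_weight z"] by (simp add: comp_def)
  finally show ?thesis
    unfolding prod_lower_mat prod_upper_mat[OF z] prod_column_weight \<rho>_def
    by (simp only: power_one mult_1_left mult_ac)
qed

section \<open>Identification of the matrix of the pair and of its determinant\<close>

lemma std_ordering_carrier: "std_ordering l ms j \<in> carrier (Zprod l ms)"
  using ms_pos by (auto simp: Zprod_def std_ordering_def carrier_integer_mod_group)

text \<open>Reducing a multiple of k_s modulo m_s = k_s n_s reduces the cofactor modulo n_s, which
  gives a digit in the radix \<open>ns\<close>.\<close>

lemma sub_ordering_eq:
  "sub_ordering l ms ns i = (\<lambda>s\<in>{1..l}. int (ks s * digit ns s i))"
proof -
  have "(ms s div ns s * (i div partial_prod ns s)) mod ms s = ks s * digit ns s i" if "s \<in> {1..l}" for s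
    using ms_eq[OF that] by (simp add: digit_def mult_mod_right ks_def)
  then show ?thesis by (auto simp: sub_ordering_def restrict_def)
qed

text \<open>The components of the quotient are the offsets, and these are the digits of the
  exponent. So the exponent is the number of the quotient in the standard ordering.\<close>

lemma quotient_eq_std_ordering:
  "sub_ordering l ms ns i \<otimes>\<^bsub>Zprod l ms\<^esub> inv\<^bsub>Zprod l ms\<^esub> std_ordering l ms j
    = std_ordering l ms (\<Sum>s\<in>{1..l}. partial_prod ms s * offset i j s)"
proof -
  have inv: "inv\<^bsub>Zprod l ms\<^esub> std_ordering l ms j
      = (\<lambda>s\<in>{1..l}. inv\<^bsub>integer_mod_group (ms s)\<^esub> std_ordering l ms j s)"
    using std_ordering_carrier[of j] unfolding Zprod_def by (intro inv_product_group) simp_all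
  have comp: "inv\<^bsub>integer_mod_group (ms s)\<^esub> std_ordering l ms j s = (- int (digit ms s j)) mod int (ms s)"
    if s: "s \<in> {1..l}" for s
  proof -
    have "std_ordering l ms j s = int (digit ms s j)" using s by (simp add: std_ordering_def digit_def)
    moreover have "int (digit ms s j) \<in> carrier (integer_mod_group (ms s))"
      using ms_pos[OF s] digit_less[of ms s j] by (simp add: carrier_integer_mod_group)
    ultimately show ?thesis by simp
  qed
  have digits: "digit ms s (\<Sum>s\<in>{1..l}. partial_prod ms s * offset i j s) = offset i j s"
    if "s \<in> {1..l}" for s
    using number_of_digits[of l "offset i j" ms] offset_less that by blast
  show ?thesis
  proof
    fix s
    show "(sub_ordering l ms ns i \<otimes>\<^bsub>Zprod l ms\<^esub> inv\<^bsub>Zprod l ms\<^esub> std_ordering l ms j) s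
      = std_ordering l ms (\<Sum>s\<in>{1..l}. partial_prod ms s * offset i j s) s"
    proof (cases "s \<in> {1..l}")
      case True
      have "(sub_ordering l ms ns i \<otimes>\<^bsub>Zprod l ms\<^esub> inv\<^bsub>Zprod l ms\<^esub> std_ordering l ms j) s
          = (int (ks s * digit ns s i) + (- int (digit ms s j)) mod int (ms s)) mod int (ms s)"
        unfolding inv using True comp[OF True] by (simp add: Zprod_def sub_ordering_eq)
      also have "\<dots> = (int (ks s * digit ns s i) - int (digit ms s j)) mod int (ms s)"
        by (simp only: mod_add_right_eq diff_conv_add_uminus)
      also have "\<dots> = int (offset i j s)" using ms_pos[OF True] by (simp add: offset_def)
      finally show ?thesis
        using True digits[OF True] by (simp add: std_ordering_def digit_def)
    next
      case False
      then show ?thesis by (simp add: Zprod_def std_ordering_def del: atLeastAtMost_iff)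
    qed
  qed
qed

lemma inj_std_ordering: "inj_on (std_ordering l ms) {..<m}"
proof (rule inj_onI)
  fix i j assume ij: "i \<in> {..<m}" "j \<in> {..<m}" and eq: "std_ordering l ms i = std_ordering l ms j"
  have "digit ms s i = digit ms s j" if "s \<in> {1..l}" for s
    using fun_cong[OF eq, of s] that by (simp add: std_ordering_def digit_def)
  then show "i = j" using ij by (intro digits_inject[of i ms l j]) (simp_all add: partial_prod_eqs)
qed

lemma principal_spec_quotient:
  "principal_spec l ms (sub_ordering l ms ns i \<otimes>\<^bsub>Zprod l ms\<^esub> inv\<^bsub>Zprod l ms\<^esub> std_ordering l ms j)
    = monom 1 (\<Sum>s\<in>{1..l}. partial_prod ms s * offset i j s)"
proof -
  have "(\<Sum>s\<in>{1..l}. partial_prod ms s * offset i j s) < m"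
    using number_of_digits[of l "offset i j" ms] offset_less by (simp add: partial_prod_eqs)
  then show ?thesis
    unfolding principal_spec_def quotient_eq_std_ordering m_def[symmetric]
    by (simp add: inv_into_f_f[OF inj_std_ordering])
qed

lemma order_Zprod: "order (Zprod l ms) = m"
proof -
  have "card (carrier (integer_mod_group (ms s))) = ms s" if "s \<in> {1..l}" for s
    using ms_pos[OF that] by (simp add: carrier_integer_mod_group)
  then show ?thesis by (simp add: order_def Zprod_def card_PiE m_def)
qed

lemma card_Zprod_sub: "card (Zprod_sub l ms ks) = n"
proof -
  have "card (generate (integer_mod_group (ms s)) {int (ks s) mod int (ms s)}) = ns s" if "s \<in> {1..l}" for s
    using card_generate_multiple[OF ks_pos[OF that] ns_pos[OF that]] ms_eq[OF that] by simp
  then show ?thesis by (simp add: Zprod_sub_def card_PiE n_def)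
qed

lemma wrdet_pair_eq:
  assumes "is_sigma \<sigma>" "is_tau \<tau>"
  shows "wrdet_pair (Zprod l ms) (Zprod_sub l ms ks) (sub_ordering l ms ns)
      (std_ordering l ms) (principal_spec l ms)
    = Polynomial.smult (omega k n (\<sigma> \<circ> inv_into UNIV \<tau>) * (fact k / of_nat k ^ k) ^ n)
        ((\<Prod>s=1..l. monom 1 (m * partial_prod ms s * (ks s - 1) div 2)) *
         (\<Prod>s=1..l. (monom 1 (partial_prod ms s * ms s) - 1) ^ (m - m div ns s)))"
proof (rule poly_eqI_nonzero)
  fix z :: complex assume z: "z \<noteq> 0"
  let ?X = "pair_matrix (Zprod l ms) (Zprod_sub l ms ks) (sub_ordering l ms ns)
    (std_ordering l ms) (principal_spec l ms)"
  have "order (Zprod l ms) div card (Zprod_sub l ms ks) = k"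
    using n_pos by (simp add: order_Zprod card_Zprod_sub m_eq)
  then have "poly (wrdet_pair (Zprod l ms) (Zprod_sub l ms ks) (sub_ordering l ms ns)
      (std_ordering l ms) (principal_spec l ms)) z = wr k n (\<lambda>i j. poly (?X $$ (i, j)) z)"
    unfolding wrdet_pair_def
    by (simp only:) (rule poly_wrdet, simp add: pair_matrix_def order_Zprod card_Zprod_sub m_eq)
  also have "\<dots> = wr k n (\<lambda>i j. \<Prod>s\<in>{1..l}. z ^ (partial_prod ms s * offset i j s))"
    by (rule wr_cong)
      (simp add: pair_matrix_def order_Zprod card_Zprod_sub m_eq principal_spec_quotient
        poly_monom power_sum)
  finally show "poly (wrdet_pair (Zprod l ms) (Zprod_sub l ms ks) (sub_ordering l ms ns)
      (std_ordering l ms) (principal_spec l ms)) z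
    = poly (Polynomial.smult (omega k n (\<sigma> \<circ> inv_into UNIV \<tau>) * (fact k / of_nat k ^ k) ^ n)
        ((\<Prod>s=1..l. monom 1 (m * partial_prod ms s * (ks s - 1) div 2)) *
         (\<Prod>s=1..l. (monom 1 (partial_prod ms s * ms s) - 1) ^ (m - m div ns s)))) z"
    using wr_offsets[OF z assms] by (simp add: poly_prod poly_monom)
qed

end

text \<open>Existence of \<sigma> and \<tau> is part of the claim, so that the statement about all
  of them is not vacuous. Both divisions are exact: n_s divides m, so \<open>m - m div ns s\<close>
  is m (1 - 1/n_s), and k_s divides m, so m M_s (k_s - 1) is even.\<close>

theorem theorem2:
  fixes l :: nat and ms ns :: "nat \<Rightarrow> nat"
  defines "ks \<equiv> \<lambda>s. ms s div ns s"
    and "M \<equiv> partial_prod ms"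
    and "m \<equiv> \<Prod>s\<in>{1..l}. ms s"
    and "n \<equiv> \<Prod>s\<in>{1..l}. ns s"
    and "k \<equiv> \<Prod>s\<in>{1..l}. ms s div ns s"
  defines "is_sigma \<equiv> \<lambda>\<sigma>. \<sigma> permutes {..<m} \<and>
      kronecker_desc (\<lambda>s. kronecker (1\<^sub>m (ns s)) (ones_mat 1 (ks s))) l
        = (kronecker (1\<^sub>m n) (ones_mat 1 k) * perm_mat m \<sigma> :: int mat)"
    and "is_tau \<equiv> \<lambda>\<tau>. \<tau> permutes {..<m} \<and>
      kronecker_desc (\<lambda>s. perm_mat (ms s) (full_cycle (ms s))) l = (perm_mat m \<tau> :: int mat)"
  assumes "l \<ge> 1"
    and "\<And>s. s \<in> {1..l} \<Longrightarrow> ms s > 0"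
    and "\<And>s. s \<in> {1..l} \<Longrightarrow> ns s > 0"
    and "\<And>s. s \<in> {1..l} \<Longrightarrow> ns s dvd ms s"
  shows "(\<exists>\<sigma>. is_sigma \<sigma>) \<and> (\<exists>\<tau>. is_tau \<tau>) \<and>
    (\<forall>\<sigma> \<tau>. is_sigma \<sigma> \<longrightarrow> is_tau \<tau> \<longrightarrow>
      wrdet_pair (Zprod l ms) (Zprod_sub l ms ks) (sub_ordering l ms ns)
          (std_ordering l ms) (principal_spec l ms)
        = Polynomial.smult (omega k n (\<sigma> \<circ> inv_into UNIV \<tau>) * (fact k / of_nat k ^ k) ^ n)
            ((\<Prod>s=1..l. monom 1 (m * M s * (ks s - 1) div 2)) *
             (\<Prod>s=1..l. (monom 1 (M s * ms s) - 1) ^ (m - m div ns s))))"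
proof -
  interpret D: divisor_tuple l ms ns by unfold_locales fact+
  have ks: "D.ks = ks" by (auto simp: D.ks_def ks_def)
  have mnk: "D.m = m" "D.n = n" "D.k = k"
    by (simp_all add: D.m_def D.n_def D.k_def D.ks_def m_def n_def k_def)
  have is_sigma: "D.is_sigma = is_sigma" and is_tau: "D.is_tau = is_tau"
    unfolding D.is_sigma_def D.is_tau_def is_sigma_def is_tau_def ks mnk by (rule ext, rule refl)+
  show ?thesis
    using D.ex_sigma D.ex_tau D.wrdet_pair_eq unfolding ks mnk is_sigma is_tau M_def by blast
qed

end
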